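(* For all integers $n\ge0$ and $k\ge0$, we have \[ \mathcal{EO}_u\left(2\times 5^{2 k+3}n+\frac{5^{2k+4}-1}{6}\right)\equiv 3^{k+1}\,\mathcal{EO}_u(10n+4) \pmod 5, \] and, for each $r\in\{1,2,3,4\}$, \[ \mathcal{EO}_u\left(2\times 5^{2k+2}n+2\times 5^{2k+1}r+\frac{5^{2k+2}-1}{6}\right)\equiv 0 \pmod{16}. \]
   Context: For a positive integer $k$, let $f_k:=(q^k;q^k)_\infty=\prod_{i=1}^\infty(1-q^{ki})$. The integers $\mathcal{EO}_u(n)$, $n\ge 0$, are defined by $\sum_{n=0}^\infty \mathcal{EO}_u(n)q^n=\dfrac{f_4^2}{f_2^2}$. *)

theory Defs
  imports
    "HOL-Analysis.Infinite_Products"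
    "HOL-Computational_Algebra.Formal_Power_Series"
    "HOL-Number_Theory.Cong"
begin

text \<open>
  The infinite product is taken in the ring of formal power series over the integers with its
  \<open>X\<close>-adic topology.  It converges for \<open>k > 0\<close>, see \<open>euler_f_has_prod\<close> below.
\<close>
definition euler_f :: "nat \<Rightarrow> int fps" where
  "euler_f k = (\<Prod>i. 1 - fps_X ^ (k * Suc i))"

text \<open>
  The library's division of power series needs an inverse on the coefficient type, which
  \<^typ>\<open>int\<close> lacks.  The constant coefficient of the denominator is \<open>1\<close>, so the quotient is formed
  with \<^term>\<open>fps_right_inverse\<close>, whose second argument is the inverse of that coefficient.
  The lemma \<open>EO_u_generating_function\<close> confirms that this is the intended quotient.
\<close>
definition EO_u :: "nat \<Rightarrow> int" where
  "EO_u n = fps_nth ((euler_f 4)\<^sup>2 * fps_right_inverse ((euler_f 2)\<^sup>2) 1) n"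

lemma euler_f_partial_stable:
  assumes "k > 0" "n \<le> N"
  shows "fps_nth (\<Prod>i\<le>N. 1 - fps_X ^ (k * Suc i) :: int fps) n
       = fps_nth (\<Prod>i\<le>n. 1 - fps_X ^ (k * Suc i)) n"
  using assms(2)
proof (induction N rule: dec_induct)
  case (step N)
  define A :: "int fps" where "A = (\<Prod>i\<le>N. 1 - fps_X ^ (k * Suc i))"
  have "n < 1 * Suc (Suc N)"
    using step.hyps by simp
  also have "\<dots> \<le> k * Suc (Suc N)"
    using \<open>k > 0\<close> by (intro mult_le_mono1) simp
  finally have n: "n < k * Suc (Suc N)" .
  have "(\<Prod>i\<le>Suc N. 1 - fps_X ^ (k * Suc i)) = A - A * fps_X ^ (k * Suc (Suc N))"
    by (simp only: A_def prod.atMost_Suc right_diff_distrib mult_1_right)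
  thus ?case
    using step.IH n unfolding A_def[symmetric]
    by (simp only: fps_sub_nth fps_X_power_mult_right_nth if_True diff_0_right)
qed simp

lemma euler_f_has_prod:
  assumes "k > 0"
  shows "(\<lambda>i. 1 - fps_X ^ (k * Suc i)) has_prod euler_f k"
    and "fps_nth (euler_f k) 0 = 1"
proof -
  let ?P = "\<lambda>N. \<Prod>i\<le>N. 1 - fps_X ^ (k * Suc i) :: int fps"
  define L where "L = Abs_fps (\<lambda>n. fps_nth (?P n) n)"
  have "?P \<longlonglongrightarrow> L"
  proof (rule tendsto_fpsI)
    fix n
    show "eventually (\<lambda>N. fps_nth (?P N) n = fps_nth L n) sequentially"
      using eventually_ge_at_top[of n]
    proof eventually_elim
      case (elim N)
      show ?case
        unfolding L_def fps_nth_Abs_fps by (rule euler_f_partial_stable[OF assms elim])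
    qed
  qed
  moreover have L0: "fps_nth L 0 = 1"
    using assms by (simp add: L_def)
  hence "L \<noteq> 0"
    by auto
  ultimately have L: "(\<lambda>i. 1 - fps_X ^ (k * Suc i)) has_prod L"
    unfolding has_prod_def raw_has_prod_def by simp
  have factor: "1 - fps_X ^ (k * Suc i) \<noteq> (0 :: int fps)" for i
  proof
    assume "1 - fps_X ^ (k * Suc i) = (0 :: int fps)"
    hence "fps_nth (1 - fps_X ^ (k * Suc i) :: int fps) 0 = 0"
      by simp
    thus False
      using assms by simp
  qed
  have "M = L" if "(\<lambda>i. 1 - fps_X ^ (k * Suc i)) has_prod M" for M
  proof -
    have "raw_has_prod (\<lambda>i. 1 - fps_X ^ (k * Suc i)) 0 M"
      using that factor unfolding has_prod_def by blast
    hence "?P \<longlonglongrightarrow> M"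
      unfolding raw_has_prod_def add_0_right by (rule conjunct1)
    thus ?thesis
      using \<open>?P \<longlonglongrightarrow> L\<close> by (rule LIMSEQ_unique)
  qed
  hence "euler_f k = L"
    unfolding euler_f_def prodinf_def using L by (intro the_equality)
  thus "(\<lambda>i. 1 - fps_X ^ (k * Suc i)) has_prod euler_f k" "fps_nth (euler_f k) 0 = 1"
    using L L0 by simp_all
qed

lemma EO_u_generating_function: "Abs_fps EO_u * (euler_f 2)\<^sup>2 = (euler_f 4)\<^sup>2"
proof -
  define F where "F = (euler_f 2)\<^sup>2"
  define G where "G = fps_right_inverse F 1"
  have "F * G = 1"
    unfolding G_def
    by (rule fps_right_inverse) (simp add: F_def power2_eq_square euler_f_has_prod(2))
  moreover have "Abs_fps EO_u = (euler_f 4)\<^sup>2 * G"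
    by (rule fps_ext) (simp only: EO_u_def F_def G_def fps_nth_Abs_fps)
  ultimately show ?thesis
    unfolding F_def[symmetric] by (simp only: mult.assoc mult.commute[of G F] mult_1_right)
qed

end

theory Submission
  imports Defs "Berlekamp_Zassenhaus.Finite_Field" "HOL-Computational_Algebra.Polynomial"
begin

text \<open>
  Only even arguments matter, and \<open>\<Sum> EO_u (2m) q\<^sup>m = f\<^sub>2\<^sup>2 / f\<^sub>1\<^sup>2\<close>.  Put \<open>\<phi> = f\<^sub>1\<^sup>2 / f\<^sub>2 = \<Sum> (-1)\<^sup>n q\<^bsup>n\<^sup>2\<^esup>\<close>.

  Modulo 16 this series is \<open>f\<^sub>2 / \<phi> \<equiv> 2 f\<^sub>1\<^sup>2 - f\<^sub>1\<^sup>6 / f\<^sub>2\<^sup>2\<close>.  Both terms are sums over Gaussian integers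
  \<open>u + vi\<close> with \<open>u\<^sup>2 + v\<^sup>2 = 24m + 2\<close>, the second one because \<open>f\<^sub>1\<^sup>5 / f\<^sub>2\<^sup>2 = \<Sum> (6n + 1) q\<^bsup>n(3n+1)/2\<^esup>\<close>.
  Factoring out the primes \<open>2 \<plusminus> i\<close> gives a Hecke recursion in the power of 5 dividing \<open>12m + 1\<close>, whose
  inhomogeneous part is divisible by 16.

  Modulo 5 the Fermat congruence turns the theta series of \<open>f\<^sub>1\<close>, \<open>f\<^sub>1\<^sup>3\<close> and \<open>\<phi>\<close> into differential
  equations for \<open>\<theta> = q d/dq\<close>, from which the logarithmic derivatives of all eta quotients in \<open>f\<^sub>1\<close>, \<open>f\<^sub>2\<close>
  are polynomials in one series \<open>e\<close> with \<open>\<theta> e = 1 - e\<^sup>4\<close>.  Since \<open>1 - \<theta>\<^sup>4\<close> extracts the exponents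
  divisible by 5, the action of \<open>U\<^sub>5\<close> on \<open>f\<^sub>1\<^sup>8 f\<^sub>2\<^sup>2\<close>, \<open>f\<^sub>1\<^sup>6 f\<^sub>2\<^sup>2\<close> and \<open>f\<^sub>1\<^bsup>14\<^esup> / f\<^sub>2\<^sup>6\<close> is read off from
  polynomial identities in \<open>e\<close>.
\<close>

section \<open>Gaussian binomial coefficients and theta series\<close>

text \<open>Both claims become statements about \<open>12m + 1\<close>: the map
  \<open>m -> 25m + 2\<close> multiplies it by 25, and \<open>m = 5n + 2\<close> means
  \<open>12m + 1 = 5(12n + 5)\<close>. Modulo 16 the obstacle is that \<open>1 / phi\<close> is not
  a theta series; only a polynomial in \<open>phi\<close> can be expanded over Gaussian integers.
  Counting lattice points with all signs costs a factor 4, so the Gaussian sums must vanish modulo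
  64. The exponent of 5 is odd, so the recursion starts from an empty sum. Modulo 5 the differential
  equations are Ramanujan's with \<open>E_4 = 1\<close> and \<open>E_6 = E_2\<close>, the reductions
  of \<open>E_(p-1)\<close> and \<open>E_(p+1)\<close>, but they are derived from theta series
  alone. Computing \<open>phi^24\<close> both from its own equation and as
  \<open>f1^48 / f2^24\<close> gives the relation that eliminates \<open>E_2\<close> in favour of
  \<open>e\<close>. The three eta quotients arise as follows: multiplying \<open>f2^2 / f1^2\<close>
  by the fifth power \<open>f1^10\<close> gives \<open>f1^8 f2^2\<close>, an eigenvector with value
  3 for the section at residue 2. Dividing by \<open>f1^2\<close> leaves \<open>f1^6 f2^2\<close>,
  which is exchanged with \<open>f1^14 / f2^6\<close> up to the same factor 3.\<close>

definition q_factorial :: "'a::comm_ring_1 \<Rightarrow> nat \<Rightarrow> 'a" where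
  "q_factorial q n = (\<Prod>i<n. 1 - q ^ Suc i)"

lemma q_factorial_0 [simp]: "q_factorial q 0 = 1"
  by (simp add: q_factorial_def)

lemma q_factorial_Suc: "q_factorial q (Suc n) = q_factorial q n * (1 - q ^ Suc n)"
  by (simp add: q_factorial_def)

text \<open>Defined by Pascal's rule rather than as a quotient of factorials, so that it lives in
  any commutative ring; \<open>q_binomial_mult_factorials\<close> recovers the quotient.\<close>

fun q_binomial :: "'a::comm_ring_1 \<Rightarrow> nat \<Rightarrow> nat \<Rightarrow> 'a" where
  "q_binomial q n 0 = 1"
| "q_binomial q 0 (Suc k) = 0"
| "q_binomial q (Suc n) (Suc k) = q_binomial q n (Suc k) + q ^ (n - k) * q_binomial q n k"

lemma q_binomial_eq_0: "n < k \<Longrightarrow> q_binomial q n k = 0"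
  by (induction q n k rule: q_binomial.induct) auto

lemma q_binomial_mult_factorials:
  "k \<le> n \<Longrightarrow> q_binomial q n k * q_factorial q k * q_factorial q (n - k) = q_factorial q n"
proof (induction q n k rule: q_binomial.induct)
  case (3 q n k)
  have A: "q_binomial q n (Suc k) * q_factorial q (Suc k) * q_factorial q (n - k)
      = q_factorial q n * (1 - q ^ (n - k))"
  proof (cases "k < n")
    case True
    then obtain d where n: "n = k + Suc d"
      using less_iff_Suc_add by auto
    have "q_binomial q n (Suc k) * q_factorial q (Suc k) * q_factorial q d = q_factorial q n"
      using 3(1) n by simp
    moreover have "n - k = Suc d"
      using n by simp
    ultimately show ?thesis
      by (simp only: q_factorial_Suc[of q d] mult.assoc [symmetric])
  next
    case False
    with 3(3) have "n = k" by simp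
    thus ?thesis by (simp add: q_binomial_eq_0)
  qed
  have B: "q_binomial q n k * q_factorial q k * q_factorial q (n - k) = q_factorial q n"
    using 3 by simp
  have "q_binomial q (Suc n) (Suc k) * q_factorial q (Suc k) * q_factorial q (Suc n - Suc k)
     = q_binomial q n (Suc k) * q_factorial q (Suc k) * q_factorial q (n - k)
       + q ^ (n - k) * (1 - q ^ Suc k) * (q_binomial q n k * q_factorial q k * q_factorial q (n - k))"
    by (simp add: q_factorial_Suc algebra_simps)
  also have "\<dots> = q_factorial q n * (1 - q ^ (n - k) * q ^ Suc k)"
    unfolding A B by (simp add: algebra_simps)
  also have "q ^ (n - k) * q ^ Suc k = q ^ Suc n"
    using 3(3) by (simp only: power_add [symmetric]) simp
  finally show ?case by (simp add: q_factorial_Suc)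
qed auto

text \<open>The second variable is kept formal: induction then compares coefficients, and the
  product can later be differentiated.\<close>

lemma coeff_q_binomial_theorem:
  "coeff (\<Prod>i<n. [:x, q ^ i:]) k = q ^ (k choose 2) * q_binomial q n k * x ^ (n - k)"
proof (induction n arbitrary: k)
  case 0
  show ?case by (cases k) (auto simp: binomial_eq_0)
next
  case (Suc n)
  show ?case
  proof (cases k)
    case 0
    thus ?thesis using Suc[of 0] by (simp add: coeff_mult_0 mult_ac binomial_eq_0)
  next
    case k: (Suc l)
    have "coeff (\<Prod>i<Suc n. [:x, q ^ i:]) k
        = x * coeff (\<Prod>i<n. [:x, q ^ i:]) (Suc l) + q ^ n * coeff (\<Prod>i<n. [:x, q ^ i:]) l"
      by (simp add: k)
    also have "\<dots> = q ^ (Suc l choose 2) * (x * x ^ (n - Suc l) * q_binomial q n (Suc l))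
          + q ^ (n + (l choose 2)) * q_binomial q n l * x ^ (n - l)"
      by (simp add: Suc power_add algebra_simps)
    also have "x * x ^ (n - Suc l) * q_binomial q n (Suc l) = q_binomial q n (Suc l) * x ^ (n - l)"
      by (cases "l < n") (auto simp: q_binomial_eq_0 Suc_diff_Suc mult_ac simp flip: power_Suc)
    also have "q ^ (n + (l choose 2)) * q_binomial q n l
        = q ^ (Suc l choose 2) * (q ^ (n - l) * q_binomial q n l)"
    proof (cases "l \<le> n")
      case True
      hence "n + (l choose 2) = (Suc l choose 2) + (n - l)"
        by (simp add: numeral_2_eq_2)
      thus ?thesis by (simp add: power_add)
    qed (simp add: q_binomial_eq_0)
    finally show ?thesis by (simp add: k algebra_simps)
  qed
qed

lemma q_binomial_theorem_poly:
  "(\<Prod>i<n. [:x, q ^ i:]) = (\<Sum>k\<le>n. monom (q ^ (k choose 2) * q_binomial q n k * x ^ (n - k)) k)"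
  by (rule poly_eqI) (auto simp: coeff_q_binomial_theorem coeff_sum q_binomial_eq_0 not_le)

lemma q_binomial_theorem:
  "(\<Prod>i<n. x + y * q ^ i) = (\<Sum>k\<le>n. q ^ (k choose 2) * q_binomial q n k * x ^ (n - k) * y ^ k)"
proof -
  have "(\<Prod>i<n. x + y * q ^ i) = poly (\<Prod>i<n. [:x, q ^ i:]) y"
    by (simp add: poly_prod)
  also have "\<dots> = (\<Sum>k\<le>n. q ^ (k choose 2) * q_binomial q n k * x ^ (n - k) * y ^ k)"
    unfolding q_binomial_theorem_poly by (simp add: poly_sum poly_monom)
  finally show ?thesis .
qed

lemma q_factorial_dvd_diff:
  "m \<le> n \<Longrightarrow> q ^ Suc m dvd q_factorial q n - q_factorial q m"
proof (induction n rule: dec_induct)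
  case (step n)
  have "q_factorial q (Suc n) - q_factorial q m
      = (q_factorial q n - q_factorial q m) - q ^ Suc n * q_factorial q n"
    by (simp add: q_factorial_Suc algebra_simps)
  moreover have "q ^ Suc m dvd q ^ Suc n * q_factorial q n"
    using step.hyps by (intro dvd_mult2 le_imp_power_dvd) simp
  ultimately show ?case using step.IH by (metis dvd_diff)
qed simp

text \<open>All four factorials agree with the unit \<open>w = q_factorial q d\<close> modulo
  \<open>q ^ Suc d\<close>, so the factorial formula reads \<open>b * w * w = w\<close> there;
  cancelling \<open>w\<close> gives the claim. It measures how fast central Gaussian binomials
  approach \<open>1 / (q;q)_infinity\<close>.\<close>

lemma q_factorial_mult_binomial_dvd:
  fixes q :: "'a::comm_ring_1"
  assumes "k \<le> n" "d \<le> k" "d \<le> n - k" "d \<le> m" "q_factorial q d * v = 1"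
  shows "q ^ Suc d dvd q_factorial q m * q_binomial q n k - 1"
proof -
  define w where "w = q_factorial q d"
  define b where "b = q_binomial q n k"
  define Q where "Q = q ^ Suc d"
  have ex: "\<exists>x. q_factorial q i = w + Q * x" if "d \<le> i" for i
    using q_factorial_dvd_diff[OF that, of q] unfolding w_def Q_def dvd_def
    by (metis add.commute diff_add_cancel)
  obtain x where x: "q_factorial q m = w + Q * x" using ex assms(4) by blast
  obtain y where y: "q_factorial q k = w + Q * y" using ex assms(2) by blast
  obtain z where z: "q_factorial q (n - k) = w + Q * z" using ex assms(3) by blast
  obtain t where t: "q_factorial q n = w + Q * t" using ex assms by fastforce
  have wv: "w * v = 1" using assms by (simp add: w_def)
  have "b * (w + Q * y) * (w + Q * z) = w + Q * t"
    using q_binomial_mult_factorials[OF assms(1), of q] unfolding x y z t b_def by simp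
  hence w: "w = b * (w + Q * y) * (w + Q * z) - Q * t" by simp
  define R where "R = t - b * y * w - b * w * z - b * y * Q * z"
  have "b * w * w - w = b * w * w - (b * (w + Q * y) * (w + Q * z) - Q * t)"
    using w by simp
  also have "\<dots> = Q * R"
    by (simp add: R_def algebra_simps)
  finally have R: "Q * R = b * w * w - w" ..
  have "Q * (R * v + x * b) = (Q * R) * v + Q * x * b"
    by (simp add: algebra_simps)
  also have "\<dots> = b * w * (w * v) - w * v + Q * x * b"
    unfolding R by (simp add: algebra_simps)
  also have "\<dots> = (w + Q * x) * b - 1"
    unfolding wv by (simp add: algebra_simps)
  finally have "(w + Q * x) * b - 1 = Q * (R * v + x * b)" ..
  thus ?thesis unfolding x b_def Q_def[symmetric] by simp
qed

lemma prod_lessThan_add: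
  fixes f :: "nat \<Rightarrow> 'a::comm_monoid_mult"
  shows "(\<Prod>i<a + b. f i) = (\<Prod>i<a. f i) * (\<Prod>i<b. f (a + i))"
  by (induction b) (auto simp: mult_ac)

lemma prod_power_linear:
  "(\<Prod>i<n. (q::'a::comm_ring_1) ^ (m * i + r)) = q ^ (m * (n choose 2) + r * n)"
  by (induction n) (auto simp: numeral_2_eq_2 algebra_simps simp flip: power_add)

lemma two_mult_choose_two: "2 * (n choose 2) + n = n * n"
  by (induction n) (auto simp: numeral_2_eq_2)

lemma choose_two_add: "(n + j) choose 2 = (n choose 2) + (j choose 2) + n * j"
  by (induction j) (auto simp: numeral_2_eq_2)

lemma choose_two_diff:
  assumes "j \<le> n"
  shows "((n - j) choose 2) + n * j = (n choose 2) + (j choose 2) + j"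
proof -
  obtain i where n: "n = i + j" using assms le_iff_add[of j n] by (metis add.commute)
  show ?thesis using two_mult_choose_two[of j]
    by (simp add: n choose_two_add algebra_simps)
qed

section \<open>Finite forms of Jacobi's triple product and of his identity for the cube\<close>

text \<open>The q-binomial theorem with \<open>2 * n\<close> factors, base \<open>q ^ m\<close>,
  \<open>x = q ^ (m * n)\<close> and \<open>y = - (q ^ r)\<close>. This \<open>x\<close> moves the
  symmetric range \<open>-n..n\<close> to \<open>0..2n\<close>, which avoids negative exponents;
  \<open>E\<close> is the power of \<open>q\<close> that the shift puts in front of both
  sides.\<close>

lemma finite_triple_product:
  fixes q :: "'a::idom"
  assumes "q \<noteq> 0" "r \<le> m"
  shows "(\<Prod>i<n. (1 - q ^ (m * i + r)) * (1 - q ^ (m * i + (m - r)))) =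
      (\<Sum>j\<le>n. (-1) ^ j * q_binomial (q ^ m) (2 * n) (n + j) * q ^ (m * (j choose 2) + r * j))
    + (\<Sum>j\<in>{1..n}. (-1) ^ j * q_binomial (q ^ m) (2 * n) (n - j) * q ^ (m * (j choose 2) + (m - r) * j))"
    (is "?L = ?A + ?B")
proof -
  define E where "E = m * (n choose 2) + r * n + m * n * n"
  define c where "c k = (q ^ m) ^ (k choose 2) * q_binomial (q ^ m) (2 * n) k
                        * (q ^ (m * n)) ^ (2 * n - k) * (- (q ^ r)) ^ k" for k
  have neg: "(- (q ^ r)) ^ k = (-1) ^ k * q ^ (r * k)" for k
    by (metis power_minus power_mult)
  have c_eq: "c k = (- 1) ^ k * q_binomial (q ^ m) (2 * n) k * (q ^ E * q ^ e)"
    if "m * (k choose 2) + m * n * (2 * n - k) + r * k = E + e" for k e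
  proof -
    have "c k = (- 1) ^ k * q_binomial (q ^ m) (2 * n) k
        * q ^ (m * (k choose 2) + m * n * (2 * n - k) + r * k)"
      unfolding c_def neg power_add power_mult by (simp only: mult_ac)
    thus ?thesis unfolding that power_add .
  qed
  \<comment> \<open>In the lower half of the factors the second term has the smaller exponent, so it
    is the one pulled out; the cofactors are the second family of the product in reverse
    order.\<close>
  have "(\<Prod>i<n. q ^ (m * n) + - (q ^ r) * (q ^ m) ^ i)
      = (\<Prod>i<n. (- 1) * q ^ (m * i + r) * (1 - q ^ (m * (n - Suc i) + (m - r))))"
  proof (intro prod.cong refl)
    fix i assume "i \<in> {..<n}"
    then obtain d where "n = Suc i + d" using less_iff_Suc_add by auto
    hence "m * n = (m * i + r) + (m * (n - Suc i) + (m - r))"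
      using assms(2) by (simp add: algebra_simps)
    hence "q ^ (m * n) = q ^ (m * i + r) * q ^ (m * (n - Suc i) + (m - r))"
      by (simp only: power_add)
    moreover have "(q ^ r) * (q ^ m) ^ i = q ^ (m * i + r)"
      by (simp add: power_add power_mult)
    ultimately show "q ^ (m * n) + - (q ^ r) * (q ^ m) ^ i
        = (- 1) * q ^ (m * i + r) * (1 - q ^ (m * (n - Suc i) + (m - r)))"
      by (simp only: right_diff_distrib mult_minus_left mult_1_right mult_1_left) simp
  qed
  also have "\<dots> = (- 1) ^ n * q ^ (m * (n choose 2) + r * n)
       * (\<Prod>i<n. 1 - q ^ (m * (n - Suc i) + (m - r)))"
    by (simp only: prod.distrib prod_power_linear prod_constant card_lessThan)
  also have "(\<Prod>i<n. 1 - q ^ (m * (n - Suc i) + (m - r))) = (\<Prod>i<n. 1 - q ^ (m * i + (m - r)))"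
    by (rule prod.nat_diff_reindex)
  finally have first: "(\<Prod>i<n. q ^ (m * n) + - (q ^ r) * (q ^ m) ^ i)
       = (- 1) ^ n * q ^ (m * (n choose 2) + r * n) * (\<Prod>i<n. 1 - q ^ (m * i + (m - r)))" .
  have "(\<Prod>i<n. q ^ (m * n) + - (q ^ r) * (q ^ m) ^ (n + i))
      = (\<Prod>i<n. q ^ (m * n) * (1 - q ^ (m * i + r)))"
    by (intro prod.cong refl) (simp add: algebra_simps flip: power_add power_mult)
  also have "\<dots> = q ^ (m * n * n) * (\<Prod>i<n. 1 - q ^ (m * i + r))"
    by (simp add: prod.distrib power_mult)
  finally have second: "(\<Prod>i<n. q ^ (m * n) + - (q ^ r) * (q ^ m) ^ (n + i))
      = q ^ (m * n * n) * (\<Prod>i<n. 1 - q ^ (m * i + r))" .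
  have "(- 1) ^ n * q ^ E * ?L = (\<Prod>i<n + n. q ^ (m * n) + - (q ^ r) * (q ^ m) ^ i)"
    by (simp only: prod_lessThan_add first second) (simp add: E_def prod.distrib power_add mult_ac)
  also have "\<dots> = (\<Sum>k\<le>2 * n. c k)"
    unfolding c_def by (subst q_binomial_theorem) (simp add: mult_2)
  also have "{..2 * n} = (\<lambda>j. n + j) ` {..n} \<union> (\<lambda>j. n - j) ` {1..n}"
  proof -
    have "k \<in> (\<lambda>j. n + j) ` {..n} \<union> (\<lambda>j. n - j) ` {1..n}" if "k \<le> 2 * n" for k
    proof (cases "n \<le> k")
      case True
      thus ?thesis using that by (intro UnI1 image_eqI[of _ _ "k - n"]) auto
    next
      case False
      thus ?thesis using that by (intro UnI2 image_eqI[of _ _ "n - k"]) auto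
    qed
    thus ?thesis by auto
  qed
  also have "sum c \<dots> = (\<Sum>j\<le>n. c (n + j)) + (\<Sum>j\<in>{1..n}. c (n - j))"
  proof -
    have "inj_on (\<lambda>j. n - j) {1..n}"
      by (auto simp: inj_on_def)
    thus ?thesis
      by (subst sum.union_disjoint) (auto simp: sum.reindex)
  qed
  also have "(\<Sum>j\<le>n. c (n + j)) = (- 1) ^ n * q ^ E * ?A"
    unfolding sum_distrib_left
  proof (intro sum.cong refl)
    fix j assume "j \<in> {..n}"
    then obtain d where n: "n = j + d" using le_iff_add by auto
    have "m * ((n + j) choose 2) + m * n * (2 * n - (n + j)) + r * (n + j)
        = E + (m * (j choose 2) + r * j)"
      unfolding choose_two_add E_def by (simp add: n algebra_simps)
    from c_eq[OF this] show "c (n + j) = (- 1) ^ n * q ^ E *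
        ((- 1) ^ j * q_binomial (q ^ m) (2 * n) (n + j) * q ^ (m * (j choose 2) + r * j))"
      by (simp only: power_add[of "- 1"] mult_ac)
  qed
  also have "(\<Sum>j\<in>{1..n}. c (n - j)) = (- 1) ^ n * q ^ E * ?B"
    unfolding sum_distrib_left
  proof (intro sum.cong refl)
    fix j assume "j \<in> {1..n}"
    hence "j \<le> n" by simp
    have "m * ((n - j) choose 2) + m * n * (2 * n - (n - j)) + r * (n - j)
        = m * (((n - j) choose 2) + n * j) + m * n * n + r * (n - j)"
      using \<open>j \<le> n\<close> by (simp add: algebra_simps)
    also have "\<dots> = E + (m * (j choose 2) + (m - r) * j)"
    proof -
      have "m * j = r * j + (m - r) * j"
        using assms(2) by (simp flip: add_mult_distrib)
      moreover have "r * n = r * (n - j) + r * j"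
        using \<open>j \<le> n\<close> by (simp flip: add_mult_distrib2)
      ultimately show ?thesis
        unfolding choose_two_diff[OF \<open>j \<le> n\<close>] E_def by (simp add: add_mult_distrib2)
    qed
    finally have "m * ((n - j) choose 2) + m * n * (2 * n - (n - j)) + r * (n - j)
       = E + (m * (j choose 2) + (m - r) * j)" .
    note c = c_eq[OF this]
    have "(- 1 :: 'a) ^ (n - j) = (- 1) ^ n * (- 1) ^ j"
      using \<open>j \<le> n\<close> by (metis minus_one_power_iff mult_minus1 mult_minus1_right even_diff_nat not_less power_add mult.right_neutral minus_minus)
    thus "c (n - j) = (- 1) ^ n * q ^ E *
        ((- 1) ^ j * q_binomial (q ^ m) (2 * n) (n - j) * q ^ (m * (j choose 2) + (m - r) * j))"
      by (simp only: c mult_ac)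
  qed
  finally have "(- 1) ^ n * q ^ E * ?L = (- 1) ^ n * q ^ E * (?A + ?B)"
    by (simp add: algebra_simps)
  thus ?thesis using assms(1) by simp
qed

text \<open>Evaluate at \<open>-1\<close> the derivative of the product of the
  \<open>2 * n + 1\<close> factors \<open>q ^ n + q ^ i * y\<close>. The factor \<open>i = n\<close>
  vanishes there, so only the term in which it is differentiated survives, and the other factors
  give two copies of \<open>q_factorial q n\<close>. On the coefficient side
  \<open>k = n + 1 + j\<close> and \<open>k = n - j\<close> carry the same power of
  \<open>q\<close>; the difference of these indices is the weight \<open>2j + 1\<close>.\<close>

lemma finite_jacobi_identity:
  fixes q :: "'a::idom"
  assumes "q \<noteq> 0"
  shows "(\<Sum>j\<le>n. (-1) ^ j * (of_nat (n + 1 + j) * q_binomial q (2 * n + 1) (n + 1 + j)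
             - of_nat (n - j) * q_binomial q (2 * n + 1) (n - j)) * q ^ (Suc j choose 2))
     = (q_factorial q n)\<^sup>2"
proof -
  define E where "E = (n choose 2) + n * n + n"
  define c where "c k = q ^ (k choose 2) * q_binomial q (2 * n + 1) k * (q ^ n) ^ (2 * n + 1 - k)" for k
  have c_eq: "c k = q ^ E * q ^ e * q_binomial q (2 * n + 1) k"
    if "(k choose 2) + n * (2 * n + 1 - k) = E + e" for k e
  proof -
    have "c k = q ^ ((k choose 2) + n * (2 * n + 1 - k)) * q_binomial q (2 * n + 1) k"
      unfolding c_def power_add power_mult by (simp only: mult_ac)
    thus ?thesis unfolding that power_add .
  qed
  define d where "d k = of_nat k * c k * (- 1) ^ (k - 1)" for k
  define p where "p = (\<Prod>i<2 * n + 1. [:q ^ n, q ^ i:])"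
  define s where "s = (\<Prod>i<n. [:q ^ n, q ^ i:]) * (\<Prod>i<n. [:q ^ n, q ^ (n + Suc i):])"
  have "p = [:q ^ n, q ^ n:] * s"
  proof -
    have "p = (\<Prod>i<n + Suc n. [:q ^ n, q ^ i:])" by (simp add: p_def mult_2)
    also have "\<dots> = (\<Prod>i<n. [:q ^ n, q ^ i:]) * (\<Prod>i<Suc n. [:q ^ n, q ^ (n + i):])"
      by (rule prod_lessThan_add)
    also have "(\<Prod>i<Suc n. [:q ^ n, q ^ (n + i):])
       = [:q ^ n, q ^ n:] * (\<Prod>i<n. [:q ^ n, q ^ (n + Suc i):])"
      by (subst prod.lessThan_Suc_shift) simp
    finally show ?thesis by (simp only: s_def mult_ac)
  qed
  hence "poly (pderiv p) (- 1) = q ^ n * poly s (- 1)"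
    by (simp add: pderiv_mult pderiv_pCons del: mult_pCons_left)
  also have "poly s (- 1) = (\<Prod>i<n. q ^ n - q ^ i) * (\<Prod>i<n. q ^ n - q ^ (n + Suc i))"
    by (simp add: s_def poly_prod)
  also have "(\<Prod>i<n. q ^ n - q ^ i) = (\<Prod>i<n. (- 1) * q ^ (1 * i + 0) * (1 - q ^ Suc (n - Suc i)))"
    by (intro prod.cong refl) (auto simp: algebra_simps Suc_diff_Suc simp flip: power_add power_Suc)
  also have "\<dots> = (- 1) ^ n * q ^ (n choose 2) * (\<Prod>i<n. (1 - q ^ Suc (n - Suc i)))"
    by (simp only: prod.distrib prod_power_linear) simp
  also have "(\<Prod>i<n. (1 - q ^ Suc (n - Suc i))) = q_factorial q n"
    unfolding q_factorial_def by (rule prod.nat_diff_reindex)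
  also have "(\<Prod>i<n. q ^ n - q ^ (n + Suc i)) = (\<Prod>i<n. q ^ n * (1 - q ^ Suc i))"
    by (intro prod.cong refl) (simp add: power_add algebra_simps)
  also have "\<dots> = q ^ (n * n) * q_factorial q n"
    by (simp add: prod.distrib q_factorial_def power_mult)
  finally have 1: "poly (pderiv p) (- 1) = (- 1) ^ n * q ^ E * (q_factorial q n)\<^sup>2"
    by (simp add: E_def power_add power2_eq_square mult_ac)
  have "p = (\<Sum>k\<le>2 * n + 1. monom (c k) k)"
    unfolding p_def c_def by (rule q_binomial_theorem_poly)
  hence "poly (pderiv p) (- 1) = (\<Sum>k\<le>2 * n + 1. d k)"
    using higher_pderiv_sum[of 1 "\<lambda>k. monom (c k) k" "{..2 * n + 1}"]
    by (simp add: pderiv_monom poly_sum poly_monom d_def)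
  also have "{..2 * n + 1} = (\<lambda>j. n + 1 + j) ` {..n} \<union> (\<lambda>j. n - j) ` {..n}"
  proof -
    have "k \<in> (\<lambda>j. n + 1 + j) ` {..n} \<union> (\<lambda>j. n - j) ` {..n}" if "k \<le> 2 * n + 1" for k
    proof (cases "n + 1 \<le> k")
      case True
      thus ?thesis using that by (intro UnI1 image_eqI[of _ _ "k - (n + 1)"]) auto
    next
      case False
      thus ?thesis using that by (intro UnI2 image_eqI[of _ _ "n - k"]) auto
    qed
    thus ?thesis by auto
  qed
  also have "sum d \<dots> = (\<Sum>j\<le>n. d (n + 1 + j)) + (\<Sum>j\<le>n. d (n - j))"
  proof -
    have inj: "inj_on (\<lambda>j. n - j) {..n}" "inj_on (\<lambda>j. n + 1 + j) {..n}"
      by (auto simp: inj_on_def)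
    show ?thesis
      by (subst sum.union_disjoint)
         (auto simp: sum.reindex[OF inj(1)] sum.reindex[OF inj(2), simplified])
  qed
  also have "\<dots> = (\<Sum>j\<le>n. d (n + 1 + j) + d (n - j))"
    by (simp only: sum.distrib)
  also have "\<dots> = (\<Sum>j\<le>n. (- 1) ^ n * q ^ E * ((-1) ^ j * (of_nat (n + 1 + j) * q_binomial q (2 * n + 1) (n + 1 + j)
             - of_nat (n - j) * q_binomial q (2 * n + 1) (n - j)) * q ^ (Suc j choose 2)))"
  proof (intro sum.cong refl)
    fix j assume "j \<in> {..n}"
    hence "j \<le> n" by simp
    have "((n + Suc j) choose 2) + n * (2 * n + 1 - (n + 1 + j)) = E + (Suc j choose 2)"
    proof -
      have "n * Suc j + n * (2 * n + 1 - (n + 1 + j)) = n * n + n"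
        using \<open>j \<le> n\<close> by (simp flip: add_mult_distrib2)
      thus ?thesis unfolding choose_two_add E_def by linarith
    qed
    hence 2: "c (n + 1 + j) = q ^ E * q ^ (Suc j choose 2) * q_binomial q (2 * n + 1) (n + 1 + j)"
      by (intro c_eq) simp
    have "((n - j) choose 2) + n * (2 * n + 1 - (n - j)) = ((n - j) choose 2) + n * j + n * n + n"
      using \<open>j \<le> n\<close> by (simp add: algebra_simps)
    also have "\<dots> = E + (Suc j choose 2)"
      unfolding choose_two_diff[OF \<open>j \<le> n\<close>] E_def by (simp add: numeral_2_eq_2)
    finally have 3: "c (n - j) = q ^ E * q ^ (Suc j choose 2) * q_binomial q (2 * n + 1) (n - j)"
      by (rule c_eq)
    have 4: "of_nat (n - j) * (- 1 :: 'a) ^ (n - j - 1) = - of_nat (n - j) * ((- 1) ^ n * (- 1) ^ j)"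
      using \<open>j \<le> n\<close> by (cases "j = n") (auto simp: minus_one_power_iff)
    have "d (n - j) = (of_nat (n - j) * (- 1) ^ (n - j - 1)) * c (n - j)"
      by (simp add: d_def mult_ac)
    also have "\<dots> = - of_nat (n - j) * ((- 1) ^ n * (- 1) ^ j) * c (n - j)"
      unfolding 4 ..
    finally show "d (n + 1 + j) + d (n - j) = (- 1) ^ n * q ^ E * ((-1) ^ j * (of_nat (n + 1 + j) * q_binomial q (2 * n + 1) (n + 1 + j)
             - of_nat (n - j) * q_binomial q (2 * n + 1) (n - j)) * q ^ (Suc j choose 2))"
      unfolding d_def 2 3 by (simp add: power_add algebra_simps del: of_nat_add)
  qed
  finally have "(- 1) ^ n * q ^ E * (q_factorial q n)\<^sup>2 = (- 1) ^ n * q ^ E *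
      (\<Sum>j\<le>n. (-1) ^ j * (of_nat (n + 1 + j) * q_binomial q (2 * n + 1) (n + 1 + j)
             - of_nat (n - j) * q_binomial q (2 * n + 1) (n - j)) * q ^ (Suc j choose 2))"
    unfolding 1 sum_distrib_left .
  thus ?thesis using assms by simp
qed

section \<open>From finite identities to power series\<close>

definition eq_upto :: "nat \<Rightarrow> 'a fps \<Rightarrow> 'a fps \<Rightarrow> bool" where
  "eq_upto n f g \<longleftrightarrow> (\<forall>i<n. fps_nth f i = fps_nth g i)"

lemma eq_upto_mult:
  fixes f g :: "'a::comm_semiring_1 fps"
  shows "eq_upto n f f' \<Longrightarrow> eq_upto n g g' \<Longrightarrow> eq_upto n (f * g) (f' * g')"
  by (auto simp: eq_upto_def fps_mult_nth intro!: sum.cong)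

lemma eq_upto_power:
  fixes f g :: "'a::comm_semiring_1 fps"
  shows "eq_upto n f g \<Longrightarrow> eq_upto n (f ^ k) (g ^ k)"
proof (induction k)
  case 0
  show ?case by (simp add: eq_upto_def)
next
  case (Suc k)
  thus ?case using eq_upto_mult[of n f g "f ^ k" "g ^ k"] by simp
qed

lemma eq_upto_trans: "eq_upto n f g \<Longrightarrow> eq_upto n g h \<Longrightarrow> eq_upto n f h"
  by (simp add: eq_upto_def)

lemma eq_upto_sym: "eq_upto n f g \<Longrightarrow> eq_upto n g f"
  by (simp add: eq_upto_def)

lemma eq_upto_imp_eq: "(\<And>n. eq_upto n f g) \<Longrightarrow> f = g"
  unfolding eq_upto_def by (rule fps_ext) blast

lemma eq_upto_dvdI:
  fixes f g :: "'a::comm_ring_1 fps"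
  assumes "fps_X ^ n dvd f - g"
  shows "eq_upto n f g"
proof -
  obtain h where "f - g = fps_X ^ n * h" using assms by (auto simp: dvd_def)
  hence "fps_nth (f - g) i = 0" if "i < n" for i
    using that by (simp only: fps_X_power_mult_nth if_True)
  thus ?thesis by (simp add: eq_upto_def)
qed

lemma q_factorial_fps_nth_0: "k > 0 \<Longrightarrow> fps_nth (q_factorial (fps_X ^ k :: int fps) n) 0 = 1"
  by (induction n) (auto simp: q_factorial_Suc fps_mult_nth_0 simp flip: power_mult power_Suc)

lemma q_factorial_fps_unit:
  assumes "k > 0"
  obtains v where "q_factorial (fps_X ^ k :: int fps) n * v = 1"
  using fps_right_inverse[of "q_factorial (fps_X ^ k :: int fps) n" 1] q_factorial_fps_nth_0[OF assms]
  by simp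

lemma eq_upto_euler_f:
  assumes "k > 0" "n \<le> N"
  shows "eq_upto n (euler_f k) (q_factorial (fps_X ^ k) N)"
proof -
  have *: "q_factorial (fps_X ^ k :: int fps) (Suc M) = (\<Prod>i\<le>M. 1 - fps_X ^ (k * Suc i))" for M
    unfolding q_factorial_def lessThan_Suc_atMost by (simp only: power_mult)
  have "fps_nth (euler_f k) i = fps_nth (q_factorial (fps_X ^ k) N) i" if i: "i < n" for i
  proof -
    have "(\<lambda>N. \<Prod>i\<le>N. 1 - fps_X ^ (k * Suc i)) \<longlonglongrightarrow> euler_f k"
      by (rule has_prod_imp_tendsto[OF euler_f_has_prod(1)[OF assms(1)]])
    hence "eventually (\<lambda>N. fps_nth (\<Prod>i\<le>N. 1 - fps_X ^ (k * Suc i)) i = fps_nth (euler_f k) i) sequentially"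
      by (simp add: tendsto_fps_iff)
    hence "eventually (\<lambda>N. fps_nth (\<Prod>j\<le>i. 1 - fps_X ^ (k * Suc j)) i = fps_nth (euler_f k) i) sequentially"
      using eventually_ge_at_top[of i]
      by eventually_elim (metis euler_f_partial_stable[OF assms(1)])
    hence "fps_nth (\<Prod>j\<le>i. 1 - fps_X ^ (k * Suc j)) i = fps_nth (euler_f k) i"
      by simp
    moreover obtain M where M: "N = Suc M" using i assms(2) by (cases N) auto
    ultimately show ?thesis
      unfolding M * using euler_f_partial_stable[OF assms(1), of i M] i assms(2) M by simp
  qed
  thus ?thesis by (simp add: eq_upto_def)
qed

definition alt_sign :: "int \<Rightarrow> int" where
  "alt_sign j = (if even j then 1 else -1)"

lemma alt_sign_int: "alt_sign (int j) = (-1) ^ j" "alt_sign (- int j) = (-1) ^ j"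
  by (auto simp: alt_sign_def minus_one_power_iff)

text \<open>The error in \<open>q_factorial_mult_binomial_dvd\<close> has order at least
  \<open>Suc (n - j)\<close>, and the factor \<open>fps_X ^ e\<close> pushes it to order
  \<open>n\<close>, beyond the coefficient \<open>N\<close>.\<close>

lemma q_binomial_tail_nth:
  fixes k j n N :: nat and e :: nat
  assumes s: "s > 0" and Q: "Q = (fps_X ^ s :: int fps) ^ m" and "m > 0"
    and k: "k \<le> M" "n - j \<le> k" "n - j \<le> M - k" and e: "n \<le> Suc (n - j) + e" and "N < n"
  shows "fps_nth (q_factorial Q n * q_binomial Q M k * fps_X ^ e) N = (if N = e then 1 else 0)"
proof -
  have Q': "Q = fps_X ^ (s * m)" "s * m > 0"
    using s \<open>m > 0\<close> by (auto simp: Q simp flip: power_mult)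
  obtain v where v: "q_factorial Q (n - j) * v = 1"
    using q_factorial_fps_unit[OF Q'(2)] Q'(1) by metis
  have "fps_X ^ Suc (n - j) dvd Q ^ Suc (n - j)"
    unfolding Q' using Q'(2) by (intro dvd_power_same) (simp add: dvd_power)
  also have "\<dots> dvd q_factorial Q n * q_binomial Q M k - 1"
    by (rule q_factorial_mult_binomial_dvd[OF k _ v]) simp
  finally have "fps_X ^ (Suc (n - j) + e) dvd (q_factorial Q n * q_binomial Q M k - 1) * fps_X ^ e"
    unfolding power_add by (rule mult_dvd_mono) simp
  hence "fps_X ^ n dvd q_factorial Q n * q_binomial Q M k * fps_X ^ e - fps_X ^ e"
    using dvd_trans[OF le_imp_power_dvd[OF e]] by (simp add: algebra_simps)
  from eq_upto_dvdI[OF this] show ?thesis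
    using \<open>N < n\<close> by (auto simp: eq_upto_def)
qed

lemma le_choose_two_Suc: "j \<le> Suc (j choose 2)" "j \<le> Suc j choose 2"
  by (induction j) (auto simp: numeral_2_eq_2)

text \<open>The equation for \<open>j\<close> is doubled so that \<open>j choose 2\<close> becomes
  the polynomial \<open>j * (j - 1)\<close>, which is meaningful for negative \<open>j\<close>.
  Nonnegative \<open>j\<close> come from the exponents with \<open>r\<close>, negative ones from
  those with \<open>m - r\<close>.\<close>

lemma triple_product_nth:
  assumes r: "0 < r" "r < m" and s: "s > 0" and N: "N < n"
  defines "q \<equiv> fps_X ^ s :: int fps"
  shows "fps_nth (q_factorial (q ^ m) n * (\<Prod>i<n. (1 - q ^ (m * i + r)) * (1 - q ^ (m * i + (m - r))))) N
     = (\<Sum>j | int s * (int m * (j * (j - 1)) + 2 * int r * j) = 2 * int N. alt_sign j)"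
proof -
  have q0: "q \<noteq> 0" by (simp add: q_def)
  define e where "e t j = s * (m * (j choose 2) + t * j)" for t j
  have nth: "fps_nth (q_factorial (q ^ m) n * ((-1) ^ j * q_binomial (q ^ m) (2 * n) k *
      q ^ (m * (j choose 2) + t * j))) N = (if N = e t j then (-1) ^ j else 0)"
    if "j \<le> n" "k = n + j \<or> k = n - j" for j k t
  proof -
    have "n \<le> Suc (n - j) + (j choose 2)" using le_choose_two_Suc(1)[of j] that by simp
    also have "(j choose 2) \<le> e t j"
    proof -
      have "1 * (1 * (j choose 2)) \<le> s * (m * (j choose 2) + t * j)"
        using r s by (intro mult_le_mono trans_le_add1) auto
      thus ?thesis by (simp add: e_def)
    qed
    finally have e: "n \<le> Suc (n - j) + e t j" by simp
    have nth1: "fps_nth (q_factorial (q ^ m) n * q_binomial (q ^ m) (2 * n) k * fps_X ^ e t j) N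
       = (if N = e t j then 1 else 0)"
      using that r by (intro q_binomial_tail_nth[where m = m, OF s _ _ _ _ _ e N]) (auto simp: q_def)
    have "(-1 :: int fps) ^ j = fps_const ((-1) ^ j)"
      by (cases "even j") (simp_all flip: fps_const_neg)
    moreover have "q ^ (m * (j choose 2) + t * j) = fps_X ^ e t j"
      by (simp only: q_def e_def power_mult[symmetric])
    ultimately have eq: "q_factorial (q ^ m) n * ((-1) ^ j * q_binomial (q ^ m) (2 * n) k *
      q ^ (m * (j choose 2) + t * j)) = fps_const ((-1) ^ j) *
       (q_factorial (q ^ m) n * q_binomial (q ^ m) (2 * n) k * fps_X ^ e t j)"
      by (simp only: mult_ac)
    show ?thesis
      unfolding eq fps_mult_left_const_nth nth1 by simp
  qed
  define A where "A = {j\<in>{..n}. N = e r j}"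
  define B where "B = {j\<in>{1..n}. N = e (m - r) j}"
  have "fps_nth (q_factorial (q ^ m) n * (\<Prod>i<n. (1 - q ^ (m * i + r)) * (1 - q ^ (m * i + (m - r))))) N
      = (\<Sum>j\<le>n. if N = e r j then (-1) ^ j else 0) + (\<Sum>j\<in>{1..n}. if N = e (m - r) j then (-1) ^ j else 0)"
    using r by (subst finite_triple_product[OF q0])
      (auto simp: distrib_left sum_distrib_left fps_sum_nth nth)
  also have "\<dots> = (\<Sum>j\<in>A. alt_sign (int j)) + (\<Sum>j\<in>B. alt_sign (- int j))"
    unfolding A_def B_def alt_sign_int by (simp add: sum.If_cases Int_def)
  also have "\<dots> = sum alt_sign (int ` A \<union> (\<lambda>j. - int j) ` B)"
    by (subst sum.union_disjoint) (auto simp: A_def B_def sum.reindex inj_on_def)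
  also have "int ` A \<union> (\<lambda>j. - int j) ` B
      = {j. int s * (int m * (j * (j - 1)) + 2 * int r * j) = 2 * int N}" (is "_ = ?J")
  proof -
    have two: "2 * int (j choose 2) = int j * int j - int j" for j
      using arg_cong[OF two_mult_choose_two[of j], of int] by simp
    have 1: "int j \<in> ?J \<longleftrightarrow> N = e r j" for j
    proof -
      have "int j \<in> ?J \<longleftrightarrow> 2 * int (e r j) = 2 * int N"
        by (simp add: e_def two algebra_simps)
      thus ?thesis by auto
    qed
    have 2: "- int j \<in> ?J \<longleftrightarrow> N = e (m - r) j" for j
    proof -
      have "2 * int (e (m - r) j) = int s * (int m * (2 * int (j choose 2)) + 2 * (int m - int r) * int j)"
        unfolding e_def of_nat_mult of_nat_add of_nat_diff[OF less_imp_le[OF r(2)]]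
        by (simp add: algebra_simps)
      also have "\<dots> = int s * (int m * (- int j * (- int j - 1)) + 2 * int r * (- int j))"
        unfolding two by (simp add: algebra_simps)
      finally show ?thesis by auto
    qed
    \<comment> \<open>Since \<open>r\<close> and \<open>m - r\<close> are both positive, every
      solution has absolute value at most \<open>N\<close>, so the truncation at \<open>n\<close>
      loses none.\<close>
    have le: "j \<le> e t j" if "t > 0" for t j
    proof -
      have "1 * (1 * j) \<le> s * (m * (j choose 2) + t * j)"
        using that s by (intro mult_le_mono trans_le_add2) auto
      thus ?thesis by (simp add: e_def)
    qed
    have 3: "j \<in> A \<longleftrightarrow> int j \<in> ?J" for j
      unfolding 1 A_def using le[of r j] r N by auto
    have 4: "j \<in> B \<longleftrightarrow> - int j \<in> ?J \<and> j \<ge> 1" for j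
      unfolding 2 B_def using le[of "m - r" j] r N by auto
    have "j \<in> int ` A \<union> (\<lambda>j. - int j) ` B" if "j \<in> ?J" for j
    proof (cases "j \<ge> 0")
      case True
      thus ?thesis using that 3[of "nat j"] by (intro UnI1 image_eqI[of _ _ "nat j"]) auto
    next
      case False
      thus ?thesis using that 4[of "nat (- j)"] by (intro UnI2 image_eqI[of _ _ "nat (- j)"]) auto
    qed
    thus ?thesis using 3 4 by blast
  qed
  finally show ?thesis .
qed

section \<open>Theta series of \<open>f_k\<close>, its cube and \<open>phi\<close>\<close>

text \<open>The Kronecker symbol \<open>(12 / u)\<close>, the even primitive character modulo
  12.\<close>

definition chi12 :: "int \<Rightarrow> int" where
  "chi12 u = (if u mod 12 \<in> {1, 11} then 1 else if u mod 12 \<in> {5, 7} then -1 else 0)"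

definition chi4 :: "int \<Rightarrow> int" where
  "chi4 u = (if u mod 4 = 1 then 1 else if u mod 4 = 3 then -1 else 0)"

lemma finite_int_square_eq:
  assumes "a > 0"
  shows "finite {u::int. a * u\<^sup>2 = c}"
proof (rule finite_subset)
  show "{u. a * u\<^sup>2 = c} \<subseteq> {- c..c}"
  proof
    fix u assume "u \<in> {u. a * u\<^sup>2 = c}"
    hence c: "c = a * u\<^sup>2" by simp
    have "\<bar>u\<bar> \<le> 1 * u\<^sup>2"
    proof (cases "u = 0")
      case False
      hence "\<bar>u\<bar> * 1 \<le> \<bar>u\<bar> * \<bar>u\<bar>" by (intro mult_left_mono) auto
      thus ?thesis by (simp add: power2_eq_square)
    qed simp
    also have "1 * u\<^sup>2 \<le> a * u\<^sup>2" using assms by (intro mult_right_mono) auto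
    finally show "u \<in> {- c..c}" unfolding c by auto
  qed
qed simp

lemma chi12_linear: "chi12 (6 * j - 1) = alt_sign j"
proof (cases "even j")
  case True
  hence "(6 * j - 1) mod 12 = 11" by presburger
  thus ?thesis using True by (simp add: chi12_def alt_sign_def)
next
  case False
  hence "(6 * j - 1) mod 12 = 5" by presburger
  thus ?thesis using False by (simp add: chi12_def alt_sign_def)
qed

lemma mod_12_cases: "(u :: int) mod 12 \<in> {0, 1, 2, 3, 4, 5, 6, 7, 8, 9, 10, 11}"
proof -
  have "0 \<le> u mod 12" "u mod 12 < 12" by simp_all
  thus ?thesis by (simp only: insert_iff empty_iff) presburger
qed

lemma chi12_minus: "chi12 (- u) = chi12 u"
proof -
  have "(- u) mod 12 = (- (u mod 12)) mod 12"
    by (simp add: mod_minus_eq)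
  thus ?thesis using mod_12_cases[of u] unfolding chi12_def by auto
qed

lemma chi12_eq_0:
  assumes "u mod 6 \<noteq> 1" "u mod 6 \<noteq> 5"
  shows "chi12 u = 0"
proof -
  have "(u mod 12) mod 6 = u mod 6" by (simp add: mod_mod_cancel)
  thus ?thesis using assms mod_12_cases[of u] by (auto simp: chi12_def)
qed

lemma q_factorial_mult_3:
  "q_factorial q (3 * n) = q_factorial (q ^ 3) n * (\<Prod>i<n. (1 - q ^ (3 * i + 1)) * (1 - q ^ (3 * i + (3 - 1))))"
proof (induction n)
  case (Suc n)
  have "3 * Suc n = Suc (Suc (Suc (3 * n)))" by simp
  hence "q_factorial q (3 * Suc n) =
     q_factorial q (3 * n) * (1 - q ^ (3 * n + 1)) * (1 - q ^ (3 * n + 2)) * (1 - q ^ (3 * n + 3))"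
    by (simp only: q_factorial_Suc) (simp add: eval_nat_numeral)
  moreover have "(q ^ 3) ^ Suc n = q ^ (3 * n + 3)"
    unfolding power_mult[symmetric] by (rule arg_cong[of _ _ "\<lambda>i. q ^ i"]) simp
  ultimately show ?case by (simp only: Suc q_factorial_Suc prod.lessThan_Suc) (simp add: mult_ac)
qed simp

lemma q_factorial_mult_2:
  "q_factorial q (2 * n) = q_factorial (q ^ 2) n * (\<Prod>i<n. 1 - q ^ (2 * i + 1))"
proof (induction n)
  case (Suc n)
  have "2 * Suc n = Suc (Suc (2 * n))" by simp
  hence "q_factorial q (2 * Suc n) =
     q_factorial q (2 * n) * (1 - q ^ (2 * n + 1)) * (1 - q ^ (2 * n + 2))"
    by (simp only: q_factorial_Suc) (simp add: eval_nat_numeral)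
  moreover have "(q ^ 2) ^ Suc n = q ^ (2 * n + 2)"
    unfolding power_mult[symmetric] by (rule arg_cong[of _ _ "\<lambda>i. q ^ i"]) simp
  ultimately show ?case by (simp only: Suc q_factorial_Suc prod.lessThan_Suc) (simp add: mult_ac)
qed simp

text \<open>Euler's pentagonal number theorem with the square completed by
  \<open>u = 6 * j - 1\<close>. Each \<open>j\<close> accounts for the pair \<open>u\<close>,
  \<open>- u\<close>, whence the factor 2; solutions \<open>u\<close> not prime to 6 have weight
  0.\<close>

lemma euler_f_nth:
  assumes "k > 0"
  shows "2 * fps_nth (euler_f k) N = (\<Sum>u | int k * u\<^sup>2 = 24 * int N + int k. chi12 u)"
proof -
  define J where "J = {j. int k * (int 3 * (j * (j - 1)) + 2 * int 1 * j) = 2 * int N}"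
  define U where "U = {u. int k * u\<^sup>2 = 24 * int N + int k}"
  define V where "V = {u \<in> U. u mod 6 = 5}"
  have fin: "finite U" unfolding U_def using assms by (intro finite_int_square_eq) simp
  \<comment> \<open>A length divisible by 3 lets the factorial split by residues modulo 3, which is
    the triple product with \<open>m = 3\<close> and \<open>r = 1\<close>.\<close>
  have "fps_nth (euler_f k) N = fps_nth (q_factorial (fps_X ^ k) (3 * Suc N)) N"
    using eq_upto_euler_f[OF assms, of "Suc N" "3 * Suc N"] by (simp add: eq_upto_def)
  also have "\<dots> = sum alt_sign J"
    unfolding q_factorial_mult_3 J_def by (rule triple_product_nth) (use assms in auto)
  also have "\<dots> = (\<Sum>j\<in>J. chi12 (6 * j - 1))"
    by (simp add: chi12_linear)
  also have "\<dots> = sum chi12 ((\<lambda>j. 6 * j - 1) ` J)"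
    by (subst sum.reindex) (auto simp: inj_on_def)
  also have "(\<lambda>j. 6 * j - 1) ` J = V"
  proof -
    have *: "6 * j - 1 \<in> U \<longleftrightarrow> j \<in> J" for j
    proof -
      have "12 * (int k * (int 3 * (j * (j - 1)) + 2 * int 1 * j)) = int k * (6 * j - 1)\<^sup>2 - int k"
        by (simp add: power2_eq_square algebra_simps)
      thus ?thesis unfolding U_def J_def by auto
    qed
    have "u \<in> (\<lambda>j. 6 * j - 1) ` J" if "u \<in> V" for u
    proof -
      define j where "j = (u + 1) div 6"
      have "u mod 6 = 5" using that by (simp add: V_def)
      hence "u = 6 * j - 1" unfolding j_def by presburger
      thus ?thesis using that * by (auto simp: V_def)
    qed
    moreover have "(6 * j - 1) mod 6 = 5" for j :: int by presburger
    ultimately show ?thesis using * by (auto simp: V_def)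
  qed
  finally have 1: "fps_nth (euler_f k) N = sum chi12 V" .
  have 2: "sum chi12 (uminus ` V) = sum chi12 V"
    by (subst sum.reindex) (auto simp: inj_on_def chi12_minus)
  have "sum chi12 (V \<union> uminus ` V) = sum chi12 U"
  proof (rule sum.mono_neutral_left[OF fin])
    show "V \<union> uminus ` V \<subseteq> U" by (auto simp: V_def U_def)
    show "\<forall>u\<in>U - (V \<union> uminus ` V). chi12 u = 0"
    proof
      fix u assume u: "u \<in> U - (V \<union> uminus ` V)"
      hence "u mod 6 \<noteq> 5" by (auto simp: V_def)
      moreover have "(- u) mod 6 \<noteq> 5"
      proof
        assume "(- u) mod 6 = 5"
        hence "- u \<in> V" using u by (auto simp: V_def U_def)
        hence "u \<in> uminus ` V" by (metis image_eqI minus_minus)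
        thus False using u by blast
      qed
      moreover have "u mod 6 = 1 \<Longrightarrow> (- u) mod 6 = 5" by presburger
      ultimately show "chi12 u = 0" by (intro chi12_eq_0) auto
    qed
  qed
  moreover have "V \<inter> uminus ` V = {}"
  proof -
    have "\<not> (u mod 6 = 5 \<and> (- u) mod 6 = 5)" for u :: int by presburger
    thus ?thesis by (auto simp: V_def)
  qed
  moreover have "finite V" using fin by (simp add: V_def)
  ultimately have "sum chi12 U = sum chi12 V + sum chi12 (uminus ` V)"
    by (simp add: sum.union_disjoint)
  thus ?thesis using 1 2 by (simp add: U_def)
qed

text \<open>Jacobi's series for the cube with \<open>u = 2 * j + 1\<close>, since eight times a
  triangular number plus one is an odd square. The weight \<open>chi4 u * u\<close> is even in
  \<open>u\<close>, so both signs contribute equally.\<close>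

lemma euler_f_cubed_nth:
  assumes "k > 0"
  shows "2 * fps_nth (euler_f k ^ 3) N = (\<Sum>u | int k * u\<^sup>2 = 8 * int N + int k. chi4 u * u)"
proof -
  define q where "q = (fps_X ^ k :: int fps)"
  define n where "n = Suc N"
  define A where "A = {j\<in>{..n}. N = k * (Suc j choose 2)}"
  define w where "w u = chi4 u * u" for u
  define U where "U = {u. int k * u\<^sup>2 = 8 * int N + int k}"
  have fin: "finite U" unfolding U_def using assms by (intro finite_int_square_eq) simp
  have nth: "fps_nth (q_factorial q n * q_binomial q (2 * n + 1) l * q ^ (Suc j choose 2)) N
      = (if N = k * (Suc j choose 2) then 1 else 0)" if "j \<le> n" "l = n + 1 + j \<or> l = n - j" for j l
  proof -
    have "(Suc j choose 2) * 1 \<le> (Suc j choose 2) * k" using assms by (intro mult_le_mono2) simp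
    hence e: "n \<le> Suc (n - j) + (Suc j choose 2) * k"
      using le_choose_two_Suc(2)[of j] that by linarith
    show ?thesis
      unfolding q_def power_mult[symmetric] mult.commute[of _ "Suc j choose 2"]
      using that by (intro q_binomial_tail_nth[where m = 1, OF assms _ _ _ _ _ e])
        (auto simp: n_def mult.commute)
  qed
  have q0: "q \<noteq> 0" by (simp add: q_def)
  have "fps_nth (euler_f k ^ 3) N = fps_nth (q_factorial q n ^ 3) N"
    using eq_upto_power[OF eq_upto_euler_f[OF assms order.refl, of n], of 3]
    by (simp add: eq_upto_def n_def q_def)
  also have "q_factorial q n ^ 3 = q_factorial q n * (q_factorial q n)\<^sup>2"
    by (simp add: power3_eq_cube power2_eq_square mult.assoc)
  also have "\<dots> = (\<Sum>j\<le>n.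
      fps_const ((-1) ^ j * int (n + 1 + j)) * (q_factorial q n * q_binomial q (2 * n + 1) (n + 1 + j) * q ^ (Suc j choose 2))
    - fps_const ((-1) ^ j * int (n - j)) * (q_factorial q n * q_binomial q (2 * n + 1) (n - j) * q ^ (Suc j choose 2)))"
    unfolding finite_jacobi_identity[OF q0, symmetric] sum_distrib_left
  proof (intro sum.cong refl)
    fix j
    have fc: "fps_const ((-1) ^ j * int a) = (-1) ^ j * of_nat a" for a
      by (cases "even j") (simp_all add: fps_of_nat flip: fps_const_neg)
    show "q_factorial q n * ((-1) ^ j * (of_nat (n + 1 + j) * q_binomial q (2 * n + 1) (n + 1 + j)
             - of_nat (n - j) * q_binomial q (2 * n + 1) (n - j)) * q ^ (Suc j choose 2)) =
      fps_const ((-1) ^ j * int (n + 1 + j)) * (q_factorial q n * q_binomial q (2 * n + 1) (n + 1 + j) * q ^ (Suc j choose 2))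
    - fps_const ((-1) ^ j * int (n - j)) * (q_factorial q n * q_binomial q (2 * n + 1) (n - j) * q ^ (Suc j choose 2))"
      unfolding fc by (simp only: right_diff_distrib left_diff_distrib mult_ac)
  qed
  also have "fps_nth \<dots> N = (\<Sum>j\<le>n. if N = k * (Suc j choose 2) then (-1) ^ j * (2 * int j + 1) else 0)"
    unfolding fps_sum_nth fps_sub_nth fps_mult_left_const_nth
  proof (intro sum.cong refl)
    fix j assume "j \<in> {..n}"
    hence j: "j \<le> n" by simp
    show "(- 1) ^ j * int (n + 1 + j) * fps_nth (q_factorial q n * q_binomial q (2 * n + 1) (n + 1 + j) * q ^ (Suc j choose 2)) N
      - (- 1) ^ j * int (n - j) * fps_nth (q_factorial q n * q_binomial q (2 * n + 1) (n - j) * q ^ (Suc j choose 2)) N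
      = (if N = k * (Suc j choose 2) then (-1) ^ j * (2 * int j + 1) else 0)"
      unfolding nth[OF j disjI1[OF refl]] nth[OF j disjI2[OF refl]] of_nat_diff[OF j]
      by (simp add: algebra_simps)
  qed
  also have "\<dots> = (\<Sum>j\<in>A. (-1) ^ j * (2 * int j + 1))"
    unfolding A_def by (simp add: sum.If_cases Int_def)
  finally have 1: "fps_nth (euler_f k ^ 3) N = (\<Sum>j\<in>A. (-1) ^ j * (2 * int j + 1))" .
  have w: "w (2 * int j + 1) = (-1) ^ j * (2 * int j + 1)" "w (- (2 * int j + 1)) = (-1) ^ j * (2 * int j + 1)" for j
  proof -
    have "chi4 (2 * int j + 1) = alt_sign (int j)" "chi4 (- (2 * int j + 1)) = - alt_sign (int j)"
    proof -
      have "(2 * int j + 1) mod 4 = (if even j then 1 else 3)"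
        "(- (2 * int j + 1)) mod 4 = (if even j then 3 else 1)" by presburger+
      thus "chi4 (2 * int j + 1) = alt_sign (int j)" "chi4 (- (2 * int j + 1)) = - alt_sign (int j)"
        by (auto simp: chi4_def alt_sign_def)
    qed
    thus "w (2 * int j + 1) = (-1) ^ j * (2 * int j + 1)" "w (- (2 * int j + 1)) = (-1) ^ j * (2 * int j + 1)"
      by (simp_all add: w_def alt_sign_int algebra_simps)
  qed
  have U: "2 * int j + 1 \<in> U \<longleftrightarrow> j \<in> A" for j
  proof -
    have "2 * (Suc j choose 2) = j * j + j"
      using two_mult_choose_two[of "Suc j"] by simp
    from arg_cong[OF this, of int] have two: "2 * int (Suc j choose 2) = int j * int j + int j"
      by (simp only: of_nat_mult of_nat_add of_nat_numeral)
    have "int k * (2 * int j + 1)\<^sup>2 = 4 * (int k * (2 * int (Suc j choose 2))) + int k"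
      unfolding two by (simp add: power2_eq_square algebra_simps)
    also have "\<dots> = 8 * int (k * (Suc j choose 2)) + int k"
      by (simp only: of_nat_mult)
    finally have "2 * int j + 1 \<in> U \<longleftrightarrow> N = k * (Suc j choose 2)"
      unfolding U_def mem_Collect_eq by (simp only: add_right_cancel mult_cancel_left of_nat_eq_iff) auto
    moreover have "j \<le> k * (Suc j choose 2)"
      using le_choose_two_Suc(2)[of j] assms by (simp add: le_trans)
    ultimately show ?thesis by (auto simp: A_def n_def)
  qed
  have "sum w ((\<lambda>j. 2 * int j + 1) ` A \<union> (\<lambda>j. - (2 * int j + 1)) ` A) = sum w U"
  proof (rule sum.mono_neutral_left[OF fin])
    show "(\<lambda>j. 2 * int j + 1) ` A \<union> (\<lambda>j. - (2 * int j + 1)) ` A \<subseteq> U"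
      using U unfolding U_def by (auto simp: power2_eq_square algebra_simps)
    have *: "u \<in> (\<lambda>j. 2 * int j + 1) ` A \<union> (\<lambda>j. - (2 * int j + 1)) ` A" if "u \<in> U" "odd u" for u
    proof (cases "u > 0")
      case True
      hence "u = 2 * (u div 2) + 1" "u div 2 \<ge> 0" using \<open>odd u\<close> by presburger+
      hence "u = 2 * int (nat (u div 2)) + 1" by simp
      thus ?thesis using U[of "nat (u div 2)"] that by (intro UnI1 image_eqI[of _ _ "nat (u div 2)"]) auto
    next
      case False
      hence "- u = 2 * ((- u) div 2) + 1" "(- u) div 2 \<ge> 0" using \<open>odd u\<close> by presburger+
      hence "- u = 2 * int (nat ((- u) div 2)) + 1" by simp
      moreover have "- u \<in> U" using that by (simp add: U_def)
      ultimately show ?thesis using U[of "nat ((- u) div 2)"]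
        by (intro UnI2 image_eqI[of _ _ "nat ((- u) div 2)"]) auto
    qed
    show "\<forall>u\<in>U - ((\<lambda>j. 2 * int j + 1) ` A \<union> (\<lambda>j. - (2 * int j + 1)) ` A). w u = 0"
    proof
      fix u assume "u \<in> U - ((\<lambda>j. 2 * int j + 1) ` A \<union> (\<lambda>j. - (2 * int j + 1)) ` A)"
      hence "even u" using * by blast
      hence "chi4 u = 0" unfolding chi4_def by presburger
      thus "w u = 0" by (simp add: w_def)
    qed
  qed
  also have "sum w ((\<lambda>j. 2 * int j + 1) ` A \<union> (\<lambda>j. - (2 * int j + 1)) ` A)
     = (\<Sum>j\<in>A. (-1) ^ j * (2 * int j + 1)) + (\<Sum>j\<in>A. (-1) ^ j * (2 * int j + 1))"
  proof -
    have inj: "inj_on (\<lambda>j. 2 * int j + 1) A" "inj_on (\<lambda>j. - (2 * int j + 1)) A"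
      by (auto simp: inj_on_def)
    have "finite A" by (simp add: A_def)
    moreover have "(\<lambda>j. 2 * int j + 1) ` A \<inter> (\<lambda>j. - (2 * int j + 1)) ` A = {}" by auto
    ultimately show ?thesis
      by (simp only: sum.union_disjoint finite_imageI sum.reindex[OF inj(1)] sum.reindex[OF inj(2)] comp_def w)
  qed
  finally show ?thesis using 1 by (simp add: U_def w_def)
qed

definition gauss_phi :: "int fps" where
  "gauss_phi = Abs_fps (\<lambda>N. \<Sum>y | y\<^sup>2 = int N. alt_sign y)"

text \<open>The triple product with \<open>m = 2\<close>, \<open>r = 1\<close> is \<open>f_2\<close>
  times the square of the product over odd exponents; a second \<open>f_2\<close> completes each of
  the two odd products to \<open>f_1\<close>.\<close>

lemma gauss_phi_mult_euler_f: "gauss_phi * euler_f 2 = (euler_f 1)\<^sup>2"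
proof (rule eq_upto_imp_eq)
  fix n
  define P where "P = (\<Prod>i<n. 1 - (fps_X :: int fps) ^ (2 * i + 1))"
  define F where "F = q_factorial ((fps_X :: int fps) ^ 2) n"
  have "eq_upto n gauss_phi (F * (P * P))"
    unfolding eq_upto_def
  proof (intro allI impI)
    fix N assume "N < n"
    have "fps_nth gauss_phi N = (\<Sum>j | int 1 * (int 2 * (j * (j - 1)) + 2 * int 1 * j) = 2 * int N. alt_sign j)"
      by (simp add: gauss_phi_def power2_eq_square algebra_simps)
    also have "\<dots> = fps_nth (F * (P * P)) N"
    proof -
      have "(2::nat) - 1 = 1" by simp
      thus ?thesis
        using triple_product_nth[of 1 2 1 N n] \<open>N < n\<close>
        by (simp only: F_def P_def power_one_right prod.distrib zero_less_one one_less_numeral_iff semiring_norm(76))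
    qed
    finally show "fps_nth gauss_phi N = fps_nth (F * (P * P)) N" .
  qed
  moreover have "eq_upto n (euler_f 2) F"
    unfolding F_def by (rule eq_upto_euler_f) auto
  ultimately have "eq_upto n (gauss_phi * euler_f 2) (F * (P * P) * F)"
    by (rule eq_upto_mult)
  moreover have "F * (P * P) * F = (q_factorial (fps_X ^ 1) (2 * n))\<^sup>2"
    unfolding q_factorial_mult_2 power_one_right F_def P_def by (simp add: power2_eq_square mult_ac)
  moreover have "eq_upto n ((euler_f 1)\<^sup>2) ((q_factorial (fps_X ^ 1) (2 * n))\<^sup>2)"
    by (intro eq_upto_power eq_upto_euler_f) auto
  ultimately show "eq_upto n (gauss_phi * euler_f 2) ((euler_f 1)\<^sup>2)"
    using eq_upto_trans eq_upto_sym by metis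
qed

section \<open>The congruence modulo 16\<close>

definition chi3 :: "int \<Rightarrow> int" where
  "chi3 u = (if u mod 3 = 1 then 1 else if u mod 3 = 2 then -1 else 0)"

lemma chi12_eq: "chi12 u = chi3 u * chi4 u"
proof -
  define r where "r = u mod 12"
  have "u mod 3 = r mod 3" "u mod 4 = r mod 4"
    unfolding r_def by (rule mod_mod_cancel [symmetric], simp)+
  thus ?thesis using mod_12_cases[of u]
    unfolding chi12_def chi3_def chi4_def r_def[symmetric] by (elim insertE emptyE; simp)
qed

lemma mod_3_cases: "(u :: int) mod 3 \<in> {0, 1, 2}"
proof -
  have "0 \<le> u mod 3" "u mod 3 < 3" by simp_all
  thus ?thesis by (simp only: insert_iff empty_iff) presburger
qed

lemma chi3_cong: "u mod 3 = v mod 3 \<Longrightarrow> chi3 u = chi3 v"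
  by (simp add: chi3_def)

lemma chi4_cong: "u mod 4 = v mod 4 \<Longrightarrow> chi4 u = chi4 v"
  by (simp add: chi4_def)

lemma chi3_minus: "chi3 (- u) = - chi3 u"
proof -
  define r where "r = u mod 3"
  have "(- u) mod 3 = (- r) mod 3" unfolding r_def by (rule mod_minus_eq [symmetric])
  thus ?thesis using mod_3_cases[of u] unfolding chi3_def r_def[symmetric] by auto
qed

lemma chi4_minus: "chi4 (- u) = - chi4 u"
proof -
  define r where "r = u mod 4"
  have "(- u) mod 4 = (- r) mod 4" unfolding r_def by (rule mod_minus_eq [symmetric])
  moreover have "r = 0 \<or> r = 1 \<or> r = 2 \<or> r = 3" unfolding r_def by presburger
  ultimately show ?thesis unfolding chi4_def r_def[symmetric] by auto
qed

lemma chi3_mult: "chi3 (u * v) = chi3 u * chi3 v"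
proof -
  define r s where "r = u mod 3" and "s = v mod 3"
  have "(u * v) mod 3 = (r * s) mod 3" unfolding r_def s_def by (rule mod_mult_eq [symmetric])
  thus ?thesis using mod_3_cases[of u] mod_3_cases[of v]
    unfolding chi3_def r_def[symmetric] s_def[symmetric] by auto
qed

lemma chi3_5: "chi3 (5 * u) = - chi3 u"
  using chi3_mult[of 5 u] by (simp add: chi3_def[of 5])

lemma chi4_5: "chi4 (5 * u) = chi4 u"
proof (rule chi4_cong)
  have "5 * u = u + 4 * u" by simp
  thus "5 * u mod 4 = u mod 4" by (simp only: mod_mult_self2)
qed

lemma finite_int_pairs_eq:
  assumes "a > 0" "b > 0"
  shows "finite {(u::int, v::int). a * u\<^sup>2 + b * v\<^sup>2 = c}"
proof (rule finite_subset)
  have le: "\<bar>u\<bar> \<le> a * u\<^sup>2" if "a > 0" for a u :: int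
  proof (cases "u = 0")
    case False
    hence "\<bar>u\<bar> * 1 \<le> \<bar>u\<bar> * \<bar>u\<bar>" by (intro mult_left_mono) auto
    also have "\<dots> = 1 * u\<^sup>2" by (simp add: power2_eq_square)
    also have "\<dots> \<le> a * u\<^sup>2" using that by (intro mult_right_mono) auto
    finally show ?thesis by simp
  qed simp
  show "{(u, v). a * u\<^sup>2 + b * v\<^sup>2 = c} \<subseteq> {- c..c} \<times> {- c..c}"
  proof clarify
    fix u v :: int
    show "u \<in> {- (a * u\<^sup>2 + b * v\<^sup>2)..a * u\<^sup>2 + b * v\<^sup>2} \<and> v \<in> {- (a * u\<^sup>2 + b * v\<^sup>2)..a * u\<^sup>2 + b * v\<^sup>2}"
      using le[OF assms(1), of u] le[OF assms(2), of v] by auto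
  qed
qed simp

section \<open>Products of theta series and the series for \<open>f_1^5 / f_2^2\<close>\<close>

text \<open>The convolution is a disjoint union because \<open>a * u\<^sup>2\<close> determines the
  index. The support hypotheses exclude pairs that represent the total correctly although their two
  summands are not admissible separately.\<close>

lemma theta_mult_nth:
  fixes f g :: "int fps"
  assumes f: "\<And>N. \<alpha> * fps_nth f N = (\<Sum>u | a * u\<^sup>2 = c * int N + a'. w u)"
    and g: "\<And>N. \<beta> * fps_nth g N = (\<Sum>v | b * v\<^sup>2 = c * int N + b'. w' v)"
    and pos: "a > 0" "b > 0" "c > 0"
    and supp: "\<And>u. w u \<noteq> 0 \<Longrightarrow> \<exists>N. a * u\<^sup>2 = c * int N + a'"
      "\<And>v. w' v \<noteq> 0 \<Longrightarrow> \<exists>N. b * v\<^sup>2 = c * int N + b'"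
  shows "\<alpha> * \<beta> * fps_nth (f * g) N
    = (\<Sum>(u, v) | a * u\<^sup>2 + b * v\<^sup>2 = c * int N + (a' + b'). w u * w' v)"
proof -
  define U where "U N = {u. a * u\<^sup>2 = c * int N + a'}" for N
  define V where "V N = {v. b * v\<^sup>2 = c * int N + b'}" for N
  define S where "S = {(u, v). a * u\<^sup>2 + b * v\<^sup>2 = c * int N + (a' + b')}"
  define h where "h = (\<lambda>(u, v). w u * w' v)"
  have fin: "finite (U i)" "finite (V i)" for i
    unfolding U_def V_def using pos by (auto intro: finite_int_square_eq)
  have "\<alpha> * \<beta> * fps_nth (f * g) N = (\<Sum>i\<le>N. (\<alpha> * fps_nth f i) * (\<beta> * fps_nth g (N - i)))"
    by (simp add: fps_mult_nth sum_distrib_left mult_ac atLeast0AtMost)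
  also have "\<dots> = (\<Sum>i\<le>N. sum h (U i \<times> V (N - i)))"
    unfolding f g U_def[symmetric] V_def[symmetric] h_def
    by (simp add: sum_product sum.cartesian_product)
  also have "\<dots> = sum h (\<Union>i\<le>N. U i \<times> V (N - i))"
  proof (rule sum.UNION_disjoint [symmetric])
    show "\<forall>i\<in>{..N}. finite (U i \<times> V (N - i))" using fin by auto
    show "\<forall>i\<in>{..N}. \<forall>j\<in>{..N}. i \<noteq> j \<longrightarrow> U i \<times> V (N - i) \<inter> U j \<times> V (N - j) = {}"
      using pos by (auto simp: U_def)
  qed simp
  also have "\<dots> = sum h S"
  proof (rule sum.mono_neutral_left)
    show "finite S" unfolding S_def using pos by (intro finite_int_pairs_eq)
    show "(\<Union>i\<le>N. U i \<times> V (N - i)) \<subseteq> S"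
      by (auto simp: U_def V_def S_def of_nat_diff algebra_simps)
    show "\<forall>p\<in>S - (\<Union>i\<le>N. U i \<times> V (N - i)). h p = 0"
    proof (clarify, rule ccontr)
      fix u v assume uv: "(u, v) \<in> S" "(u, v) \<notin> (\<Union>i\<le>N. U i \<times> V (N - i))" "h (u, v) \<noteq> 0"
      then obtain i j where ij: "a * u\<^sup>2 = c * int i + a'" "b * v\<^sup>2 = c * int j + b'"
        using supp[of u] supp[of v] unfolding h_def by auto
      hence "c * (int i + int j) = c * int N" using uv(1) by (simp add: S_def algebra_simps)
      hence "i + j = N" using pos by simp
      hence "(u, v) \<in> (\<Union>i\<le>N. U i \<times> V (N - i))"
        using ij by (auto simp: U_def V_def intro!: exI[of _ i])
      thus False using uv(2) by blast
    qed
  qed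
  finally show ?thesis by (simp add: h_def S_def)
qed

lemma sum_involution:
  assumes "\<And>p. p \<in> S \<Longrightarrow> \<sigma> p \<in> S" "\<And>p. p \<in> S \<Longrightarrow> \<sigma> (\<sigma> p) = p"
  shows "(\<Sum>p\<in>S. f (\<sigma> p)) = sum f S"
  by (rule sum.reindex_bij_witness[of _ \<sigma> \<sigma>]) (use assms in auto)

lemma sum_involution_half:
  fixes f :: "'a \<Rightarrow> int"
  assumes "finite S" and "\<And>p. p \<in> S \<Longrightarrow> \<sigma> p \<in> S" "\<And>p. p \<in> S \<Longrightarrow> \<sigma> (\<sigma> p) = p"
    and "\<And>p. p \<in> S \<Longrightarrow> P (\<sigma> p) \<longleftrightarrow> \<not> P p" "\<And>p. p \<in> S \<Longrightarrow> f (\<sigma> p) = f p"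
  shows "sum f S = 2 * sum f {p\<in>S. P p}"
proof -
  have "sum f S = sum f {p\<in>S. P p} + sum f {p\<in>S. \<not> P p}"
    using assms(1) by (subst sum.union_disjoint [symmetric]) (auto intro!: sum.cong)
  also have "sum f {p\<in>S. \<not> P p} = sum f {p\<in>S. P p}"
    by (rule sum.reindex_bij_witness[of _ \<sigma> \<sigma>]) (use assms in auto)
  finally show ?thesis by simp
qed

text \<open>On odd \<open>u\<close> this is half of the even weight \<open>u * chi3 u\<close>: it
  picks one of \<open>u\<close> and \<open>- u\<close>, so the coefficients of
  \<open>theta_T\<close> need no factor 2.\<close>

definition theta_w :: "int \<Rightarrow> int" where
  "theta_w u = (if u mod 6 = 1 then u else 0)"

definition theta_T :: "int fps" where
  "theta_T = Abs_fps (\<lambda>N. \<Sum>u | u\<^sup>2 = 24 * int N + 1. theta_w u)"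

lemma square_mod_24:
  assumes "(u::int) mod 6 = 1 \<or> u mod 6 = 5"
  obtains N where "u\<^sup>2 = 24 * int N + 1"
proof -
  have "\<exists>j. u = 6 * j + 1 \<or> u = 6 * j - 1" using assms by presburger
  then obtain j where j: "u = 6 * j + 1 \<or> u = 6 * j - 1" ..
  have ev: "even (j * (3 * j + 1))" "even (j * (3 * j - 1))" by auto
  obtain t where t: "u\<^sup>2 = 24 * t + 1"
  proof (cases "u = 6 * j + 1")
    case True
    obtain t where "j * (3 * j + 1) = 2 * t" using ev(1) by (elim evenE)
    hence "u\<^sup>2 = 24 * t + 1" unfolding True by (simp add: power2_eq_square algebra_simps)
    thus ?thesis by (rule that)
  next
    case False
    hence u: "u = 6 * j - 1" using j by simp
    obtain t where "j * (3 * j - 1) = 2 * t" using ev(2) by (elim evenE)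
    hence "u\<^sup>2 = 24 * t + 1" unfolding u by (simp add: power2_eq_square algebra_simps)
    thus ?thesis by (rule that)
  qed
  have "u\<^sup>2 \<ge> 0" by simp
  hence "t \<ge> 0" using t by linarith
  thus ?thesis using t that[of "nat t"] by simp
qed

lemma chi12_support: "chi12 u \<noteq> 0 \<Longrightarrow> \<exists>N. int k * u\<^sup>2 = 24 * int N + int k"
proof -
  assume "chi12 u \<noteq> 0"
  hence "u mod 6 = 1 \<or> u mod 6 = 5" using chi12_eq_0 by blast
  then obtain N where "u\<^sup>2 = 24 * int N + 1" by (rule square_mod_24)
  hence "int k * u\<^sup>2 = 24 * int (k * N) + int k" by (simp add: algebra_simps)
  thus ?thesis by blast
qed

lemma theta_w_support: "theta_w u \<noteq> 0 \<Longrightarrow> \<exists>N. 1 * u\<^sup>2 = 24 * int N + 1"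
  using square_mod_24[of u] by (auto simp: theta_w_def split: if_splits)

lemma chi4_support: "chi4 u * u \<noteq> 0 \<Longrightarrow> \<exists>N. 3 * u\<^sup>2 = 24 * int N + 3"
proof -
  assume "chi4 u * u \<noteq> 0"
  hence "u mod 4 = 1 \<or> u mod 4 = 3" by (auto simp: chi4_def split: if_splits)
  hence "odd u" by presburger
  then obtain j where u: "u = 2 * j + 1" by (elim oddE)
  obtain t where t: "j * (j + 1) = 2 * t" using evenE[of "j * (j + 1)"] by auto
  have sq: "u\<^sup>2 = 8 * t + 1" using t unfolding u by (simp add: power2_eq_square algebra_simps)
  have "u\<^sup>2 \<ge> 0" by simp
  hence "t \<ge> 0" using sq by linarith
  hence "3 * u\<^sup>2 = 24 * int (nat t) + 3" using sq by simp
  thus ?thesis by blast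
qed

lemma euler_f_1_nth: "2 * fps_nth (euler_f 1) N = (\<Sum>u | 1 * u\<^sup>2 = 24 * int N + 1. chi12 u)"
  using euler_f_nth[of 1 N] by simp

lemma theta_T_nth: "1 * fps_nth theta_T N = (\<Sum>u | 1 * u\<^sup>2 = 24 * int N + 1. theta_w u)"
  by (simp add: theta_T_def)

lemma theta_T_mult_euler_f_nth:
  "2 * fps_nth (theta_T * euler_f 2) N
     = (\<Sum>(u, v) | 1 * u\<^sup>2 + 2 * v\<^sup>2 = 24 * int N + (1 + 2). theta_w u * chi12 v)"
proof -
  have "1 * 2 * fps_nth (theta_T * euler_f 2) N
     = (\<Sum>(u, v) | 1 * u\<^sup>2 + 2 * v\<^sup>2 = 24 * int N + (1 + 2). theta_w u * chi12 v)"
    by (rule theta_mult_nth) (use theta_T_nth euler_f_nth[of 2] theta_w_support chi12_support[of _ 2] in simp_all)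
  thus ?thesis by simp
qed

lemma euler_f_cubed_mult_gauss_phi_nth:
  "2 * fps_nth (euler_f 1 ^ 3 * gauss_phi) N
     = (\<Sum>(x, y) | 3 * x\<^sup>2 + 24 * y\<^sup>2 = 24 * int N + (3 + 0). (chi4 x * x) * alt_sign y)"
proof -
  have J: "2 * fps_nth (euler_f 1 ^ 3) N = (\<Sum>u | 3 * u\<^sup>2 = 24 * int N + 3. chi4 u * u)" for N
  proof -
    have "{u. 3 * u\<^sup>2 = 24 * int N + 3} = {u. int 1 * u\<^sup>2 = 8 * int N + int 1}" by auto
    thus ?thesis using euler_f_cubed_nth[of 1 N] by (simp only: zero_less_one simp_thms)
  qed
  have phi: "1 * fps_nth gauss_phi N = (\<Sum>y | 24 * y\<^sup>2 = 24 * int N + 0. alt_sign y)" for N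
    by (simp add: gauss_phi_def)
  have supp: "\<exists>N. 24 * y\<^sup>2 = 24 * int N + 0" for y
    by (intro exI[of _ "nat (y\<^sup>2)"]) simp
  have "2 * 1 * fps_nth (euler_f 1 ^ 3 * gauss_phi) N
     = (\<Sum>(x, y) | 3 * x\<^sup>2 + 24 * y\<^sup>2 = 24 * int N + (3 + 0). (chi4 x * x) * alt_sign y)"
    by (rule theta_mult_nth[OF J phi]) (use chi4_support supp in auto)
  thus ?thesis by simp
qed

lemma chi4_add_2: "chi4 (x + 2) = - chi4 x"
proof -
  define r where "r = x mod 4"
  have "(x + 2) mod 4 = (r + 2) mod 4" unfolding r_def by (rule mod_add_left_eq [symmetric])
  moreover have "r = 0 \<or> r = 1 \<or> r = 2 \<or> r = 3" unfolding r_def by presburger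
  ultimately show ?thesis unfolding chi4_def r_def[symmetric] by auto
qed

lemma chi4_add_4_mult: "chi4 (x + 4 * y) = chi4 x"
  by (rule chi4_cong) simp

lemma chi4_add_2_mult: "chi4 (x + 2 * y) = chi4 x * alt_sign y"
proof (cases "even y")
  case True
  then obtain z where "y = 2 * z" by (elim evenE)
  thus ?thesis using chi4_add_4_mult[of x z] by (simp add: alt_sign_def)
next
  case False
  then obtain z where "y = 2 * z + 1" by (elim oddE)
  thus ?thesis using chi4_add_4_mult[of "x + 2" z] chi4_add_2[of x]
    by (simp add: alt_sign_def algebra_simps)
qed

lemma theta_w_symm: "odd u \<Longrightarrow> theta_w u + theta_w (- u) = u * chi3 u"
proof -
  assume "odd u"
  define r where "r = u mod 6"
  have "u mod 3 = r mod 3"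
    unfolding r_def by (rule mod_mod_cancel [symmetric]) simp
  moreover have "(- u) mod 6 = (- r) mod 6"
    unfolding r_def by (rule mod_minus_eq [symmetric])
  moreover have "r = 1 \<or> r = 3 \<or> r = 5" unfolding r_def using \<open>odd u\<close> by presburger
  ultimately show ?thesis unfolding theta_w_def chi3_def r_def[symmetric] by auto
qed

text \<open>In \<open>Z[sqrt(-2)]\<close> the two conditions say that \<open>u + v sqrt(-2)\<close>
  is divisible by \<open>1 + sqrt(-2)\<close> and by its conjugate, the primes above 3. This trades
  the characters modulo 3 for divisibility.\<close>

lemma chi3_mult_eq_diff:
  "(if 3 dvd u - v then 1 else 0) - (if 3 dvd u + v then 1 else 0) = chi3 u * chi3 v"
proof -
  define r s where "r = u mod 3" and "s = v mod 3"
  have a: "3 dvd u - v \<longleftrightarrow> r = s" by (simp only: r_def s_def mod_eq_dvd_iff)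
  have b: "3 dvd u + v \<longleftrightarrow> (r + s) mod 3 = 0"
    unfolding r_def s_def dvd_eq_mod_eq_0 mod_add_eq ..
  show ?thesis using mod_3_cases[of u] mod_3_cases[of v]
    unfolding a b chi3_def r_def[symmetric] s_def[symmetric] by (elim insertE emptyE; simp)
qed

text \<open>
  In \<open>\<int>[\<surd>-2]\<close> we have \<open>(x + 2y\<surd>-2)(1 + \<surd>-2) = (x - 4y) + (x + 2y)\<surd>-2\<close>, which turns
  representations of \<open>M\<close> by \<open>x\<^sup>2 + 8y\<^sup>2\<close> into representations of \<open>3M\<close> by \<open>u\<^sup>2 + 2v\<^sup>2\<close>.
\<close>

lemma theta_T_mult_euler_f: "theta_T * euler_f 2 = euler_f 1 ^ 3 * gauss_phi"
proof (rule fps_ext)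
  fix N
  define S where "S = {(u :: int, v). 1 * u\<^sup>2 + 2 * v\<^sup>2 = 24 * int N + (1 + 2)}"
  define R where "R = {(x :: int, y). 3 * x\<^sup>2 + 24 * y\<^sup>2 = 24 * int N + (3 + 0)}"
  define h where "h = (\<lambda>(u, v). theta_w u * chi12 v)"
  \<comment> \<open>\<open>h\<close> and \<open>g\<close> have the same total over each orbit of
    sign changes, but \<open>g\<close> is supported on the multiples of \<open>1 + sqrt(-2)\<close>,
    where division by that prime is possible.\<close>
  define g where "g = (\<lambda>(u, v). if 3 dvd u - v then u * chi4 v else 0)"
  define s where "s = (\<lambda>(u :: int, v :: int). (- u, v))"
  define t where "t = (\<lambda>(u :: int, v :: int). (u, - v))"
  have finS: "finite S" unfolding S_def by (rule finite_int_pairs_eq) auto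
  have symm: "4 * sum f S = (\<Sum>p\<in>S. f p + f (s p) + f (t p) + f (s (t p)))" for f :: "int \<times> int \<Rightarrow> int"
  proof -
    have "(\<Sum>p\<in>S. f (s p)) = sum f S" for f :: "int \<times> int \<Rightarrow> int"
      by (rule sum_involution) (auto simp: s_def S_def)
    moreover have "(\<Sum>p\<in>S. f (t p)) = sum f S" for f :: "int \<times> int \<Rightarrow> int"
      by (rule sum_involution) (auto simp: t_def S_def)
    ultimately show ?thesis
      using \<open>\<And>f. (\<Sum>p\<in>S. f (t p)) = sum f S\<close>[of "\<lambda>p. f (s p)"] by (simp add: sum.distrib)
  qed
  have odd: "odd u \<and> odd v" if "(u, v) \<in> S" for u v
  proof -
    have eq: "u\<^sup>2 + 2 * v\<^sup>2 = 24 * int N + 3" using that by (simp add: S_def)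
    have "odd (u\<^sup>2 + 2 * v\<^sup>2)" unfolding eq by simp
    hence "odd u" by simp
    then obtain j where u: "u = 2 * j + 1" by (elim oddE)
    have "2 * (v\<^sup>2 + 2 * (j * j + j)) = 2 * (12 * int N + 1)"
      using eq unfolding u by (simp add: power2_eq_square algebra_simps)
    hence "v\<^sup>2 + 2 * (j * j + j) = 12 * int N + 1" by simp
    hence "odd (v\<^sup>2 + 2 * (j * j + j))" by simp
    thus ?thesis using \<open>odd u\<close> by simp
  qed
  have "h p + h (s p) + h (t p) + h (s (t p)) = g p + g (s p) + g (t p) + g (s (t p))" if "p \<in> S" for p
  proof -
    obtain u v where p: "p = (u, v)" by fastforce
    have "odd u" using odd that p by blast
    have "h p + h (s p) + h (t p) + h (s (t p)) = 2 * (theta_w u + theta_w (- u)) * chi12 v"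
      by (simp add: p h_def s_def t_def chi12_minus algebra_simps)
    also have "\<dots> = 2 * u * chi4 v * (chi3 u * chi3 v)"
      unfolding theta_w_symm[OF \<open>odd u\<close>] chi12_eq by simp
    also have "\<dots> = g p + g (s p) + g (t p) + g (s (t p))"
    proof -
      have "3 dvd - u - v \<longleftrightarrow> 3 dvd u + v" "3 dvd - u + v \<longleftrightarrow> 3 dvd u - v" by presburger+
      thus ?thesis
        unfolding chi3_mult_eq_diff[symmetric] by (auto simp: p g_def s_def t_def chi4_minus)
    qed
    finally show ?thesis .
  qed
  hence "4 * sum h S = 4 * sum g S" unfolding symm by (intro sum.cong) auto
  hence "sum h S = sum g S" by simp
  also have "sum g S = sum g {p\<in>S. 3 dvd fst p - snd p}"
    by (rule sum.mono_neutral_right[OF finS]) (auto simp: g_def split: if_splits)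
  also have "\<dots> = (\<Sum>(x, y)\<in>R. (x - 4 * y) * (chi4 x * alt_sign y))"
  proof (rule sum.reindex_bij_witness[of _ "\<lambda>(x, y). (x - 4 * y, x + 2 * y)" "\<lambda>(u, v). ((u + 2 * v) div 3, (v - u) div 6)"])
    fix p assume p: "p \<in> {p\<in>S. 3 dvd fst p - snd p}"
    obtain u v where uv: "p = (u, v)" by fastforce
    have "odd u" "odd v" "3 dvd u - v" using p odd[of u v] uv by auto
    define y where "y = (v - u) div 6"
    have y: "v = u + 6 * y"
      unfolding y_def using \<open>odd u\<close> \<open>odd v\<close> \<open>3 dvd u - v\<close> by presburger
    define x where "x = u + 4 * y"
    have div: "(u + 2 * v) div 3 = x" "(v - u) div 6 = y"
      using y unfolding x_def by auto
    show "(\<lambda>(x, y). (x - 4 * y, x + 2 * y)) ((\<lambda>(u, v). ((u + 2 * v) div 3, (v - u) div 6)) p) = p"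
      by (simp add: uv div) (simp add: x_def y)
    have "(x, y) \<in> R" using p unfolding uv S_def R_def x_def y by (simp add: power2_eq_square algebra_simps)
    thus "(\<lambda>(u, v). ((u + 2 * v) div 3, (v - u) div 6)) p \<in> R"
      by (simp add: uv div)
    have "u = x - 4 * y" "v = x + 2 * y" by (simp_all add: x_def y)
    thus "(case (\<lambda>(u, v). ((u + 2 * v) div 3, (v - u) div 6)) p of (x, y) \<Rightarrow> (x - 4 * y) * (chi4 x * alt_sign y)) = g p"
      using \<open>3 dvd u - v\<close> by (simp add: uv div) (simp add: g_def chi4_add_2_mult)
  next
    fix p assume "p \<in> R"
    moreover obtain x y where xy: "p = (x, y)" by fastforce
    ultimately have "3 * x\<^sup>2 + 24 * y\<^sup>2 = 24 * int N + 3" by (simp add: R_def)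
    hence "(x - 4 * y)\<^sup>2 + 2 * (x + 2 * y)\<^sup>2 = 24 * int N + 3"
      by (simp add: power2_eq_square algebra_simps)
    moreover have "3 dvd (x - 4 * y) - (x + 2 * y)" by presburger
    ultimately show "(\<lambda>(x, y). (x - 4 * y, x + 2 * y)) p \<in> {p\<in>S. 3 dvd fst p - snd p}"
      by (simp add: xy S_def)
    show "(\<lambda>(u, v). ((u + 2 * v) div 3, (v - u) div 6)) ((\<lambda>(x, y). (x - 4 * y, x + 2 * y)) p) = p"
      by (simp add: xy)
  qed
  \<comment> \<open>From \<open>u = x - 4 * y\<close>: the part with \<open>x\<close> is the wanted
    coefficient, the part with \<open>y\<close> is odd under \<open>y -> -y\<close> and
    cancels.\<close>
  also have "\<dots> = (\<Sum>(x, y)\<in>R. (chi4 x * x) * alt_sign y) - 4 * (\<Sum>(x, y)\<in>R. y * (chi4 x * alt_sign y))"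
    unfolding sum_distrib_left sum_subtractf[symmetric] by (intro sum.cong refl) (auto simp: algebra_simps)
  also have "(\<Sum>(x, y)\<in>R. y * (chi4 x * alt_sign y)) = 0"
  proof -
    have "(\<Sum>p\<in>R. (\<lambda>(x, y). y * (chi4 x * alt_sign y)) (t p)) = (\<Sum>(x, y)\<in>R. y * (chi4 x * alt_sign y))"
      by (rule sum_involution) (auto simp: t_def R_def)
    moreover have "(\<Sum>p\<in>R. (\<lambda>(x, y). y * (chi4 x * alt_sign y)) (t p)) = - (\<Sum>(x, y)\<in>R. y * (chi4 x * alt_sign y))"
      unfolding sum_negf[symmetric] by (intro sum.cong refl) (auto simp: t_def alt_sign_def)
    ultimately show ?thesis by linarith
  qed
  finally have "sum h S = (\<Sum>(x, y)\<in>R. (chi4 x * x) * alt_sign y)" by simp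
  hence "2 * fps_nth (theta_T * euler_f 2) N = 2 * fps_nth (euler_f 1 ^ 3 * gauss_phi) N"
    unfolding theta_T_mult_euler_f_nth euler_f_cubed_mult_gauss_phi_nth h_def S_def R_def .
  thus "fps_nth (theta_T * euler_f 2) N = fps_nth (euler_f 1 ^ 3 * gauss_phi) N" by simp
qed

section \<open>Even arguments, and the approximation modulo 16\<close>

lemma fps_nth_compose_X_square:
  fixes f :: "int fps"
  shows "fps_nth (f oo fps_X ^ 2) (2 * m) = fps_nth f m"
proof -
  have "fps_nth (f oo fps_X ^ 2) (2 * m) = (\<Sum>i\<in>{0..2 * m}. if i = m then fps_nth f i else 0)"
    unfolding fps_compose_nth power_mult[symmetric] fps_X_power_nth by (intro sum.cong refl) auto
  thus ?thesis by simp
qed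

lemma eq_upto_compose_X_square:
  fixes f g :: "int fps"
  assumes "eq_upto n f g"
  shows "eq_upto n (f oo fps_X ^ 2) (g oo fps_X ^ 2)"
  using assms unfolding eq_upto_def fps_compose_nth by (intro allI impI sum.cong refl) auto

lemma q_factorial_compose_X_square:
  "q_factorial (fps_X ^ k) n oo fps_X ^ 2 = (q_factorial (fps_X ^ (2 * k)) n :: int fps)"
proof -
  have X0: "fps_nth (fps_X ^ 2 :: int fps) 0 = 0" by simp
  have "(fps_X ^ k) ^ Suc i oo fps_X ^ 2 = (fps_X ^ (2 * k) :: int fps) ^ Suc i" for i
  proof -
    have "(fps_X oo fps_X ^ 2 :: int fps) = fps_X ^ 2" by (rule fps_X_fps_compose_startby0) simp
    thus ?thesis
      unfolding power_mult[symmetric] by (simp only: fps_compose_power[OF X0, symmetric] power_mult)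
  qed
  thus ?thesis
    unfolding q_factorial_def
    by (simp only: fps_compose_prod_distrib[OF X0] fps_compose_sub_distrib fps_compose_1)
qed

lemma euler_f_double:
  assumes "k > 0"
  shows "euler_f (2 * k) = euler_f k oo fps_X ^ 2"
proof (rule eq_upto_imp_eq)
  fix n
  have "eq_upto n (euler_f k oo fps_X ^ 2) (q_factorial (fps_X ^ k) n oo fps_X ^ 2)"
    using assms by (intro eq_upto_compose_X_square eq_upto_euler_f) auto
  moreover have "eq_upto n (euler_f (2 * k)) (q_factorial (fps_X ^ (2 * k)) n)"
    using assms by (intro eq_upto_euler_f) auto
  ultimately show "eq_upto n (euler_f (2 * k)) (euler_f k oo fps_X ^ 2)"
    unfolding q_factorial_compose_X_square using eq_upto_trans eq_upto_sym by metis
qed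

definition eo_half :: "int fps" where
  "eo_half = (euler_f 2)\<^sup>2 * fps_right_inverse ((euler_f 1)\<^sup>2) 1"

lemma eo_half_mult: "eo_half * (euler_f 1)\<^sup>2 = (euler_f 2)\<^sup>2"
proof -
  have "(euler_f 1)\<^sup>2 * fps_right_inverse ((euler_f 1)\<^sup>2) 1 = 1"
    by (rule fps_right_inverse) (simp add: power2_eq_square euler_f_has_prod(2))
  thus ?thesis unfolding eo_half_def by Groebner_Basis.algebra
qed

lemma euler_f_nonzero: "k > 0 \<Longrightarrow> euler_f k \<noteq> 0"
  using euler_f_has_prod(2)[of k] by auto

text \<open>Replacing \<open>q\<close> by \<open>q^2\<close> turns \<open>f_1\<close> and
  \<open>f_2\<close> into \<open>f_2\<close> and \<open>f_4\<close>, so the defining quotient is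
  \<open>eo_half\<close> in \<open>q^2\<close>.\<close>

lemma EO_u_even: "EO_u (2 * m) = fps_nth eo_half m"
proof -
  let ?Q = "fps_X ^ 2 :: int fps"
  have Q0: "fps_nth ?Q 0 = 0" by simp
  have "Abs_fps EO_u * (euler_f 2)\<^sup>2 = (euler_f (2 * 2))\<^sup>2"
    using EO_u_generating_function by simp
  also have "\<dots> = (euler_f 2)\<^sup>2 oo ?Q"
    by (simp only: euler_f_double[of 2] zero_less_numeral fps_compose_power[OF Q0])
  also have "\<dots> = (eo_half oo ?Q) * ((euler_f 1)\<^sup>2 oo ?Q)"
    by (simp only: eo_half_mult[symmetric] fps_compose_mult_distrib[OF Q0])
  also have "(euler_f 1)\<^sup>2 oo ?Q = (euler_f (2 * 1))\<^sup>2"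
    by (simp only: euler_f_double[of 1] zero_less_one fps_compose_power[OF Q0])
  finally have "Abs_fps EO_u = eo_half oo fps_X ^ 2"
    using euler_f_nonzero[of 2] by simp
  thus ?thesis using fps_nth_compose_X_square[of eo_half m] by (metis fps_nth_Abs_fps)
qed

lemma fps_nth_numeral_mult: "fps_nth (numeral k * f) n = numeral k * fps_nth f n"
  for f :: "'a::comm_ring_1 fps"
  unfolding numeral_fps_const fps_mult_left_const_nth ..

lemma gauss_phi_nth_even:
  assumes "N > 0"
  shows "even (fps_nth gauss_phi N)"
proof (cases "\<exists>r::int. r\<^sup>2 = int N")
  case True
  then obtain r :: int where r: "r\<^sup>2 = int N" ..
  hence "r \<noteq> - r" using assms by auto
  have "{y. y\<^sup>2 = int N} = {r, - r}"
    unfolding r[symmetric] power2_eq_iff by auto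
  hence "fps_nth gauss_phi N = alt_sign r + alt_sign (- r)"
    using \<open>r \<noteq> - r\<close> by (simp add: gauss_phi_def)
  thus ?thesis by (simp add: alt_sign_def)
next
  case False
  hence "{y. y\<^sup>2 = int N} = {}" by blast
  thus ?thesis by (simp add: gauss_phi_def)
qed

lemma gauss_phi_nth_0: "fps_nth gauss_phi 0 = 1"
  by (simp add: gauss_phi_def alt_sign_def)

text \<open>
  Writing \<open>\<phi> = 1 + 2S\<close>, the square of \<open>\<phi>\<^sup>2 - 1 = 4S(S + 1)\<close> vanishes modulo 16, so that
  \<open>1/\<phi> \<equiv> 2\<phi> - \<phi>\<^sup>3\<close>.
\<close>

lemma eo_half_cong_16:
  "[fps_nth eo_half m = 2 * fps_nth (euler_f 1 * euler_f 1) m - fps_nth (theta_T * euler_f 1) m] (mod 16)"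
proof -
  define S where "S = Abs_fps (\<lambda>N. if N = 0 then 0 else fps_nth gauss_phi N div 2)"
  have S: "gauss_phi = 1 + 2 * S"
  proof (rule fps_ext)
    fix N
    show "fps_nth gauss_phi N = fps_nth (1 + 2 * S) N"
      using gauss_phi_nth_even[of N] gauss_phi_nth_0 by (auto simp: S_def fps_nth_numeral_mult)
  qed
  obtain v where v: "gauss_phi * v = 1"
    using fps_right_inverse[of gauss_phi 1] gauss_phi_nth_0 by auto
  define f g where "f = euler_f 1" and "g = euler_f 2"
  have nz: "g \<noteq> 0" "f \<noteq> 0" unfolding f_def g_def by (auto simp: euler_f_nonzero)
  have 1: "gauss_phi * g = f\<^sup>2" unfolding f_def g_def by (rule gauss_phi_mult_euler_f)
  have 2: "eo_half * f\<^sup>2 = g\<^sup>2" unfolding f_def g_def by (rule eo_half_mult)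
  have 3: "theta_T * g = f ^ 3 * gauss_phi" unfolding f_def g_def by (rule theta_T_mult_euler_f)
  \<comment> \<open>Cancelling \<open>g\<close> yields \<open>eo_half = f_2 / phi\<close>, and below
    \<open>theta_T * f_1 = phi^3 f_2\<close>, the two quantities that the approximation of
    \<open>1 / phi\<close> compares.\<close>
  have "g * (eo_half * gauss_phi) = g * g" using 1 2 by Groebner_Basis.algebra
  hence A: "eo_half * gauss_phi = g" using nz by simp
  have "g * (theta_T * f) = g * (gauss_phi ^ 3 * g)" using 1 3 by Groebner_Basis.algebra
  hence B: "theta_T * f = gauss_phi ^ 3 * g" using nz by simp
  have "gauss_phi * (eo_half - (2 * (f * f) - theta_T * f)) = g * (gauss_phi\<^sup>2 - 1)\<^sup>2"
    using 1 A B by Groebner_Basis.algebra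
  also have "\<dots> = 16 * (g * (S + S\<^sup>2)\<^sup>2)"
    unfolding S by Groebner_Basis.algebra
  finally have "eo_half - (2 * (f * f) - theta_T * f) = 16 * (g * (S + S\<^sup>2)\<^sup>2 * v)"
    using v by Groebner_Basis.algebra
  hence "fps_nth (eo_half - (2 * (f * f) - theta_T * f)) m
      = fps_nth (16 * (g * (S + S\<^sup>2)\<^sup>2 * v)) m"
    by (rule arg_cong)
  hence "fps_nth eo_half m - (2 * fps_nth (f * f) m - fps_nth (theta_T * f) m)
      = 16 * fps_nth (g * (S + S\<^sup>2)\<^sup>2 * v) m"
    by (simp only: fps_sub_nth fps_nth_numeral_mult)
  thus ?thesis unfolding f_def cong_iff_dvd_diff by (simp add: dvd_def)
qed

section \<open>Weighted sums over Gaussian integers of given norm\<close>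

abbreviation two_squares :: "int \<Rightarrow> (int \<times> int) set" where
  "two_squares n \<equiv> {(u, v). u\<^sup>2 + v\<^sup>2 = n}"

lemma finite_two_squares: "finite (two_squares n)"
  using finite_int_pairs_eq[of 1 1 n] by simp

definition w1 :: "int \<times> int \<Rightarrow> int" where
  "w1 = (\<lambda>(u, v). chi12 u * chi12 v)"

text \<open>The first factor is \<open>theta_w\<close> symmetrised under \<open>u -> -u\<close>.
  This makes the weight even in both coordinates, at the cost of the factor 4 in
  \<open>theta_T_mult_euler_f_1_nth\<close>.\<close>

definition w2 :: "int \<times> int \<Rightarrow> int" where
  "w2 = (\<lambda>(u, v). u * chi3 u * chi12 v)"

lemma two_squares_odd:
  assumes "u\<^sup>2 + v\<^sup>2 = 4 * n + (2 :: int)"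
  shows "odd u" "odd v"
proof -
  have even_sq: "4 dvd w\<^sup>2" if "even w" for w :: int
    using that by (auto simp: power2_eq_square elim!: evenE)
  have odd_sq: "\<exists>t. w\<^sup>2 = 4 * t + 1" if w: "odd w" for w :: int
  proof -
    obtain j where "w = 2 * j + 1" using w by (elim oddE)
    hence "w\<^sup>2 = 4 * (j * j + j) + 1" by (simp add: power2_eq_square algebra_simps)
    thus ?thesis by blast
  qed
  have "odd u \<and> odd v"
  proof (cases "even u"; cases "even v")
    assume "even u" "even v"
    hence "4 dvd 4 * n + 2" using even_sq[of u] even_sq[of v] assms by (metis dvd_add)
    thus ?thesis by presburger
  next
    assume "even u" "odd v"
    hence "odd (u\<^sup>2 + v\<^sup>2)" by simp
    thus ?thesis unfolding assms by simp
  next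
    assume "odd u" "even v"
    hence "odd (u\<^sup>2 + v\<^sup>2)" by simp
    thus ?thesis unfolding assms by simp
  qed auto
  thus "odd u" "odd v" by auto
qed

lemma euler_f_square_nth: "4 * fps_nth (euler_f 1 * euler_f 1) m = sum w1 (two_squares (24 * int m + 2))"
proof -
  have "2 * 2 * fps_nth (euler_f 1 * euler_f 1) m
     = (\<Sum>(u, v) | 1 * u\<^sup>2 + 1 * v\<^sup>2 = 24 * int m + (1 + 1). chi12 u * chi12 v)"
    by (rule theta_mult_nth[OF euler_f_1_nth euler_f_1_nth]) (use chi12_support[of _ 1] in simp_all)
  thus ?thesis by (simp add: w1_def)
qed

lemma theta_T_mult_euler_f_1_nth: "4 * fps_nth (theta_T * euler_f 1) m = sum w2 (two_squares (24 * int m + 2))"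
proof -
  define S where "S = two_squares (24 * int m + 2)"
  define h where "h = (\<lambda>(u, v). theta_w u * chi12 v)"
  define s where "s = (\<lambda>(u :: int, v :: int). (- u, v))"
  have "1 * 2 * fps_nth (theta_T * euler_f 1) m
     = (\<Sum>(u, v) | 1 * u\<^sup>2 + 1 * v\<^sup>2 = 24 * int m + (1 + 1). theta_w u * chi12 v)"
    by (rule theta_mult_nth[OF theta_T_nth euler_f_1_nth])
       (use chi12_support[of _ 1] theta_w_support in simp_all)
  hence "2 * fps_nth (theta_T * euler_f 1) m = sum h S"
    by (simp add: h_def S_def)
  moreover have "sum w2 S = (\<Sum>p\<in>S. h p + h (s p))"
  proof (intro sum.cong refl)
    fix p assume "p \<in> S"
    moreover obtain u v where p: "p = (u, v)" by fastforce
    ultimately have "u\<^sup>2 + v\<^sup>2 = 4 * (6 * int m) + 2" by (simp add: S_def)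
    hence "odd u" by (rule two_squares_odd)
    have "w2 p = (u * chi3 u) * chi12 v" by (simp add: p w2_def)
    also have "\<dots> = h p + h (s p)"
      unfolding theta_w_symm[OF \<open>odd u\<close>, symmetric] by (simp add: p h_def s_def algebra_simps)
    finally show "w2 p = h p + h (s p)" .
  qed
  moreover have "(\<Sum>p\<in>S. h (s p)) = sum h S"
    by (rule sum_involution) (auto simp: s_def S_def)
  ultimately show ?thesis by (simp add: sum.distrib S_def)
qed

text \<open>
  The two Gaussian primes above 5: an element of norm \<open>5K\<close> is a multiple of \<open>2 + i\<close> or of
  \<open>2 - i\<close>, and a multiple of 5 if it is a multiple of both.
\<close>

lemma sum_two_squares_5:
  fixes h :: "int \<times> int \<Rightarrow> int"
  shows "sum h (two_squares (5 * K)) =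
     (\<Sum>(a, b)\<in>two_squares K. h (2 * a - b, a + 2 * b))
   + (\<Sum>(a, b)\<in>two_squares K. h (2 * a + b, 2 * b - a))
   - (\<Sum>(a, b) | 5 * (a\<^sup>2 + b\<^sup>2) = K. h (5 * a, 5 * b))"
proof -
  define S where "S = two_squares (5 * K)"
  define A where "A = {p\<in>S. 5 dvd fst p - 2 * snd p}"
  define B where "B = {p\<in>S. 5 dvd fst p + 2 * snd p}"
  have "S = A \<union> B"
  proof -
    have "5 dvd u - 2 * v \<or> 5 dvd u + 2 * v" if "(u, v) \<in> S" for u v
    proof -
      have "(u - 2 * v) * (u + 2 * v) = 5 * (K - v\<^sup>2)"
        using that by (simp add: S_def power2_eq_square algebra_simps)
      hence "5 dvd (u - 2 * v) * (u + 2 * v)" by simp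
      moreover have "prime (5 :: int)" by simp
      ultimately show ?thesis by (simp add: prime_dvd_mult_iff)
    qed
    thus ?thesis unfolding A_def B_def by fastforce
  qed
  moreover have "finite A" "finite B"
    using finite_two_squares[of "5 * K"] by (auto simp: A_def B_def S_def)
  ultimately have "sum h S = sum h A + sum h B - sum h (A \<inter> B)"
    using sum.union_inter[of A B h] by simp
  also have "sum h A = (\<Sum>(a, b)\<in>two_squares K. h (2 * a - b, a + 2 * b))"
  proof (rule sum.reindex_bij_witness[of _ "\<lambda>(a, b). (2 * a - b, a + 2 * b)" "\<lambda>(u, v). ((2 * u + v) div 5, (2 * v - u) div 5)"])
    fix p assume p: "p \<in> A"
    obtain u v where uv: "p = (u, v)" by fastforce
    with p obtain c where "u - 2 * v = 5 * c" by (auto simp: A_def)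
    hence u: "u = 2 * v + 5 * c" by simp
    have div: "(2 * u + v) div 5 = v + 2 * c" "(2 * v - u) div 5 = - c"
      unfolding u by simp_all
    show "(case (case p of (u, v) \<Rightarrow> ((2 * u + v) div 5, (2 * v - u) div 5)) of (a, b) \<Rightarrow> (2 * a - b, a + 2 * b)) = p"
      by (simp add: uv div) (simp add: u algebra_simps)
    show "(case p of (u, v) \<Rightarrow> ((2 * u + v) div 5, (2 * v - u) div 5)) \<in> two_squares K"
      using p by (simp add: uv div) (simp add: A_def S_def u power2_eq_square algebra_simps)
    show "(case (case p of (u, v) \<Rightarrow> ((2 * u + v) div 5, (2 * v - u) div 5)) of (a, b) \<Rightarrow> h (2 * a - b, a + 2 * b)) = h p"
      by (simp add: uv div) (simp add: u algebra_simps)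
  next
    fix p assume p: "p \<in> two_squares K"
    obtain a b where ab: "p = (a, b)" by fastforce
    show "(case (case p of (a, b) \<Rightarrow> (2 * a - b, a + 2 * b)) of (u, v) \<Rightarrow> ((2 * u + v) div 5, (2 * v - u) div 5)) = p"
      by (simp add: ab)
    have "5 dvd (2 * a - b) - 2 * (a + 2 * b)" by simp
    thus "(case p of (a, b) \<Rightarrow> (2 * a - b, a + 2 * b)) \<in> A"
      using p by (simp add: ab A_def S_def) (simp add: power2_eq_square algebra_simps)
  qed
  also have "sum h B = (\<Sum>(a, b)\<in>two_squares K. h (2 * a + b, 2 * b - a))"
  proof (rule sum.reindex_bij_witness[of _ "\<lambda>(a, b). (2 * a + b, 2 * b - a)" "\<lambda>(u, v). ((2 * u - v) div 5, (u + 2 * v) div 5)"])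
    fix p assume p: "p \<in> B"
    obtain u v where uv: "p = (u, v)" by fastforce
    with p obtain c where "u + 2 * v = 5 * c" by (auto simp: B_def)
    hence u: "u = 5 * c - 2 * v" by simp
    have div: "(2 * u - v) div 5 = 2 * c - v" "(u + 2 * v) div 5 = c"
      unfolding u by simp_all
    show "(case (case p of (u, v) \<Rightarrow> ((2 * u - v) div 5, (u + 2 * v) div 5)) of (a, b) \<Rightarrow> (2 * a + b, 2 * b - a)) = p"
      by (simp add: uv div) (simp add: u algebra_simps)
    show "(case p of (u, v) \<Rightarrow> ((2 * u - v) div 5, (u + 2 * v) div 5)) \<in> two_squares K"
      using p by (simp add: uv div) (simp add: B_def S_def u power2_eq_square algebra_simps)
    show "(case (case p of (u, v) \<Rightarrow> ((2 * u - v) div 5, (u + 2 * v) div 5)) of (a, b) \<Rightarrow> h (2 * a + b, 2 * b - a)) = h p"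
      by (simp add: uv div) (simp add: u algebra_simps)
  next
    fix p assume p: "p \<in> two_squares K"
    obtain a b where ab: "p = (a, b)" by fastforce
    show "(case (case p of (a, b) \<Rightarrow> (2 * a + b, 2 * b - a)) of (u, v) \<Rightarrow> ((2 * u - v) div 5, (u + 2 * v) div 5)) = p"
      by (simp add: ab)
    have "5 dvd (2 * a + b) + 2 * (2 * b - a)" by simp
    thus "(case p of (a, b) \<Rightarrow> (2 * a + b, 2 * b - a)) \<in> B"
      using p by (simp add: ab B_def S_def) (simp add: power2_eq_square algebra_simps)
  qed
  also have "sum h (A \<inter> B) = (\<Sum>(a, b) | 5 * (a\<^sup>2 + b\<^sup>2) = K. h (5 * a, 5 * b))"
  proof (rule sum.reindex_bij_witness[of _ "\<lambda>(a, b). (5 * a, 5 * b)" "\<lambda>(u, v). (u div 5, v div 5)"])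
    fix p assume p: "p \<in> A \<inter> B"
    obtain u v where uv: "p = (u, v)" by fastforce
    have "5 dvd u - 2 * v" "5 dvd u + 2 * v" using p by (auto simp: uv A_def B_def)
    hence "5 dvd u" "5 dvd v" by presburger+
    then obtain a b where ab: "u = 5 * a" "v = 5 * b" by (auto elim!: dvdE)
    show "(case (case p of (u, v) \<Rightarrow> (u div 5, v div 5)) of (a, b) \<Rightarrow> (5 * a, 5 * b)) = p"
      by (simp add: uv ab)
    show "(case p of (u, v) \<Rightarrow> (u div 5, v div 5)) \<in> {(a, b). 5 * (a\<^sup>2 + b\<^sup>2) = K}"
      using p by (simp add: uv ab A_def S_def power2_eq_square algebra_simps)
    show "(case (case p of (u, v) \<Rightarrow> (u div 5, v div 5)) of (a, b) \<Rightarrow> h (5 * a, 5 * b)) = h p"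
      by (simp add: uv ab)
  next
    fix p assume p: "p \<in> {(a :: int, b). 5 * (a\<^sup>2 + b\<^sup>2) = K}"
    obtain a b where ab: "p = (a, b)" by fastforce
    show "(case (case p of (a, b) \<Rightarrow> (5 * a, 5 * b)) of (u, v) \<Rightarrow> (u div 5, v div 5)) = p"
      by (simp add: ab)
    have "5 dvd 5 * a - 2 * (5 * b)" "5 dvd 5 * a + 2 * (5 * b)" by simp_all
    thus "(case p of (a, b) \<Rightarrow> (5 * a, 5 * b)) \<in> A \<inter> B"
      using p by (simp add: ab A_def B_def S_def)
  qed
  finally show ?thesis by (simp add: S_def)
qed

text \<open>The arguments are the coordinates of \<open>(2 + i)(a + b i)\<close>. Modulo 3 the
  factor is \<open>-1 + i\<close>, which sends \<open>(a, b)\<close> to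
  \<open>(-(a + b), a - b)\<close>.\<close>

lemma chi3_rotate: "chi3 (2 * a - b) * chi3 (a + 2 * b) = - chi3 (a\<^sup>2 - b\<^sup>2)"
proof -
  have "2 * a - b = - (a + b) + 3 * a" "a + 2 * b = (a - b) + 3 * b" by simp_all
  hence "(2 * a - b) mod 3 = (- (a + b)) mod 3" "(a + 2 * b) mod 3 = (a - b) mod 3"
    by (simp_all only: mod_mult_self2)
  hence "chi3 (2 * a - b) = chi3 (- (a + b))" "chi3 (a + 2 * b) = chi3 (a - b)"
    using chi3_cong by blast+
  moreover have "a\<^sup>2 - b\<^sup>2 = (a + b) * (a - b)"
    by (simp add: power2_eq_square algebra_simps)
  ultimately show ?thesis by (simp only: chi3_minus chi3_mult mult_minus_left)
qed

lemma chi4_add_2_mult_odd: "odd b \<Longrightarrow> chi4 (a + 2 * b) = - chi4 a"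
  by (simp add: chi4_add_2_mult alt_sign_def)

lemma w1_rotate:
  assumes "odd a" "odd b"
  shows "w1 (2 * a - b, a + 2 * b) = chi3 (a\<^sup>2 - b\<^sup>2) * chi4 a * chi4 b"
proof -
  have "chi4 (2 * a - b) = chi4 b"
    using chi4_add_2_mult_odd[OF assms(1), of "- b"] by (simp add: chi4_minus)
  moreover have "w1 (2 * a - b, a + 2 * b)
      = (chi3 (2 * a - b) * chi3 (a + 2 * b)) * (chi4 (2 * a - b) * chi4 (a + 2 * b))"
    by (simp add: w1_def chi12_eq)
  ultimately show ?thesis
    unfolding chi3_rotate chi4_add_2_mult_odd[OF assms(2)] by simp
qed

lemma w2_rotate:
  assumes "odd b"
  shows "w2 (2 * a - b, a + 2 * b) = (2 * a - b) * chi3 (a\<^sup>2 - b\<^sup>2) * chi4 a"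
proof -
  have "w2 (2 * a - b, a + 2 * b) = (2 * a - b) * (chi3 (2 * a - b) * chi3 (a + 2 * b)) * chi4 (a + 2 * b)"
    by (simp add: w2_def chi12_eq)
  thus ?thesis unfolding chi3_rotate chi4_add_2_mult_odd[OF assms] by simp
qed

text \<open>Both coordinates are odd when the norm is 2 modulo 4, and then the rotated weight is odd
  in \<open>b\<close> by \<open>w1_rotate\<close>, so reflection cancels the sum. The same
  reflection carries the prime \<open>2 + i\<close> to \<open>2 - i\<close>.\<close>

lemma sum_w1_rotate:
  "(\<Sum>(a, b)\<in>two_squares (4 * n + 2). w1 (2 * a - b, a + 2 * b)) = 0" (is "?s = 0")
  "(\<Sum>(a, b)\<in>two_squares (4 * n + 2). w1 (2 * a + b, 2 * b - a)) = 0" (is "?s' = 0")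
proof -
  define t where "t = (\<lambda>(a :: int, b :: int). (a, - b))"
  have "(\<Sum>p\<in>two_squares (4 * n + 2). (\<lambda>(a, b). w1 (2 * a - b, a + 2 * b)) (t p)) = ?s"
    by (rule sum_involution) (auto simp: t_def)
  moreover have "(\<Sum>p\<in>two_squares (4 * n + 2). (\<lambda>(a, b). w1 (2 * a - b, a + 2 * b)) (t p)) = - ?s"
    unfolding sum_negf[symmetric]
  proof (intro sum.cong refl)
    fix p assume "p \<in> two_squares (4 * n + 2)"
    moreover obtain a b where p: "p = (a, b)" by fastforce
    ultimately have "odd a" "odd b" using two_squares_odd[of a b n] by auto
    hence "w1 (2 * a - b, a + 2 * b) = chi3 (a\<^sup>2 - b\<^sup>2) * chi4 a * chi4 b"
      "w1 (2 * a - - b, a + 2 * - b) = chi3 (a\<^sup>2 - (- b)\<^sup>2) * chi4 a * chi4 (- b)"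
      by (intro w1_rotate; simp)+
    thus "(\<lambda>(a, b). w1 (2 * a - b, a + 2 * b)) (t p) = - (case p of (a, b) \<Rightarrow> w1 (2 * a - b, a + 2 * b))"
      by (simp add: p t_def chi4_minus)
  qed
  ultimately show "?s = 0" by linarith
  have "?s' = (\<Sum>p\<in>two_squares (4 * n + 2). (\<lambda>(a, b). w1 (2 * a - b, a + 2 * b)) (t p))"
  proof (intro sum.cong refl)
    fix p :: "int \<times> int"
    obtain a b where p: "p = (a, b)" by fastforce
    have "chi12 (2 * b - a) = chi12 (a - 2 * b)" using chi12_minus[of "a - 2 * b"] by simp
    thus "(case p of (a, b) \<Rightarrow> w1 (2 * a + b, 2 * b - a)) = (\<lambda>(a, b). w1 (2 * a - b, a + 2 * b)) (t p)"
      by (simp add: p t_def w1_def)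
  qed
  thus "?s' = 0" using \<open>_ = ?s\<close> \<open>?s = 0\<close> by simp
qed

text \<open>64 is \<open>2 * 8 * 4\<close>. Adding the two rotations and symmetrising under the swap
  gives \<open>2 * sum h S\<close>; the eight symmetries of the square preserve \<open>h\<close> and
  act freely on \<open>S\<close>; and \<open>h\<close> is divisible by 4 because
  \<open>c * chi4 c\<close> is 1 modulo 4 for odd \<open>c\<close>.\<close>

lemma sum_w2_rotate:
  assumes K: "K = 24 * n + 10"
  shows "64 dvd (\<Sum>(a, b)\<in>two_squares K. w2 (2 * a - b, a + 2 * b))
     + (\<Sum>(a, b)\<in>two_squares K. w2 (2 * a + b, 2 * b - a))" (is "64 dvd ?s + ?s'")
proof -
  define S where "S = two_squares K"
  define t where "t = (\<lambda>(a :: int, b :: int). (a, - b))"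
  define s where "s = (\<lambda>(a :: int, b :: int). (- a, b))"
  define r where "r = (\<lambda>(a :: int, b :: int). (b, a))"
  define f where "f = (\<lambda>(a, b). (2 * a - b) * chi3 (a\<^sup>2 - b\<^sup>2) * chi4 a)"
  define g where "g = (\<lambda>(a, b). a * chi4 a * chi3 (a\<^sup>2 - b\<^sup>2))"
  define h where "h = (\<lambda>(a, b). (a * chi4 a - b * chi4 b) * chi3 (a\<^sup>2 - b\<^sup>2))"
  have fin: "finite S" unfolding S_def by (rule finite_two_squares)
  have inv: "(\<Sum>p\<in>S. e (t p)) = sum e S" "(\<Sum>p\<in>S. e (r p)) = sum e S" for e :: "int \<times> int \<Rightarrow> int"
    by (rule sum_involution; auto simp: S_def t_def r_def)+
  have odd: "odd a" "odd b" if "(a, b) \<in> S" for a b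
    using that two_squares_odd[of a b "6 * n + 2"] by (auto simp: S_def K)
  have s: "?s = sum f S"
    unfolding S_def[symmetric] by (intro sum.cong refl) (auto simp: f_def w2_rotate odd)
  have "?s' = (\<Sum>p\<in>S. f (t p))"
    unfolding S_def[symmetric]
  proof (intro sum.cong refl)
    fix p assume "p \<in> S"
    moreover obtain a b where p: "p = (a, b)" by fastforce
    ultimately have "odd (- b)" using odd by auto
    have "w2 (2 * a + b, 2 * b - a) = w2 (2 * a - - b, a + 2 * - b)"
      using chi12_minus[of "2 * b - a"] by (simp add: w2_def)
    thus "(case p of (a, b) \<Rightarrow> w2 (2 * a + b, 2 * b - a)) = f (t p)"
      unfolding w2_rotate[OF \<open>odd (- b)\<close>] by (simp add: p t_def f_def)
  qed
  hence "?s + ?s' = (\<Sum>p\<in>S. f p + f (t p))" unfolding s by (simp add: sum.distrib)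
  \<comment> \<open>The terms in \<open>b\<close> cancel and \<open>4 * a\<close> remains; one of
    the two copies of \<open>g\<close> will be replaced by its image under the swap
    \<open>r\<close>.\<close>
  also have "\<dots> = (\<Sum>p\<in>S. 2 * (g p + g p))"
    by (intro sum.cong refl) (auto simp: f_def g_def t_def algebra_simps)
  also have "\<dots> = 2 * (sum g S + (\<Sum>p\<in>S. g (r p)))"
    unfolding inv by (simp add: sum.distrib flip: sum_distrib_left)
  also have "\<dots> = 2 * sum h S"
  proof -
    have "g p + g (r p) = h p" for p
    proof -
      obtain a b where p: "p = (a, b)" by fastforce
      have "chi3 (b\<^sup>2 - a\<^sup>2) = - chi3 (a\<^sup>2 - b\<^sup>2)" using chi3_minus[of "a\<^sup>2 - b\<^sup>2"] by simp
      thus ?thesis by (simp add: p g_def h_def r_def algebra_simps)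
    qed
    thus ?thesis by (simp add: sum.distrib[symmetric])
  qed
  also have "sum h S = 2 * sum h {p\<in>S. fst p > 0}"
  proof (rule sum_involution_half[OF fin, where \<sigma> = s])
    fix p assume p: "p \<in> S"
    obtain a b where ab: "p = (a, b)" by fastforce
    have "a \<noteq> 0" using odd p ab by fastforce
    thus "0 < fst (s p) \<longleftrightarrow> \<not> 0 < fst p" by (auto simp: ab s_def)
  qed (auto simp: s_def S_def h_def chi4_minus)
  also have "sum h {p\<in>S. fst p > 0} = 2 * sum h {p\<in>{p\<in>S. fst p > 0}. snd p > 0}"
  proof (rule sum_involution_half[where \<sigma> = t])
    fix p assume p: "p \<in> {p\<in>S. fst p > 0}"
    obtain a b where ab: "p = (a, b)" by fastforce
    have "b \<noteq> 0" using odd p ab by fastforce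
    thus "0 < snd (t p) \<longleftrightarrow> \<not> 0 < snd p" by (auto simp: ab t_def)
  qed (use fin in \<open>auto simp: t_def S_def h_def chi4_minus\<close>)
  also have "sum h {p\<in>{p\<in>S. fst p > 0}. snd p > 0}
      = 2 * sum h {p\<in>{p\<in>{p\<in>S. fst p > 0}. snd p > 0}. fst p < snd p}"
  proof (rule sum_involution_half[where \<sigma> = r])
    fix p assume p: "p \<in> {p\<in>{p\<in>S. fst p > 0}. snd p > 0}"
    obtain a b where ab: "p = (a, b)" by fastforce
    \<comment> \<open>On the diagonal half of \<open>K\<close> would be a square, but it is 2 modulo
      3.\<close>
    have "a \<noteq> b"
    proof
      assume "a = b"
      hence "a\<^sup>2 = 12 * n + 5" using p by (simp add: ab S_def K)
      moreover have "a\<^sup>2 mod 3 = (a mod 3)\<^sup>2 mod 3" by (simp add: power_mod)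
      moreover have "(12 * n + 5) mod 3 = (2 :: int)" by presburger
      ultimately show False using mod_3_cases[of a] by auto
    qed
    thus "fst (r p) < snd (r p) \<longleftrightarrow> \<not> fst p < snd p" by (auto simp: ab r_def)
    have "chi3 (b\<^sup>2 - a\<^sup>2) = - chi3 (a\<^sup>2 - b\<^sup>2)" using chi3_minus[of "a\<^sup>2 - b\<^sup>2"] by simp
    thus "h (r p) = h p" by (simp add: ab r_def h_def algebra_simps)
  qed (use fin in \<open>auto simp: r_def S_def\<close>)
  finally have eq: "?s + ?s' = 16 * sum h {p\<in>{p\<in>{p\<in>S. fst p > 0}. snd p > 0}. fst p < snd p}"
    by simp
  have "4 dvd sum h {p\<in>{p\<in>{p\<in>S. fst p > 0}. snd p > 0}. fst p < snd p}"
  proof (rule dvd_sum)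
    fix p assume "p \<in> {p\<in>{p\<in>{p\<in>S. fst p > 0}. snd p > 0}. fst p < snd p}"
    moreover obtain a b where ab: "p = (a, b)" by fastforce
    ultimately have "odd a" "odd b" using odd by auto
    have *: "\<exists>x. c * chi4 c = 4 * x + 1" if "odd c" for c
    proof -
      have "c mod 4 = 1 \<or> c mod 4 = 3" using that by presburger
      thus ?thesis
      proof
        assume m: "c mod 4 = 1"
        hence "c * chi4 c = 4 * (c div 4) + 1"
          using div_mult_mod_eq[of c 4] by (simp add: chi4_def)
        thus ?thesis by blast
      next
        assume m: "c mod 4 = 3"
        hence "c * chi4 c = - c" by (simp add: chi4_def)
        moreover obtain k where "c = 4 * k + 3" using m by (metis mult_div_mod_eq)
        ultimately have "c * chi4 c = 4 * (- k - 1) + 1" by simp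
        thus ?thesis by blast
      qed
    qed
    obtain x y where "a * chi4 a = 4 * x + 1" "b * chi4 b = 4 * y + 1"
      using * \<open>odd a\<close> \<open>odd b\<close> by meson
    hence "a * chi4 a - b * chi4 b = 4 * (x - y)" by simp
    thus "4 dvd h p" by (simp add: ab h_def)
  qed
  thus ?thesis unfolding eq by (auto elim!: dvdE)
qed

lemma w_mult_5: "w1 (5 * a, 5 * b) = w1 (a, b)" "w2 (5 * a, 5 * b) = 5 * w2 (a, b)"
  by (simp_all add: w1_def w2_def chi12_eq chi3_5 chi4_5)

text \<open>\<open>K\<close> is twice a number that is 5 modulo 12, so \<open>5 * K\<close> has the
  shape \<open>24m + 2\<close> of the coefficient formulas. The rotated sums are the inhomogeneous
  part; what is left is the correction for elements divisible by 5, on which \<open>w_mult_5\<close>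
  gives the factors 1 and 5.\<close>

lemma two_squares_recursion:
  assumes K: "K = 24 * n + 10"
  shows "sum w1 (two_squares (5 * K)) = - (\<Sum>p | 5 * ((fst p)\<^sup>2 + (snd p)\<^sup>2) = K. w1 p)"
    and "64 dvd sum w2 (two_squares (5 * K)) + 5 * (\<Sum>p | 5 * ((fst p)\<^sup>2 + (snd p)\<^sup>2) = K. w2 p)"
proof -
  have K': "K = 4 * (6 * n + 2) + 2" by (simp add: K)
  show "sum w1 (two_squares (5 * K)) = - (\<Sum>p | 5 * ((fst p)\<^sup>2 + (snd p)\<^sup>2) = K. w1 p)"
    unfolding sum_two_squares_5 unfolding K' sum_w1_rotate w_mult_5 by (simp add: case_prod_unfold)
  show "64 dvd sum w2 (two_squares (5 * K)) + 5 * (\<Sum>p | 5 * ((fst p)\<^sup>2 + (snd p)\<^sup>2) = K. w2 p)"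
    unfolding sum_two_squares_5 w_mult_5 using sum_w2_rotate[OF K]
    by (simp add: case_prod_unfold sum_distrib_left)
qed

text \<open>Each application of the recursion removes two factors 5. An odd exponent ends at
  \<open>5 * L\<close>, where the correction sum is empty because 5 does not divide
  \<open>2 * L\<close>.\<close>

lemma two_squares_odd_power_5:
  assumes "\<not> 5 dvd L" "5 ^ (2 * k + 1) * L = 12 * n + (1 :: int)"
  shows "sum w1 (two_squares (2 * (5 ^ (2 * k + 1) * L))) = 0
       \<and> 64 dvd sum w2 (two_squares (2 * (5 ^ (2 * k + 1) * L)))"
  using assms(2)
proof (induction k arbitrary: n)
  case 0
  hence "5 * L = 12 * n + 1" by simp
  \<comment> \<open>5 is its own inverse modulo 12, so \<open>L\<close> is 5 modulo 12 and the
    recursion applies with \<open>K = 2 * L\<close>.\<close>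
  hence "L = 12 * (5 * n - 2 * L) + 5" by simp
  then obtain m where m: "2 * L = 24 * m + 10" by (metis distrib_left mult.assoc mult_2 numeral_Bit0)
  have "5 * ((fst p)\<^sup>2 + (snd p)\<^sup>2) \<noteq> 2 * L" for p
    using assms(1) by presburger
  hence "{p. 5 * ((fst p)\<^sup>2 + (snd p)\<^sup>2) = 2 * L} = {}" by blast
  thus ?case using two_squares_recursion[OF m] by (simp add: mult.left_commute)
next
  case (Suc k)
  define N where "N = 5 ^ (2 * k + 1) * L"
  have pow: "5 ^ (2 * Suc k + 1) = (25 :: int) * 5 ^ (2 * k + 1)" by simp
  have N: "25 * N = 12 * n + 1"
    using Suc.prems unfolding pow N_def by (simp only: mult.assoc)
  hence "N = 12 * (n - 2 * N) + 1" by simp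
  then obtain n' where n': "N = 12 * n' + 1" by blast
  have IH: "sum w1 (two_squares (2 * N)) = 0" "64 dvd sum w2 (two_squares (2 * N))"
    using Suc.IH[of n'] n' by (simp_all add: N_def)
  have K: "5 * (2 * N) = 24 * (5 * n') + 10" using n' by simp
  have "{p. 5 * ((fst p)\<^sup>2 + (snd p)\<^sup>2) = 5 * (2 * N)} = two_squares (2 * N)" by auto
  hence "sum w1 (two_squares (5 * (5 * (2 * N)))) = 0"
    "64 dvd sum w2 (two_squares (5 * (5 * (2 * N)))) + 5 * sum w2 (two_squares (2 * N))"
    using two_squares_recursion[OF K] IH by simp_all
  moreover have "2 * (5 ^ (2 * Suc k + 1) * L) = 5 * (5 * (2 * N))"
    unfolding pow N_def by simp
  ultimately show ?case using IH(2) by (metis dvd_add_left_iff dvd_mult)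
qed

lemma eo_half_dvd_16:
  assumes "\<not> 5 dvd L" "5 ^ (2 * k + 1) * L = 12 * m + 1"
  shows "16 dvd fps_nth eo_half m"
proof -
  have "\<not> 5 dvd int L" using assms(1) by (metis int_dvd_int_iff of_nat_numeral)
  moreover have eq: "5 ^ (2 * k + 1) * int L = 12 * int m + 1"
    using arg_cong[OF assms(2), of int] by simp
  ultimately have "sum w1 (two_squares (2 * (12 * int m + 1))) = 0
       \<and> 64 dvd sum w2 (two_squares (2 * (12 * int m + 1)))"
    using two_squares_odd_power_5[of "int L" k "int m"] by metis
  moreover have "2 * (12 * int m + 1) = 24 * int m + 2" by simp
  ultimately have "4 * fps_nth (euler_f 1 * euler_f 1) m = 0"
    "64 dvd 4 * fps_nth (theta_T * euler_f 1) m"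
    unfolding euler_f_square_nth theta_T_mult_euler_f_1_nth by simp_all
  hence "fps_nth (euler_f 1 * euler_f 1) m = 0" "16 dvd fps_nth (theta_T * euler_f 1) m"
    by (auto elim!: dvdE)
  thus ?thesis using eo_half_cong_16[of m] by (simp add: cong_dvd_iff)
qed

section \<open>The congruence modulo 5\<close>

lemma power_4_mod_5: "\<not> 5 dvd (z :: int) \<Longrightarrow> [z ^ 4 = 1] (mod 5)"
proof -
  assume "\<not> 5 dvd z"
  hence "z mod 5 = 1 \<or> z mod 5 = 2 \<or> z mod 5 = 3 \<or> z mod 5 = 4" by presburger
  moreover have "z ^ 4 mod 5 = (z mod 5) ^ 4 mod 5" by (simp add: power_mod)
  ultimately show ?thesis unfolding cong_def by auto
qed

lemma dvd_5_power: "5 dvd (u :: int) ^ n \<Longrightarrow> 5 dvd u"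
  by (rule prime_dvd_power[of "5 :: int"]) simp_all

lemma euler_f_nth_eq:
  assumes "k > 0" "int k * u\<^sup>2 = 24 * int n + int k"
  shows "fps_nth (euler_f k) n = chi12 u"
proof -
  have "u \<noteq> - u" using assms by auto
  have "{v. int k * v\<^sup>2 = 24 * int n + int k} = {u, - u}"
    unfolding assms(2)[symmetric] using assms(1) by (auto simp: power2_eq_iff)
  hence "2 * fps_nth (euler_f k) n = chi12 u + chi12 (- u)"
    using \<open>u \<noteq> - u\<close> euler_f_nth[OF assms(1), of n] by simp
  thus ?thesis by (simp add: chi12_minus)
qed

lemma euler_f_nth_eq_0:
  assumes "k > 0" "\<And>u. int k * u\<^sup>2 \<noteq> 24 * int n + int k"
  shows "fps_nth (euler_f k) n = 0"
  using euler_f_nth[OF assms(1), of n] assms(2) by simp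

lemma chi12_5: "chi12 (5 * u) = - chi12 u"
proof -
  define r where "r = u mod 12"
  have "(5 * u) mod 12 = (5 * r) mod 12" unfolding r_def by (rule mod_mult_right_eq [symmetric])
  thus ?thesis using mod_12_cases[of u]
    unfolding chi12_def r_def[symmetric] by (elim insertE emptyE; simp)
qed

text \<open>As 24 is -1 modulo 5, \<open>n - k\<close> is \<open>- k * u\<^sup>2\<close>, and its
  square is \<open>k\<^sup>2\<close> times \<open>u ^ 4\<close>, which is 1 unless 5 divides
  \<open>u\<close>. The solutions \<open>u = 5 * w\<close> sit exactly at
  \<open>n = k + 25 * m\<close>; since \<open>chi12 (5 * w) = - chi12 w\<close>, adding the
  conditional term removes them.\<close>

lemma euler_f_cong_5:
  assumes k: "k > 0" "coprime k 5"
  shows "[(int n - int k)\<^sup>2 * fps_nth (euler_f k) n = (int k)\<^sup>2 * (fps_nth (euler_f k) n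
     + (if k \<le> n \<and> 25 dvd n - k then fps_nth (euler_f k) ((n - k) div 25) else 0))] (mod 5)"
    (is "[_ = _ * (_ + ?b)] (mod 5)")
proof (cases "\<exists>u. int k * u\<^sup>2 = 24 * int n + int k")
  case True
  then obtain u where u: "int k * u\<^sup>2 = 24 * int n + int k" ..
  have a: "fps_nth (euler_f k) n = chi12 u" by (rule euler_f_nth_eq[OF k(1) u])
  have "int n - int k - (- (int k * u\<^sup>2)) = 5 * (5 * int n)" using u by simp
  hence "[int n - int k = - (int k * u\<^sup>2)] (mod 5)" unfolding cong_iff_dvd_diff by (metis dvd_triv_left)
  hence "[(int n - int k)\<^sup>2 = (- (int k * u\<^sup>2))\<^sup>2] (mod 5)" by (rule cong_pow)
  hence n: "[(int n - int k)\<^sup>2 = (int k)\<^sup>2 * u ^ 4] (mod 5)" by (simp add: power_mult_distrib)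
  show ?thesis
  proof (cases "5 dvd u")
    case False
    have "?b = 0"
    proof (rule ccontr)
      assume "?b \<noteq> 0"
      hence "k \<le> n" "25 dvd n - k" by (auto split: if_splits)
      then obtain m where "n = k + 25 * m" by (metis dvdE le_add_diff_inverse)
      hence "int k * u\<^sup>2 = 5 * (5 * (24 * int m + int k))" using u by simp
      hence "5 dvd int k * u\<^sup>2" by simp
      moreover have "coprime 5 (int k)" using k(2) by (simp add: coprime_commute flip: coprime_int_iff)
      ultimately have "5 dvd u\<^sup>2" by (simp add: coprime_dvd_mult_right_iff)
      thus False using False dvd_5_power by blast
    qed
    moreover have "[(int k)\<^sup>2 * u ^ 4 * chi12 u = (int k)\<^sup>2 * 1 * chi12 u] (mod 5)"
      by (intro cong_mult cong_refl power_4_mod_5 False)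
    ultimately show ?thesis
      using cong_trans[OF cong_scalar_right[OF n, of "chi12 u"]] unfolding a by simp
  next
    case True
    then obtain w where w: "u = 5 * w" ..
    have "u \<noteq> 0" using u k(1) by auto
    hence "w\<^sup>2 \<ge> 1" using w by (simp add: int_one_le_iff_zero_less)
    have "25 * (int k * w\<^sup>2) = 24 * int n + int k" using u unfolding w by (simp add: power_mult_distrib)
    hence eq: "24 * (int n - int k) = 25 * (int k * w\<^sup>2 - int k)" by simp
    have "int k * 1 \<le> int k * w\<^sup>2" using \<open>w\<^sup>2 \<ge> 1\<close> by (intro mult_left_mono) auto
    hence "0 \<le> 24 * (int n - int k)" unfolding eq by simp
    hence "k \<le> n" by simp
    have "int n - int k = 25 * (int n - int k - (int k * w\<^sup>2 - int k))" using eq by simp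
    then obtain m where m: "int n - int k = 25 * m" by blast
    hence "m \<ge> 0" using \<open>k \<le> n\<close> by linarith
    define m' where "m' = nat m"
    have nm: "n - k = 25 * m'" using m \<open>m \<ge> 0\<close> \<open>k \<le> n\<close> unfolding m'_def by linarith
    have "int k * w\<^sup>2 = 24 * int m' + int k"
      using eq unfolding m m'_def using \<open>m \<ge> 0\<close> by simp
    hence "fps_nth (euler_f k) m' = chi12 w" by (rule euler_f_nth_eq[OF k(1)])
    hence "?b = chi12 w" using nm \<open>k \<le> n\<close> by simp
    moreover have "chi12 u = - chi12 w" unfolding w by (rule chi12_5)
    moreover have "[(int k)\<^sup>2 * u ^ 4 * chi12 u = 0] (mod 5)"
      unfolding cong_0_iff w by (simp add: power_mult_distrib)
    ultimately show ?thesis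
      using cong_trans[OF cong_scalar_right[OF n, of "chi12 u"]] unfolding a by simp
  qed
next
  case False
  hence a: "fps_nth (euler_f k) n = 0" using k(1) by (intro euler_f_nth_eq_0) auto
  have "?b = 0"
  proof (cases "k \<le> n \<and> 25 dvd n - k")
    case True
    then obtain m where m: "n = k + 25 * m" by (metis dvdE le_add_diff_inverse)
    have "fps_nth (euler_f k) m = 0"
    proof (rule euler_f_nth_eq_0[OF k(1)])
      fix w
      show "int k * w\<^sup>2 \<noteq> 24 * int m + int k"
      proof
        assume "int k * w\<^sup>2 = 24 * int m + int k"
        hence "int k * (5 * w)\<^sup>2 = 24 * int n + int k"
          by (simp add: m power_mult_distrib)
        thus False using False by blast
      qed
    qed
    thus ?thesis by (simp add: m)
  qed auto
  thus ?thesis unfolding a by simp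
qed

text \<open>Here \<open>n - 3 * k\<close> is \<open>2 * k * u\<^sup>2\<close> modulo 5, with square
  \<open>- k\<^sup>2 * u ^ 4\<close>. When 5 divides \<open>u\<close> the weight itself vanishes, so
  no correction as in \<open>euler_f_cong_5\<close> arises.\<close>

lemma euler_f_cubed_cong_5:
  assumes "k > 0"
  shows "[(int n - 3 * int k)\<^sup>2 * fps_nth (euler_f k ^ 3) n = - ((int k)\<^sup>2 * fps_nth (euler_f k ^ 3) n)] (mod 5)"
proof -
  define U where "U = {u. int k * u\<^sup>2 = 8 * int n + int k}"
  define c where "c = (int n - 3 * int k)\<^sup>2 + (int k)\<^sup>2"
  have "5 dvd c * (\<Sum>u\<in>U. chi4 u * u)"
    unfolding sum_distrib_left
  proof (rule dvd_sum)
    fix u assume "u \<in> U"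
    hence u: "int k * u\<^sup>2 = 8 * int n + int k" by (simp add: U_def)
    have "(int n - 3 * int k) = 5 * (- 5 * int k - 3 * int n) + 2 * (int k * u\<^sup>2) + 20 * int k"
      unfolding u by simp
    hence "[int n - 3 * int k = 2 * (int k * u\<^sup>2)] (mod 5)"
      unfolding cong_iff_dvd_diff by presburger
    hence "[(int n - 3 * int k)\<^sup>2 = (2 * (int k * u\<^sup>2))\<^sup>2] (mod 5)" by (rule cong_pow)
    hence c: "[c = 4 * ((int k)\<^sup>2 * u ^ 4) + (int k)\<^sup>2] (mod 5)"
      unfolding c_def by (intro cong_add cong_refl) (simp add: power_mult_distrib)
    show "5 dvd c * (chi4 u * u)"
    proof (cases "5 dvd u")
      case False
      have "[4 * ((int k)\<^sup>2 * u ^ 4) + (int k)\<^sup>2 = 4 * ((int k)\<^sup>2 * 1) + (int k)\<^sup>2] (mod 5)"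
        by (intro cong_add cong_mult cong_refl power_4_mod_5 False)
      from cong_trans[OF c this] have "5 dvd c"
        unfolding cong_def by (simp add: dvd_eq_mod_eq_0)
      thus ?thesis by simp
    qed simp
  qed
  also have "(\<Sum>u\<in>U. chi4 u * u) = 2 * fps_nth (euler_f k ^ 3) n"
    unfolding U_def by (rule euler_f_cubed_nth[OF assms, symmetric])
  finally have "5 dvd 2 * (c * fps_nth (euler_f k ^ 3) n)" by (simp add: mult_ac)
  hence "5 dvd c * fps_nth (euler_f k ^ 3) n" by presburger
  thus ?thesis unfolding cong_iff_dvd_diff c_def by (simp add: algebra_simps)
qed

text \<open>With \<open>n = y\<^sup>2\<close> the factor is \<open>y ^ 4\<close>; the terms
  \<open>y = 5 * z\<close> form the series \<open>phi\<close> in \<open>q^25\<close>, with unchanged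
  signs.\<close>

lemma gauss_phi_cong_5:
  "[(int n)\<^sup>2 * fps_nth gauss_phi n = fps_nth gauss_phi n
     - (if 25 dvd n then fps_nth gauss_phi (n div 25) else 0)] (mod 5)"
proof (cases "5 dvd n")
  case False
  have "5 dvd ((int n)\<^sup>2 - 1) * fps_nth gauss_phi n"
    unfolding gauss_phi_def fps_nth_Abs_fps sum_distrib_left
  proof (rule dvd_sum)
    fix y assume "y \<in> {y. y\<^sup>2 = int n}"
    hence y: "int n = y\<^sup>2" by simp
    hence "\<not> 5 dvd y" using False by (metis dvd_mult2 int_dvd_int_iff of_nat_numeral power2_eq_square)
    from power_4_mod_5[OF this] show "5 dvd ((int n)\<^sup>2 - 1) * alt_sign y"
      unfolding y cong_iff_dvd_diff by simp
  qed
  moreover have "\<not> 25 dvd n" using False by presburger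
  ultimately show ?thesis by (simp add: cong_iff_dvd_diff algebra_simps)
next
  case True
  have dvd: "5 dvd y" if "y\<^sup>2 = int n" for y
  proof (rule dvd_5_power)
    show "5 dvd y\<^sup>2" unfolding that using True by (metis int_dvd_int_iff of_nat_numeral)
  qed
  have "fps_nth gauss_phi n = (if 25 dvd n then fps_nth gauss_phi (n div 25) else 0)"
  proof (cases "25 dvd n")
    case True
    then obtain m where m: "n = 25 * m" ..
    have "{y. y\<^sup>2 = int n} = (\<lambda>z. 5 * z) ` {z. z\<^sup>2 = int m}"
    proof (intro equalityI subsetI)
      fix y assume "y \<in> {y. y\<^sup>2 = int n}"
      hence y: "y\<^sup>2 = int n" by simp
      then obtain z where z: "y = 5 * z" using dvd by blast
      have "z\<^sup>2 = int m" using y unfolding z m by (simp add: power_mult_distrib)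
      thus "y \<in> (\<lambda>z. 5 * z) ` {z. z\<^sup>2 = int m}" using z by blast
    qed (auto simp: m power_mult_distrib)
    moreover have "alt_sign (5 * z) = alt_sign z" for z by (simp add: alt_sign_def)
    ultimately show ?thesis
      by (simp add: gauss_phi_def sum.reindex inj_on_def m)
  next
    case False
    have "y\<^sup>2 \<noteq> int n" for y
    proof
      assume y: "y\<^sup>2 = int n"
      then obtain z where "y = 5 * z" using dvd by blast
      hence "int n = int 25 * z\<^sup>2" using y by (simp add: power_mult_distrib)
      hence "int 25 dvd int n" by simp
      thus False using False by (simp only: int_dvd_int_iff)
    qed
    thus ?thesis using False by (simp add: gauss_phi_def)
  qed
  moreover have "5 dvd (int n)\<^sup>2"
    using True by (simp add: power2_eq_square) (metis dvd_mult2 int_dvd_int_iff of_nat_numeral)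
  ultimately show ?thesis by (simp add: cong_0_iff)
qed

section \<open>The field with five elements and Frobenius\<close>

text \<open>An index type of prime cardinality makes \<open>five mod_ring\<close> a field, so power
  series over it can be cancelled and inverted.\<close>

typedef five = "{0..<5 :: nat}"
  by (rule exI[of _ 0]) simp

instance five :: prime_card
proof
  show "prime (CARD(five))"
    unfolding type_definition.card[OF type_definition_five] by simp
qed

type_synonym gf5 = "five mod_ring"

lemma CHAR_gf5: "CHAR(gf5) = 5"
  unfolding semiring_char_mod_ring type_definition.card[OF type_definition_five] by simp

lemma of_int_gf5_eq_0_iff: "(of_int x :: gf5) = 0 \<longleftrightarrow> 5 dvd x"
  unfolding of_int_eq_0_iff_char_dvd CHAR_gf5 by simp

lemma of_int_gf5_eq_iff: "(of_int x :: gf5) = of_int y \<longleftrightarrow> [x = y] (mod 5)"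
  using of_int_gf5_eq_0_iff[of "x - y"] by (simp add: cong_iff_dvd_diff)

lemma gf5_cases:
  obtains z :: int where "(x :: gf5) = of_int z"
  by (metis of_int_mod_ring_to_int_mod_ring of_int_of_int_mod_ring)

lemma five_gf5: "(5 :: gf5) = 0"
  using of_int_gf5_eq_0_iff[of 5] by simp

lemma five_fps_gf5: "(5 :: gf5 fps) = 0"
  by (simp add: numeral_fps_const five_gf5)

lemma power_5_gf5: "(x :: gf5) ^ 5 = x"
proof -
  obtain z :: int where x: "x = of_int z" by (rule gf5_cases)
  have "[z ^ 5 = z] (mod 5)"
  proof (cases "5 dvd z")
    case True
    hence "5 dvd z ^ 5" by (rule dvd_trans) simp
    thus ?thesis using True by (simp add: cong_def mod_eq_0_iff_dvd[THEN iffD2])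
  next
    case False
    from cong_scalar_right[OF power_4_mod_5[OF this], of z] show ?thesis
      by (simp add: power_Suc2[symmetric] del: power_Suc)
  qed
  thus ?thesis unfolding x of_int_power[symmetric] of_int_gf5_eq_iff .
qed

text \<open>Frobenius, \<open>f(q)^5 = f(q^5)\<close>: the mixed binomial terms carry a factor 5 and
  the coefficients satisfy \<open>c ^ 5 = c\<close>. The induction splits off the constant
  term.\<close>

lemma fps_nth_power_5: "fps_nth (f ^ 5 :: gf5 fps) n = (if 5 dvd n then fps_nth f (n div 5) else 0)"
proof (induction n arbitrary: f rule: less_induct)
  case (less n)
  define g where "g = fps_shift 1 f"
  define c where "c = fps_nth f 0"
  define x where "x = fps_const c"
  define y where "y = fps_X * g"
  have f: "f = x + y"
    unfolding x_def y_def g_def c_def by (rule fps_ext) simp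
  have "f ^ 5 = x ^ 5 + y ^ 5 + 5 * (x ^ 4 * y + 2 * x ^ 3 * y ^ 2 + 2 * x ^ 2 * y ^ 3 + x * y ^ 4)"
    unfolding f by Groebner_Basis.algebra
  also have "\<dots> = fps_const c + fps_X ^ 5 * g ^ 5"
    unfolding five_fps_gf5 x_def y_def by (simp add: power_mult_distrib power_5_gf5)
  finally have eq: "f ^ 5 = fps_const c + fps_X ^ 5 * g ^ 5" .
  show ?case
  proof (cases "n < 5")
    case True
    thus ?thesis unfolding eq by (cases "n = 0") (auto simp: fps_X_power_mult_nth c_def dest: dvd_imp_le)
  next
    case False
    then obtain m where n: "n = m + 5" using le_Suc_ex[of 5 n] by (metis add.commute not_less)
    hence "fps_nth (f ^ 5) n = fps_nth (g ^ 5) m"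
      unfolding eq by (simp add: fps_X_power_mult_nth)
    also have "\<dots> = (if 5 dvd m then fps_nth g (m div 5) else 0)"
      by (rule less) (simp add: n)
    finally show ?thesis by (simp add: n g_def)
  qed
qed

lemma fps_nth_power_25: "fps_nth (f ^ 25 :: gf5 fps) n = (if 25 dvd n then fps_nth f (n div 25) else 0)"
proof -
  have "fps_nth (f ^ 25) n = fps_nth ((f ^ 5) ^ 5) n" by (simp flip: power_mult)
  also have "\<dots> = (if 5 dvd n \<and> 5 dvd n div 5 then fps_nth f (n div 5 div 5) else 0)"
    unfolding fps_nth_power_5 by simp
  also have "5 dvd n \<and> 5 dvd n div 5 \<longleftrightarrow> 25 dvd n" by presburger
  also have "n div 5 div 5 = n div 25" by (simp flip: div_mult2_eq)
  finally show ?thesis .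
qed

definition U5 :: "nat \<Rightarrow> 'a fps \<Rightarrow> 'a fps" where
  "U5 r f = Abs_fps (\<lambda>n. fps_nth f (5 * n + r))"

lemma U5_nth: "fps_nth (U5 r f) n = fps_nth f (5 * n + r)"
  by (simp add: U5_def)

text \<open>A fifth power is a series in \<open>q^5\<close>, so it passes through the selection of a
  residue class and loses its exponent.\<close>

lemma U5_mult_power_5:
  fixes f g :: "gf5 fps"
  assumes "r < 5"
  shows "U5 r (f * g ^ 5) = U5 r f * g"
proof (rule fps_ext)
  fix n
  have "fps_nth (f * g ^ 5) (5 * n + r) = fps_nth (g ^ 5 * f) (5 * n + r)"
    by (simp add: mult.commute)
  also have "\<dots> = (\<Sum>i\<in>{0..5 * n + r}. fps_nth (g ^ 5) i * fps_nth f (5 * n + r - i))"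
    by (rule fps_mult_nth)
  also have "\<dots> = (\<Sum>i\<in>(\<lambda>j. 5 * j) ` {0..n}. fps_nth (g ^ 5) i * fps_nth f (5 * n + r - i))"
  proof (rule sum.mono_neutral_right)
    show "\<forall>i\<in>{0..5 * n + r} - (\<lambda>j. 5 * j) ` {0..n}. fps_nth (g ^ 5) i * fps_nth f (5 * n + r - i) = 0"
    proof
      fix i assume i: "i \<in> {0..5 * n + r} - (\<lambda>j. 5 * j) ` {0..n}"
      have "\<not> 5 dvd i"
      proof
        assume "5 dvd i"
        then obtain j where "i = 5 * j" by (elim dvdE)
        thus False using i assms by auto
      qed
      thus "fps_nth (g ^ 5) i * fps_nth f (5 * n + r - i) = 0"
        by (simp add: fps_nth_power_5)
    qed
  qed auto
  also have "\<dots> = (\<Sum>j\<in>{0..n}. fps_nth g j * fps_nth f (5 * (n - j) + r))"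
    by (subst sum.reindex) (auto simp: inj_on_def fps_nth_power_5 diff_mult_distrib2 intro!: sum.cong)
  also have "\<dots> = fps_nth (g * U5 r f) n"
    by (simp add: fps_mult_nth U5_nth)
  finally show "fps_nth (U5 r (f * g ^ 5)) n = fps_nth (U5 r f * g) n"
    by (simp add: U5_nth mult.commute)
qed

section \<open>The derivation \<open>theta\<close> and the differential equations\<close>

definition theta :: "'a::comm_ring_1 fps \<Rightarrow> 'a fps" where
  "theta f = fps_X * fps_deriv f"

lemma theta_nth: "fps_nth (theta f) n = of_nat n * fps_nth f n"
  by (cases n) (auto simp: theta_def)

lemma theta_add: "theta (f + g) = theta f + theta g"
  by (rule fps_ext) (simp add: theta_nth algebra_simps)

lemma theta_diff: "theta (f - g) = theta f - theta g"
  by (rule fps_ext) (simp add: theta_nth algebra_simps)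

lemma theta_uminus: "theta (- f) = - theta f"
  by (rule fps_ext) (simp add: theta_nth)

lemma theta_mult: "theta (f * g) = theta f * g + f * theta g"
  by (simp add: theta_def algebra_simps)

lemma theta_numeral: "theta (numeral k) = 0"
  by (simp add: theta_def numeral_fps_const)

lemma theta_1: "theta 1 = 0"
  by (simp add: theta_def)

lemma theta_Suc_power: "theta (f ^ Suc n) = of_nat (Suc n) * f ^ n * theta f"
  by (induction n) (simp_all add: theta_mult algebra_simps)

lemma theta_power: "theta (f ^ numeral k) = numeral k * f ^ pred_numeral k * theta f"
  using theta_Suc_power[of f "pred_numeral k"] unfolding numeral_eq_Suc[symmetric] by simp

lemmas theta_simps = theta_add theta_diff theta_uminus theta_mult theta_numeral theta_1 theta_power

text \<open>\<open>(\<theta> + c)\<^sup>4\<close> kills the coefficients of index \<open>n \<equiv> -c\<close> modulo 5 and fixes all the others.\<close>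

definition theta_shift :: "gf5 \<Rightarrow> gf5 fps \<Rightarrow> gf5 fps" where
  "theta_shift c f = theta f + fps_const c * f"

lemma theta_shift_nth: "fps_nth (theta_shift c f) n = (of_nat n + c) * fps_nth f n"
  by (simp add: theta_shift_def theta_nth algebra_simps)

lemma theta_shift_4_nth:
  assumes "of_nat n + c = 0"
  shows "fps_nth (theta_shift c (theta_shift c (theta_shift c (theta_shift c f)))) n = 0"
  by (simp add: theta_shift_nth assms)

text \<open>On multiples \<open>a * f\<close> of a fixed \<open>f\<close> the operator acts by
  \<open>a -> theta a + a * p\<close>. If \<open>a\<close> and \<open>p\<close> are polynomials in
  \<open>e\<close>, so are all iterates.\<close>

lemma theta_shift_mult:
  assumes "theta_shift c f = p * f" "theta a * f + a * p * f = b * f"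
  shows "theta_shift c (a * f) = b * f"
proof -
  have "theta_shift c (a * f) = theta a * f + a * theta_shift c f"
    by (simp add: theta_shift_def theta_mult algebra_simps)
  thus ?thesis using assms by (simp add: mult.assoc)
qed

text \<open>Written through the logarithmic derivative, the linear equations for \<open>f\<close>
  and \<open>f ^ 3\<close> each express \<open>theta P\<close> by \<open>P\<close>. The cube gives a
  closed Riccati equation; comparison with the other one then makes \<open>X * f ^ 24\<close> a
  polynomial in \<open>P\<close>.\<close>

lemma theta_log_derivative:
  fixes f :: "gf5 fps" and k :: "gf5 fps"
  assumes f: "f \<noteq> 0" and P: "theta f = k * f * (1 - P)"
    and k: "theta k = 0"
    and h1: "theta (theta f) - 2 * k * theta f + k\<^sup>2 * f = k\<^sup>2 * (f + X * f ^ 25)"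
    and h3: "theta (theta (f ^ 3)) - 6 * k * theta (f ^ 3) + 9 * k\<^sup>2 * f ^ 3 = - (k\<^sup>2 * f ^ 3)"
  shows "9 * k\<^sup>2 * P\<^sup>2 - 3 * k * theta P = - (k\<^sup>2)"
    and "k\<^sup>2 * P\<^sup>2 - k * theta P = k\<^sup>2 * (1 + X * f ^ 24)"
proof -
  have tf: "theta (theta f) = k * f * ((k * (1 - P)) * (1 - P) - theta P)"
    unfolding P by (simp add: theta_simps k) (simp add: P algebra_simps)
  have "theta (f ^ 3) = 3 * f ^ 2 * theta f" by (simp add: theta_power)
  also have "\<dots> = 3 * k * f ^ 3 * (1 - P)" unfolding P by Groebner_Basis.algebra
  finally have t3: "theta (f ^ 3) = 3 * k * f ^ 3 * (1 - P)" .
  have "theta (theta (f ^ 3)) = 3 * k * (theta (f ^ 3) * (1 - P) - f ^ 3 * theta P)"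
    by (subst t3) (simp add: theta_mult theta_diff theta_numeral theta_1 k algebra_simps)
  hence t33: "theta (theta (f ^ 3)) = 3 * k * (3 * k * f ^ 3 * (1 - P) * (1 - P) - f ^ 3 * theta P)"
    unfolding t3 .
  have "f ^ 3 * (9 * k\<^sup>2 * P\<^sup>2 - 3 * k * theta P) = f ^ 3 * (- (k\<^sup>2))"
    using h3 t33 t3 by Groebner_Basis.algebra
  thus "9 * k\<^sup>2 * P\<^sup>2 - 3 * k * theta P = - (k\<^sup>2)"
    using f by (simp only: mult_cancel_left power_eq_0_iff) simp
  have "f * (k\<^sup>2 * P\<^sup>2 - k * theta P) = f * (k\<^sup>2 * (1 + X * f ^ 24))"
    using h1 tf P by Groebner_Basis.algebra
  thus "k\<^sup>2 * P\<^sup>2 - k * theta P = k\<^sup>2 * (1 + X * f ^ 24)"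
    using f by (simp only: mult_cancel_left) simp
qed

text \<open>\<open>z\<close> is the difference of the two sides divided by 5, which leaves a
  polynomial identity with integer coefficients. The explicit polynomials supplied to this rule
  below are such quotients.\<close>

lemma eq_mod_5: "x + 5 * z = y \<Longrightarrow> x = (y :: gf5 fps)"
  by (simp add: five_fps_gf5)

lemma gf5_const: "fps_const (- 2 :: gf5) = - 2" "fps_const (0 :: gf5) = 0"
  by (simp_all add: numeral_fps_const)

text \<open>
  Everything is a polynomial in \<open>e = 2P\<^sub>2 - P\<^sub>1\<close>, where \<open>P\<^sub>1\<close> and \<open>P\<^sub>2\<close> are the reductions of
  \<open>E\<^sub>2(q)\<close> and \<open>E\<^sub>2(q\<^sup>2)\<close>.
\<close>

locale eta_mod_5 =
  fixes f1 f2 phi A :: "gf5 fps"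
  assumes f1_0: "fps_nth f1 0 = 1" and f2_0: "fps_nth f2 0 = 1"
    and phi: "phi * f2 = f1\<^sup>2"
    and A: "A * f1\<^sup>2 = f2\<^sup>2"
    and f1_ode: "theta (theta f1) - 2 * theta f1 + f1 = f1 + fps_X * f1 ^ 25"
    and f1_cubed_ode: "theta (theta (f1 ^ 3)) - 6 * theta (f1 ^ 3) + 9 * f1 ^ 3 = - (f1 ^ 3)"
    and f2_ode: "theta (theta f2) - 4 * theta f2 + 4 * f2 = 4 * (f2 + fps_X\<^sup>2 * f2 ^ 25)"
    and f2_cubed_ode: "theta (theta (f2 ^ 3)) - 12 * theta (f2 ^ 3) + 36 * f2 ^ 3 = - (4 * f2 ^ 3)"
    and phi_ode: "theta (theta phi) = phi - phi ^ 25"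
begin

lemma nonzero: "f1 \<noteq> 0" "f2 \<noteq> 0" "phi \<noteq> 0"
  using f1_0 f2_0 phi by auto

definition P1 :: "gf5 fps" where "P1 = 1 - theta f1 * inverse f1"
text \<open>Modulo 5, \<open>E_2 = 1 + sum sigma(n) q^n\<close> since -24 is 1. The logarithmic
  derivative of \<open>f2\<close> is \<open>-2 sum sigma(n) q^(2n)\<close>, and 3 inverts 2.\<close>

definition P2 :: "gf5 fps" where "P2 = 1 - 3 * theta f2 * inverse f2"
definition e :: "gf5 fps" where "e = 2 * P2 - P1"

lemma theta_f1: "theta f1 = f1 * (1 - P1)"
proof -
  have "inverse f1 * f1 = 1" using f1_0 by (intro inverse_mult_eq_1) simp
  thus ?thesis unfolding P1_def by Groebner_Basis.algebra
qed

lemma theta_f2: "theta f2 = 2 * f2 * (1 - P2)"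
proof (rule eq_mod_5)
  have "inverse f2 * f2 = 1" using f2_0 by (intro inverse_mult_eq_1) simp
  thus "theta f2 + 5 * theta f2 = 2 * f2 * (1 - P2)" unfolding P2_def by Groebner_Basis.algebra
qed

text \<open>These are \<open>theta E_2 = (E_2^2 - E_4) / 12\<close> and
  \<open>1728 Delta = E_4^3 - E_6^2\<close> at \<open>q\<close> and \<open>q^2\<close>, with
  \<open>E_4 = 1\<close> and \<open>E_6 = E_2\<close>.\<close>

lemma P_relations:
  shows theta_P1: "theta P1 = 3 * P1\<^sup>2 - 3" and theta_P2: "theta P2 = P2\<^sup>2 - 1"
    and Z1: "fps_X * f1 ^ 24 = 2 - 2 * P1\<^sup>2" and Z2: "fps_X\<^sup>2 * f2 ^ 24 = 2 - 2 * P2\<^sup>2"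
proof -
  have 1: "9 * P1\<^sup>2 - 3 * theta P1 = - 1" "P1\<^sup>2 - theta P1 = 1 + fps_X * f1 ^ 24"
    using theta_log_derivative[of f1 1 P1 fps_X] nonzero theta_f1 f1_ode f1_cubed_ode
    by (simp_all add: theta_1)
  have two: "theta f2 = 2 * f2 * (1 - P2)" by (rule theta_f2)
  have "theta (theta f2) - 2 * 2 * theta f2 + 2\<^sup>2 * f2 = 2\<^sup>2 * (f2 + fps_X\<^sup>2 * f2 ^ 25)"
    "theta (theta (f2 ^ 3)) - 6 * 2 * theta (f2 ^ 3) + 9 * 2\<^sup>2 * f2 ^ 3 = - (2\<^sup>2 * f2 ^ 3)"
    using f2_ode f2_cubed_ode by simp_all
  note 2 = theta_log_derivative[OF nonzero(2) two theta_numeral this]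
  show t1: "theta P1 = 3 * P1\<^sup>2 - 3"
    by (rule eq_mod_5[of _ "theta P1 - 3 * P1\<^sup>2 - 1"]) (use 1(1) in Groebner_Basis.algebra)
  show t2: "theta P2 = P2\<^sup>2 - 1"
    by (rule eq_mod_5[of _ "theta P2 - 7 * P2\<^sup>2 - 1"]) (use 2(1) in Groebner_Basis.algebra)
  show "fps_X * f1 ^ 24 = 2 - 2 * P1\<^sup>2"
    using 1(2) t1 by Groebner_Basis.algebra
  show "fps_X\<^sup>2 * f2 ^ 24 = 2 - 2 * P2\<^sup>2"
    by (rule eq_mod_5[of _ "- (fps_X\<^sup>2 * f2 ^ 24)"]) (use 2(2) t2 in Groebner_Basis.algebra)
qed

text \<open>Since \<open>phi * f2 = f1\<^sup>2\<close>, the logarithmic derivative of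
  \<open>phi\<close> is \<open>2 * (P2 - P1)\<close>. Substituting it into the equation of
  \<open>phi\<close> isolates \<open>phi ^ 24\<close>.\<close>

lemma phi_24: "phi ^ 24 = 1 - 4 * (P2 - P1)\<^sup>2 - 2 * (P2\<^sup>2 - 1 - 3 * P1\<^sup>2 + 3)"
proof -
  have "theta phi * f2 + phi * theta f2 = 2 * f1 * theta f1"
    using arg_cong[OF phi, of theta] by (simp add: theta_mult theta_power)
  hence "f2 * theta phi = f2 * (2 * phi * (P2 - P1))"
    using phi unfolding theta_f1 theta_f2 by Groebner_Basis.algebra
  hence t: "theta phi = 2 * phi * (P2 - P1)" using nonzero by simp
  have "theta (theta phi) = 2 * (theta phi * (P2 - P1) + phi * (theta P2 - theta P1))"
    by (subst t) (simp add: theta_mult theta_diff theta_numeral algebra_simps)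
  with phi_ode have "phi * phi ^ 24 = phi * (1 - 4 * (P2 - P1)\<^sup>2 - 2 * (P2\<^sup>2 - 1 - 3 * P1\<^sup>2 + 3))"
    using t theta_P1 theta_P2 by Groebner_Basis.algebra
  thus ?thesis using nonzero by simp
qed

lemma P2_eq: "P2 = 3 * (e + P1)"
  by (rule eq_mod_5[of _ P2]) (simp add: e_def)

lemma P1_nth_0: "fps_nth P1 0 = 1" and e_nth_0: "fps_nth e 0 = 1"
  by (simp_all add: e_def P1_def P2_def theta_nth fps_mult_nth_0 numeral_fps_const)

text \<open>The two expressions for \<open>phi ^ 24\<close> give a quartic relation between
  \<open>P1\<close> and \<open>e\<close> that factors modulo 5. The factor \<open>P1 - 3 * e\<close>
  has constant term -2, so the other one vanishes.\<close>

lemma P1_eq: "P1 = - (e ^ 3 + 3 * e)"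
proof -
  have "phi ^ 24 * (fps_X\<^sup>2 * f2 ^ 24) = (fps_X * f1 ^ 24)\<^sup>2"
    using phi by Groebner_Basis.algebra
  hence rel: "(1 - 4 * (P2 - P1)\<^sup>2 - 2 * (P2\<^sup>2 - 1 - 3 * P1\<^sup>2 + 3)) * (2 - 2 * P2\<^sup>2) = (2 - 2 * P1\<^sup>2)\<^sup>2"
    unfolding phi_24 Z1 Z2 .
  have "(P1 + e ^ 3 + 3 * e) * (P1 - 3 * e)
      = (1 - 4 * (P2 - P1)\<^sup>2 - 2 * (P2\<^sup>2 - 1 - 3 * P1\<^sup>2 + 3)) * (2 - 2 * P2\<^sup>2) - (2 - 2 * P1\<^sup>2)\<^sup>2"
    unfolding P2_eq
    by (rule eq_mod_5[of _ "- (2 + 12 * P1 * e - 691 * P1 * e ^ 3 - P1\<^sup>2 - 900 * P1\<^sup>2 * e\<^sup>2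
          - 504 * P1 ^ 3 * e - 100 * P1 ^ 4 + 9 * e\<^sup>2 - 195 * e ^ 4)"]) Groebner_Basis.algebra
  hence "(P1 + e ^ 3 + 3 * e) * (P1 - 3 * e) = 0" unfolding rel by simp
  moreover have "P1 - 3 * e \<noteq> 0"
  proof
    assume "P1 - 3 * e = 0"
    hence "fps_nth (P1 - 3 * e) 0 = 0" by simp
    hence "(of_int (- 2) :: gf5) = 0"
      by (simp add: P1_nth_0 e_nth_0 numeral_fps_const fps_mult_nth_0)
    thus False unfolding of_int_gf5_eq_0_iff by simp
  qed
  ultimately have "P1 + e ^ 3 + 3 * e = 0" by simp
  thus ?thesis by Groebner_Basis.algebra
qed

lemma theta_e: "theta e = 1 - e ^ 4"
proof -
  have "theta e = 2 * (P2\<^sup>2 - 1) - (3 * P1\<^sup>2 - 3)"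
    unfolding e_def by (simp add: theta_simps theta_P1 theta_P2)
  also have "\<dots> = 1 - e ^ 4"
    unfolding P2_eq P1_eq
    by (rule eq_mod_5[of _ "- (9 * e\<^sup>2 + 11 * e ^ 4 + 3 * e ^ 6)"]) Groebner_Basis.algebra
  finally show ?thesis .
qed

text \<open>\<open>phi ^ 24\<close> is the cube of the right-hand side. The cofactor in the
  difference of cubes has constant term 43, nonzero modulo 5, so the cube root is unique.\<close>

lemma phi_8: "phi ^ 8 = 3 * (e\<^sup>2 + 1)"
proof -
  define y where "y = 3 * (e\<^sup>2 + 1)"
  define b where "b = phi ^ 8"
  have "b ^ 3 = phi ^ 24" by (simp add: b_def flip: power_mult)
  also have "\<dots> = y ^ 3"
    unfolding phi_24 y_def P2_eq P1_eq
    by (rule eq_mod_5[of _ "6 + 27 * e\<^sup>2 + 33 * e ^ 4 + 11 * e ^ 6"]) Groebner_Basis.algebra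
  finally have "(b - y) * (b\<^sup>2 + b * y + y\<^sup>2) = 0" by Groebner_Basis.algebra
  moreover have "b\<^sup>2 + b * y + y\<^sup>2 \<noteq> 0"
  proof
    assume 0: "b\<^sup>2 + b * y + y\<^sup>2 = 0"
    have "fps_nth phi 0 * fps_nth f2 0 = fps_nth (f1\<^sup>2) 0"
      using arg_cong[OF phi, of "\<lambda>f. fps_nth f 0"] by (simp add: fps_mult_nth_0)
    hence "fps_nth phi 0 = 1" by (simp add: f1_0 f2_0 fps_power_zeroth)
    hence "fps_nth b 0 = 1" by (simp add: b_def fps_power_zeroth)
    moreover have "fps_nth y 0 = of_int 6"
      by (simp add: y_def e_nth_0 fps_mult_nth_0 fps_power_zeroth numeral_fps_const)
    moreover have "fps_nth (b\<^sup>2 + b * y + y\<^sup>2) 0 = 0" using 0 by simp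
    ultimately have "(of_int 43 :: gf5) = 0" by (simp add: fps_mult_nth_0 fps_power_zeroth)
    thus False unfolding of_int_gf5_eq_0_iff by simp
  qed
  ultimately show ?thesis by (simp add: b_def y_def)
qed

lemma f1_16: "f1 ^ 16 = 3 * (e\<^sup>2 + 1) * f2 ^ 8"
  using phi phi_8 by Groebner_Basis.algebra

lemma X_f1_f2: "fps_X * (f1 * f2) ^ 8 = 9 * (e\<^sup>2 + 1) * (1 - e\<^sup>2)"
proof -
  have "f1 ^ 16 * (fps_X * (f1 * f2) ^ 8) = (fps_X * f1 ^ 24) * f2 ^ 8" by Groebner_Basis.algebra
  also have "fps_X * f1 ^ 24 = (3 * (e\<^sup>2 + 1)) ^ 2 * (3 * (1 - e\<^sup>2))"
    unfolding Z1 P1_eq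
    by (rule eq_mod_5[of _ "5 + 9 * e\<^sup>2 - 3 * e ^ 4 - 5 * e ^ 6"]) Groebner_Basis.algebra
  also have "\<dots> * f2 ^ 8 = f1 ^ 16 * (9 * (e\<^sup>2 + 1) * (1 - e\<^sup>2))"
    unfolding f1_16 by Groebner_Basis.algebra
  finally show ?thesis using nonzero by simp
qed

section \<open>The operator \<open>U_5\<close> on three eta quotients\<close>

definition F :: "gf5 fps" where "F = f1 ^ 8 * f2\<^sup>2"
definition G :: "gf5 fps" where "G = f1 ^ 6 * f2\<^sup>2"
definition H :: "gf5 fps" where "H = f1 ^ 14 * inverse f2 ^ 6"

lemma H_eq: "H * f2 ^ 6 = f1 ^ 14"
proof -
  have "inverse f2 * f2 = 1" using f2_0 by (intro inverse_mult_eq_1) simp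
  hence "inverse f2 ^ 6 * f2 ^ 6 = 1" by (simp flip: power_mult_distrib)
  thus ?thesis by (simp add: H_def mult.assoc)
qed

text \<open>The shift is the eta exponent: \<open>q^(1/2) F\<close> is
  \<open>eta(tau)^8 eta(2 tau)^2\<close>, and 1/2 is -2 modulo 5. For \<open>G\<close> and
  \<open>H\<close> the exponents 5/12 and 1/12 reduce to 0 and -2. After the shift the logarithmic
  derivative has no constant part, and in \<open>e\<close> it is a polynomial.\<close>

lemma theta_F: "theta_shift (- 2) F = 3 * e * F"
proof -
  have "theta F = 8 * f1 ^ 7 * theta f1 * f2\<^sup>2 + f1 ^ 8 * (2 * f2 * theta f2)"
    by (simp add: F_def theta_mult theta_power)
  also have "\<dots> = F * (8 * (1 - P1) + 4 * (1 - P2))"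
    unfolding theta_f1 theta_f2 F_def by Groebner_Basis.algebra
  finally have "theta_shift (- 2) F = F * (8 * (1 - P1) + 4 * (1 - P2)) + (- 2) * F"
    unfolding theta_shift_def gf5_const by simp
  also have "\<dots> = 3 * e * F"
    unfolding P2_eq by (rule eq_mod_5[of _ "F * (3 * e + 4 * P1 - 2)"]) Groebner_Basis.algebra
  finally show ?thesis .
qed

lemma theta_G: "theta_shift 0 G = (3 * e ^ 3 + 2 * e) * G"
proof -
  have "theta G = 6 * f1 ^ 5 * theta f1 * f2\<^sup>2 + f1 ^ 6 * (2 * f2 * theta f2)"
    by (simp add: G_def theta_mult theta_power)
  also have "\<dots> = G * (6 * (1 - P1) + 4 * (1 - P2))"
    unfolding theta_f1 theta_f2 G_def by Groebner_Basis.algebra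
  finally have "theta_shift 0 G = G * (6 * (1 - P1) + 4 * (1 - P2))"
    unfolding theta_shift_def gf5_const by simp
  also have "\<dots> = (3 * e ^ 3 + 2 * e) * G"
    unfolding P2_eq P1_eq by (rule eq_mod_5[of _ "G * (- 3 * e ^ 3 - 8 * e - 2)"]) Groebner_Basis.algebra
  finally show ?thesis .
qed

lemma theta_H: "theta_shift (- 2) H = 3 * e ^ 3 * H"
proof -
  have "theta H * f2 ^ 6 + H * (6 * f2 ^ 5 * theta f2) = 14 * f1 ^ 13 * theta f1"
    using arg_cong[OF H_eq, of theta] by (simp add: theta_mult theta_power)
  hence "f2 ^ 6 * theta H = f2 ^ 6 * (H * (14 * (1 - P1) - 12 * (1 - P2)))"
    using H_eq unfolding theta_f1 theta_f2 by Groebner_Basis.algebra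
  hence "theta H = H * (14 * (1 - P1) - 12 * (1 - P2))" using nonzero by simp
  hence "theta_shift (- 2) H = H * (14 * (1 - P1) - 12 * (1 - P2)) + (- 2) * H"
    unfolding theta_shift_def gf5_const by simp
  also have "\<dots> = 3 * e ^ 3 * H"
    unfolding P2_eq P1_eq by (rule eq_mod_5[of _ "H * (5 * e ^ 3 + 6 * e)"]) Groebner_Basis.algebra
  finally show ?thesis .
qed

lemma F_eq_F: "F - theta_shift (- 2) (theta_shift (- 2) (theta_shift (- 2) (theta_shift (- 2) F))) = 3 * (fps_X\<^sup>2 * F ^ 5)"
proof -
  have 1: "theta_shift (- 2) F = (- (2 * e)) * F"
    unfolding theta_F by (rule eq_mod_5[of _ "(- (e)) * F"]) Groebner_Basis.algebra
  have 2: "theta_shift (- 2) ((- (2 * e)) * F) = (- (2) - e\<^sup>2 + 2 * e ^ 4) * F"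
    by (rule theta_shift_mult[OF theta_F], rule eq_mod_5[of _ "(e\<^sup>2) * F"])
       (simp add: theta_simps theta_e, Groebner_Basis.algebra)
  have 3: "theta_shift (- 2) ((- (2) - e\<^sup>2 + 2 * e ^ 4) * F) = (2 * e - 2 * e ^ 5 + 2 * e ^ 7) * F"
    by (rule theta_shift_mult[OF theta_F], rule eq_mod_5[of _ "(2 * e - e ^ 3 - 2 * e ^ 5 + 2 * e ^ 7) * F"])
       (simp add: theta_simps theta_e, Groebner_Basis.algebra)
  have 4: "theta_shift (- 2) ((2 * e - 2 * e ^ 5 + 2 * e ^ 7) * F) = (2 + e\<^sup>2 - 2 * e ^ 4 - 2 * e ^ 6 + e ^ 8 + e ^ 10) * F"
    by (rule theta_shift_mult[OF theta_F], rule eq_mod_5[of _ "(- (e\<^sup>2) + 2 * e ^ 4 - 2 * e ^ 6 - 3 * e ^ 8 + 3 * e ^ 10) * F"])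
       (simp add: theta_simps theta_e, Groebner_Basis.algebra)
  \<comment> \<open>The right side is also brought to the form polynomial in \<open>e\<close> times
    \<open>F\<close>, by trading \<open>f1 ^ 16\<close> for \<open>f2 ^ 8\<close> and collecting the
    square of \<open>fps_X * (f1 * f2) ^ 8\<close>.\<close>
  have "3 * (fps_X\<^sup>2 * F ^ 5) = 3 * f1 ^ 16 * (fps_X\<^sup>2 * f1 ^ 24 * f2 ^ 10)"
    unfolding F_def by Groebner_Basis.algebra
  also have "\<dots> = 3 * (3 * (e\<^sup>2 + 1)) * (fps_X * (f1 * f2) ^ 8)\<^sup>2 * F"
    unfolding f1_16 F_def by Groebner_Basis.algebra
  finally have rhs: "3 * (fps_X\<^sup>2 * F ^ 5) = 3 * (3 * (e\<^sup>2 + 1)) * (9 * (e\<^sup>2 + 1) * (1 - e\<^sup>2))\<^sup>2 * F"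
    unfolding X_f1_f2 .
  show ?thesis
    unfolding 1 2 3 4 rhs by (rule eq_mod_5[of _ "(146 + 146 * e\<^sup>2 - 292 * e ^ 4 - 292 * e ^ 6 + 146 * e ^ 8 + 146 * e ^ 10) * F"]) Groebner_Basis.algebra
qed

lemma G_eq_H: "G - theta_shift 0 (theta_shift 0 (theta_shift 0 (theta_shift 0 G))) = H ^ 5"
proof -
  have 1: "theta_shift 0 G = (2 * e - 2 * e ^ 3) * G"
    unfolding theta_G by (rule eq_mod_5[of _ "(- (e ^ 3)) * G"]) Groebner_Basis.algebra
  have 2: "theta_shift 0 ((2 * e - 2 * e ^ 3) * G) = (2 - 2 * e\<^sup>2) * G"
    by (rule theta_shift_mult[OF theta_G], rule eq_mod_5[of _ "(0) * G"])
       (simp add: theta_simps theta_e, Groebner_Basis.algebra)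
  have 3: "theta_shift 0 ((2 - 2 * e\<^sup>2) * G) = (2 * e ^ 3 - 2 * e ^ 5) * G"
    by (rule theta_shift_mult[OF theta_G], rule eq_mod_5[of _ "(0) * G"])
       (simp add: theta_simps theta_e, Groebner_Basis.algebra)
  have 4: "theta_shift 0 ((2 * e ^ 3 - 2 * e ^ 5) * G) = (e\<^sup>2 - e ^ 4 + e ^ 6 - e ^ 8) * G"
    by (rule theta_shift_mult[OF theta_G], rule eq_mod_5[of _ "(- (e\<^sup>2) + e ^ 4 + e ^ 6 - e ^ 8) * G"])
       (simp add: theta_simps theta_e, Groebner_Basis.algebra)
  \<comment> \<open>\<open>H ^ 5\<close> is \<open>f1^70 / f2^30\<close>, that is \<open>G\<close>
    times the fourth power of \<open>f1^16 / f2^8\<close>.\<close>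
  have "f2 ^ 30 * H ^ 5 = f1 ^ 64 * f1 ^ 6"
    using H_eq by Groebner_Basis.algebra
  also have "\<dots> = (f1 ^ 16) ^ 4 * f1 ^ 6"
    by Groebner_Basis.algebra
  also have "\<dots> = f2 ^ 30 * ((3 * (e\<^sup>2 + 1)) ^ 4 * G)"
    unfolding f1_16 G_def by Groebner_Basis.algebra
  finally have rhs: "H ^ 5 = (3 * (e\<^sup>2 + 1)) ^ 4 * G"
    using nonzero by (simp only: mult_cancel_left power_eq_0_iff) simp
  show ?thesis
    unfolding 1 2 3 4 rhs by (rule eq_mod_5[of _ "(16 + 65 * e\<^sup>2 + 97 * e ^ 4 + 65 * e ^ 6 + 16 * e ^ 8) * G"]) Groebner_Basis.algebra
qed

lemma H_eq_G: "H - theta_shift (- 2) (theta_shift (- 2) (theta_shift (- 2) (theta_shift (- 2) H))) = 3 * (fps_X\<^sup>2 * G ^ 5)"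
proof -
  have 1: "theta_shift (- 2) H = (- (2 * e ^ 3)) * H"
    unfolding theta_H by (rule eq_mod_5[of _ "(- (e ^ 3)) * H"]) Groebner_Basis.algebra
  have 2: "theta_shift (- 2) ((- (2 * e ^ 3)) * H) = (- (e\<^sup>2)) * H"
    by (rule theta_shift_mult[OF theta_H], rule eq_mod_5[of _ "(e\<^sup>2) * H"])
       (simp add: theta_simps theta_e, Groebner_Basis.algebra)
  have 3: "theta_shift (- 2) ((- (e\<^sup>2)) * H) = (- (2 * e) - e ^ 5) * H"
    by (rule theta_shift_mult[OF theta_H], rule eq_mod_5[of _ "(0) * H"])
       (simp add: theta_simps theta_e, Groebner_Basis.algebra)
  have 4: "theta_shift (- 2) ((- (2 * e) - e ^ 5) * H) = (- (2) + e ^ 4 + 2 * e ^ 8) * H"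
    by (rule theta_shift_mult[OF theta_H], rule eq_mod_5[of _ "(2 * e ^ 4) * H"])
       (simp add: theta_simps theta_e, Groebner_Basis.algebra)
  have "f2 ^ 6 * (3 * (fps_X\<^sup>2 * G ^ 5)) = 3 * (fps_X * (f1 * f2) ^ 8)\<^sup>2 * f1 ^ 14"
    unfolding G_def by Groebner_Basis.algebra
  also have "\<dots> = f2 ^ 6 * (3 * (9 * (e\<^sup>2 + 1) * (1 - e\<^sup>2))\<^sup>2 * H)"
    unfolding X_f1_f2 H_eq[symmetric] by Groebner_Basis.algebra
  finally have rhs: "3 * (fps_X\<^sup>2 * G ^ 5) = 3 * (9 * (e\<^sup>2 + 1) * (1 - e\<^sup>2))\<^sup>2 * H"
    using nonzero by (simp only: mult_cancel_left power_eq_0_iff) simp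
  show ?thesis
    unfolding 1 2 3 4 rhs by (rule eq_mod_5[of _ "(48 - 97 * e ^ 4 + 49 * e ^ 8) * H"]) Groebner_Basis.algebra
qed

lemma theta_shift_2_nth:
  assumes "f - theta_shift (- 2) (theta_shift (- 2) (theta_shift (- 2) (theta_shift (- 2) f)))
      = 3 * (fps_X\<^sup>2 * g ^ 5)"
  shows "fps_nth f (5 * n + 2) = 3 * fps_nth g n"
proof -
  have 0: "of_nat (5 * n + 2) + (- 2 :: gf5) = 0"
    by (simp add: five_gf5)
  have "fps_nth f (5 * n + 2) = fps_nth (3 * (fps_X\<^sup>2 * g ^ 5)) (5 * n + 2)"
    unfolding assms[symmetric] fps_sub_nth theta_shift_4_nth[OF 0] by simp
  also have "\<dots> = 3 * fps_nth g n"
    unfolding numeral_fps_const fps_mult_left_const_nth by (simp add: fps_X_power_mult_nth fps_nth_power_5)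
  finally show ?thesis .
qed

lemma F_nth: "fps_nth F (5 * n + 2) = 3 * fps_nth F n"
  by (rule theta_shift_2_nth[OF F_eq_F])

lemma H_nth: "fps_nth H (5 * n + 2) = 3 * fps_nth G n"
  by (rule theta_shift_2_nth[OF H_eq_G])

lemma G_nth: "fps_nth G (5 * n) = fps_nth H n"
proof -
  have 0: "of_nat (5 * n) + (0 :: gf5) = 0"
    by (simp add: five_gf5)
  have "fps_nth G (5 * n) = fps_nth (H ^ 5) (5 * n)"
    unfolding G_eq_H[symmetric] fps_sub_nth theta_shift_4_nth[OF 0] by simp
  thus ?thesis by (simp add: fps_nth_power_5)
qed

text \<open>\<open>A\<close> times the fifth power of \<open>f1\<^sup>2\<close> is \<open>F\<close>.
  Taking the section at residue 2 turns the fifth power into \<open>f1\<^sup>2\<close>, and the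
  eigenvector property of \<open>F\<close> gives \<open>3 * F\<close>, which is
  \<open>3 * G * f1\<^sup>2\<close>.\<close>

lemma A_nth: "fps_nth A (5 * n + 2) = 3 * fps_nth G n"
proof -
  have "A * (f1\<^sup>2) ^ 5 = F"
    using A unfolding F_def by Groebner_Basis.algebra
  hence "U5 2 F = U5 2 A * f1\<^sup>2"
    using U5_mult_power_5[of 2 A "f1\<^sup>2"] by simp
  moreover have "U5 2 F = 3 * F"
    by (rule fps_ext) (simp only: U5_nth F_nth numeral_fps_const fps_mult_left_const_nth)
  moreover have "3 * F = 3 * G * f1\<^sup>2"
    unfolding F_def G_def by Groebner_Basis.algebra
  ultimately have "U5 2 A = 3 * G"
    using nonzero by simp
  hence "fps_nth (U5 2 A) n = fps_nth (3 * G) n" by simp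
  thus ?thesis
    by (simp only: U5_nth numeral_fps_const fps_mult_left_const_nth)
qed

theorem A_nth_125: "fps_nth A (125 * n + 52) = 3 * fps_nth A (5 * n + 2)"
proof -
  \<comment> \<open>The index is peeled from outside: \<open>A\<close> to \<open>3 * G\<close>,
    \<open>G\<close> to \<open>H\<close>, \<open>H\<close> to \<open>3 * G\<close>; one factor 3
    with the last \<open>G\<close> is \<open>A\<close> at \<open>5 * n + 2\<close>.\<close>
  have "fps_nth A (5 * (5 * (5 * n + 2)) + 2) = 3 * fps_nth A (5 * n + 2)"
    unfolding A_nth G_nth H_nth ..
  moreover have "5 * (5 * (5 * n + 2)) + 2 = 125 * n + 52" by simp
  ultimately show ?thesis by (simp only:)
qed

end

section \<open>Reduction modulo 5 and the final assembly\<close>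

definition reduce :: "int fps \<Rightarrow> gf5 fps" where
  "reduce f = Abs_fps (\<lambda>n. of_int (fps_nth f n))"

lemma reduce_nth: "fps_nth (reduce f) n = of_int (fps_nth f n)"
  by (simp add: reduce_def)

lemma reduce_mult: "reduce (f * g) = reduce f * reduce g"
  by (rule fps_ext) (simp add: reduce_nth fps_mult_nth)

lemma reduce_1: "reduce 1 = 1"
  by (rule fps_ext) (simp add: reduce_nth)

lemma reduce_power: "reduce (f ^ k) = reduce f ^ k"
  by (induction k) (simp_all add: reduce_mult reduce_1)

lemma theta_ode_nth:
  "fps_nth (theta (theta f) - fps_const (of_int (2 * c)) * theta f + fps_const (of_int (c\<^sup>2)) * f) n
     = of_int ((int n - c)\<^sup>2) * fps_nth f n" for f :: "gf5 fps"
  by (simp add: theta_nth power2_eq_square algebra_simps)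

lemma reduce_euler_f_ode:
  assumes "k > 0" "coprime k 5"
  shows "theta (theta (reduce (euler_f k))) - fps_const (of_int (2 * int k)) * theta (reduce (euler_f k))
      + fps_const (of_int ((int k)\<^sup>2)) * reduce (euler_f k)
    = fps_const (of_int ((int k)\<^sup>2)) * (reduce (euler_f k) + fps_X ^ k * reduce (euler_f k) ^ 25)"
proof (rule fps_ext)
  fix n
  have "fps_nth (fps_X ^ k * reduce (euler_f k) ^ 25) n
      = of_int (if k \<le> n \<and> 25 dvd n - k then fps_nth (euler_f k) ((n - k) div 25) else 0)"
    by (auto simp: fps_X_power_mult_nth fps_nth_power_25 reduce_nth)
  moreover note euler_f_cong_5[OF assms, of n, folded of_int_gf5_eq_iff]
  ultimately show "fps_nth (theta (theta (reduce (euler_f k))) - fps_const (of_int (2 * int k)) * theta (reduce (euler_f k))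
      + fps_const (of_int ((int k)\<^sup>2)) * reduce (euler_f k)) n
    = fps_nth (fps_const (of_int ((int k)\<^sup>2)) * (reduce (euler_f k) + fps_X ^ k * reduce (euler_f k) ^ 25)) n"
    unfolding theta_ode_nth unfolding fps_mult_left_const_nth fps_add_nth reduce_nth
    by (simp only: of_int_mult of_int_add)
qed

lemma reduce_euler_f_cubed_ode:
  assumes "k > 0"
  shows "theta (theta (reduce (euler_f k) ^ 3)) - fps_const (of_int (2 * (3 * int k))) * theta (reduce (euler_f k) ^ 3)
      + fps_const (of_int ((3 * int k)\<^sup>2)) * reduce (euler_f k) ^ 3
    = - (fps_const (of_int ((int k)\<^sup>2)) * reduce (euler_f k) ^ 3)"
proof (rule fps_ext)
  fix n
  note euler_f_cubed_cong_5[OF assms, of n, folded of_int_gf5_eq_iff]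
  thus "fps_nth (theta (theta (reduce (euler_f k) ^ 3)) - fps_const (of_int (2 * (3 * int k))) * theta (reduce (euler_f k) ^ 3)
      + fps_const (of_int ((3 * int k)\<^sup>2)) * reduce (euler_f k) ^ 3) n
    = fps_nth (- (fps_const (of_int ((int k)\<^sup>2)) * reduce (euler_f k) ^ 3)) n"
    unfolding reduce_power[symmetric] theta_ode_nth
    unfolding fps_mult_left_const_nth fps_neg_nth reduce_nth by (simp only: of_int_mult of_int_minus)
qed

lemma reduce_gauss_phi_ode:
  "theta (theta (reduce gauss_phi)) = reduce gauss_phi - reduce gauss_phi ^ 25"
proof (rule fps_ext)
  fix n
  have "fps_nth (reduce gauss_phi ^ 25) n
      = of_int (if 25 dvd n then fps_nth gauss_phi (n div 25) else 0)"
    by (simp add: fps_nth_power_25 reduce_nth)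
  moreover note gauss_phi_cong_5[of n, folded of_int_gf5_eq_iff]
  ultimately show "fps_nth (theta (theta (reduce gauss_phi))) n
    = fps_nth (reduce gauss_phi - reduce gauss_phi ^ 25) n"
    by (simp add: theta_nth reduce_nth power2_eq_square mult.assoc)
qed

lemma eo_half_cong_5: "[fps_nth eo_half (125 * n + 52) = 3 * fps_nth eo_half (5 * n + 2)] (mod 5)"
proof -
  have const: "fps_const (of_int 1 :: gf5) = 1" "fps_const (of_int 2 :: gf5) = 2" "fps_const (of_int 4 :: gf5) = 4"
    "fps_const (of_int 6 :: gf5) = 6" "fps_const (of_int 9 :: gf5) = 9" "fps_const (of_int 12 :: gf5) = 12"
    "fps_const (of_int 36 :: gf5) = 36"
    by (simp_all add: numeral_fps_const)
  interpret eta_mod_5 "reduce (euler_f 1)" "reduce (euler_f 2)" "reduce gauss_phi" "reduce eo_half"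
  proof
    show "fps_nth (reduce (euler_f 1)) 0 = 1" "fps_nth (reduce (euler_f 2)) 0 = 1"
      by (simp_all add: reduce_nth euler_f_has_prod(2))
    show "reduce gauss_phi * reduce (euler_f 2) = (reduce (euler_f 1))\<^sup>2"
      using gauss_phi_mult_euler_f by (simp flip: reduce_mult reduce_power)
    show "reduce eo_half * (reduce (euler_f 1))\<^sup>2 = (reduce (euler_f 2))\<^sup>2"
      using eo_half_mult by (simp flip: reduce_mult reduce_power)
    show "theta (theta (reduce (euler_f 1))) - 2 * theta (reduce (euler_f 1)) + reduce (euler_f 1)
        = reduce (euler_f 1) + fps_X * reduce (euler_f 1) ^ 25"
      using reduce_euler_f_ode[of 1] const by simp
    show "theta (theta (reduce (euler_f 1) ^ 3)) - 6 * theta (reduce (euler_f 1) ^ 3) + 9 * reduce (euler_f 1) ^ 3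
        = - (reduce (euler_f 1) ^ 3)"
      using reduce_euler_f_cubed_ode[of 1] const by simp
    show "theta (theta (reduce (euler_f 2))) - 4 * theta (reduce (euler_f 2)) + 4 * reduce (euler_f 2)
        = 4 * (reduce (euler_f 2) + fps_X\<^sup>2 * reduce (euler_f 2) ^ 25)"
      using reduce_euler_f_ode[of 2] const by simp
    show "theta (theta (reduce (euler_f 2) ^ 3)) - 12 * theta (reduce (euler_f 2) ^ 3) + 36 * reduce (euler_f 2) ^ 3
        = - (4 * reduce (euler_f 2) ^ 3)"
      using reduce_euler_f_cubed_ode[of 2] const by simp
    show "theta (theta (reduce gauss_phi)) = reduce gauss_phi - reduce gauss_phi ^ 25"
      by (rule reduce_gauss_phi_ode)
  qed
  have "(of_int (fps_nth eo_half (125 * n + 52)) :: gf5) = of_int (3 * fps_nth eo_half (5 * n + 2))"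
    using A_nth_125[of n] by (simp add: reduce_nth)
  thus ?thesis unfolding of_int_gf5_eq_iff .
qed

theorem corollary3p1:
  fixes n k :: nat
  shows "[EO_u (2 * 5 ^ (2 * k + 3) * n + (5 ^ (2 * k + 4) - 1) div 6)
            = 3 ^ (k + 1) * EO_u (10 * n + 4)] (mod 5)
       \<and> (\<forall>r \<in> {1, 2, 3, 4}.
           [EO_u (2 * 5 ^ (2 * k + 2) * n + 2 * 5 ^ (2 * k + 1) * r
                  + (5 ^ (2 * k + 2) - 1) div 6) = 0] (mod 16))"
proof
  \<comment> \<open>\<open>25 ^ j = 24 * c j + 1\<close>, so \<open>(5 ^ (2 * j) - 1) div 6\<close>
    is \<open>4 * c j\<close>, and halving the argument of \<open>EO_u\<close> leaves
    \<open>2 * c j\<close>.\<close>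
  define c where "c j = (25 ^ j - 1) div (24 :: nat)" for j
  have c: "25 ^ j = 24 * c j + 1" for j
  proof -
    have "[25 ^ j = 1 ^ j] (mod (24 :: nat))" by (rule cong_pow) (simp add: cong_def)
    hence "24 dvd (25 ^ j - 1 :: nat)" unfolding power_one by (rule cong_to_1_nat)
    thus ?thesis by (simp add: c_def)
  qed
  have c_Suc: "c (Suc j) = 25 * c j + 1" for j
    using c[of j] c[of "Suc j"] by simp
  have pow: "(5 :: nat) ^ (2 * j) = 25 ^ j" for j
    by (simp add: power_mult)
  have step: "[fps_nth eo_half (5 ^ (2 * k + 3) * n + 2 * c (k + 2)) = 3 ^ (k + 1) * fps_nth eo_half (5 * n + 2)] (mod 5)"
  proof (induction k)
    case 0
    have "5 ^ (2 * 0 + 3) * n + 2 * c (0 + 2) = 125 * n + 52" by (simp add: c_def)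
    thus ?case using eo_half_cong_5[of n] by (simp only:) simp
  next
    case (Suc k)
    \<comment> \<open>Chosen so that \<open>5 * x + 2\<close> is the index for \<open>k\<close>;
      then \<open>125 * x + 52\<close> is the index for \<open>Suc k\<close>.\<close>
    define x where "x = 5 ^ (2 * k + 2) * n + 10 * c (Suc k)"
    have 1: "5 * x + 2 = 5 ^ (2 * k + 3) * n + 2 * c (k + 2)"
      unfolding x_def by (simp add: c_Suc numeral_3_eq_3)
    have 2: "125 * x + 52 = 5 ^ (2 * Suc k + 3) * n + 2 * c (Suc k + 2)"
      unfolding x_def by (simp add: c_Suc numeral_3_eq_3)
    have "[fps_nth eo_half (125 * x + 52) = 3 * fps_nth eo_half (5 * x + 2)] (mod 5)"
      by (rule eo_half_cong_5)
    also have "[3 * fps_nth eo_half (5 * x + 2) = 3 * (3 ^ (k + 1) * fps_nth eo_half (5 * n + 2))] (mod 5)"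
      unfolding 1 by (intro cong_mult cong_refl Suc.IH)
    finally show ?case unfolding 2 by (simp add: mult.assoc)
  qed
  have exp: "2 * k + 4 = 2 * (k + 2)" by simp
  have "(5 ^ (2 * k + 4) - 1) div 6 = 2 * (2 * c (k + 2))"
    unfolding exp pow c by simp
  hence "2 * 5 ^ (2 * k + 3) * n + (5 ^ (2 * k + 4) - 1) div 6 = 2 * (5 ^ (2 * k + 3) * n + 2 * c (k + 2))"
    by simp
  moreover have "10 * n + 4 = 2 * (5 * n + 2)" by simp
  ultimately show "[EO_u (2 * 5 ^ (2 * k + 3) * n + (5 ^ (2 * k + 4) - 1) div 6)
      = 3 ^ (k + 1) * EO_u (10 * n + 4)] (mod 5)"
    using step by (simp only: EO_u_even)
  show "\<forall>r \<in> {1, 2, 3, 4}.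
      [EO_u (2 * 5 ^ (2 * k + 2) * n + 2 * 5 ^ (2 * k + 1) * r + (5 ^ (2 * k + 2) - 1) div 6) = 0] (mod 16)"
  proof
    fix r :: nat assume r: "r \<in> {1, 2, 3, 4}"
    define m where "m = 5 ^ (2 * k + 2) * n + 5 ^ (2 * k + 1) * r + 2 * c (k + 1)"
    \<comment> \<open>The cofactor of \<open>5 ^ (2 * k + 1)\<close> in \<open>12 * m + 1\<close>;
      modulo 5 it is \<open>2 * r\<close>, which is where \<open>r\<close> prime to 5
      enters.\<close>
    define L where "L = 60 * n + 12 * r + 5"
    have "\<not> 5 dvd L" using r unfolding L_def by auto presburger+
    moreover have "5 ^ (2 * k + 1) * L = 12 * m + 1"
    proof -
      have e: "(5 :: nat) ^ (2 * k + 1) = 5 * 25 ^ k" "(5 :: nat) ^ (2 * k + 2) = 25 * 25 ^ k"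
        by (simp_all add: pow)
      have "5 * 25 ^ k * L = 12 * (25 * 25 ^ k * n + 5 * 25 ^ k * r) + 25 ^ (k + 1)"
        unfolding L_def by (simp add: algebra_simps)
      thus ?thesis unfolding m_def e c by simp
    qed
    ultimately have "16 dvd fps_nth eo_half m" by (rule eo_half_dvd_16)
    moreover have "2 * 5 ^ (2 * k + 2) * n + 2 * 5 ^ (2 * k + 1) * r + (5 ^ (2 * k + 2) - 1) div 6 = 2 * m"
    proof -
      have exp: "2 * k + 2 = 2 * (k + 1)" by simp
      have "(5 ^ (2 * k + 2) - 1) div 6 = 2 * (2 * c (k + 1))"
        unfolding exp pow c by simp
      thus ?thesis unfolding m_def by simp
    qed
    ultimately show "[EO_u (2 * 5 ^ (2 * k + 2) * n + 2 * 5 ^ (2 * k + 1) * r + (5 ^ (2 * k + 2) - 1) div 6) = 0] (mod 16)"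
      by (simp only: EO_u_even cong_0_iff)
  qed
qed

end
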